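(* Let $f$ and $c_i$ ($i\in\mathcal{E}\cup\mathcal{I}$) be polynomials in $\mathbb{R}[x]$, $x=(x_1,\dots,x_n)$, where $\mathcal{E},\mathcal{I}$ are disjoint finite index sets, and consider the problem $$f_{\min}:=\min f(x)\quad\text{s.t. } c_i(x)=0\ (i\in\mathcal{E}),\ c_j(x)\ge 0\ (j\in\mathcal{I}).$$ Let $\mathcal{K}$, $\mathcal{K}_c$ be the sets of critical pairs and critical points (defined in the context). Suppose $\mathcal{K}_c\neq\emptyset$ and that Assumption A holds with polynomials $p_i$, and let $\phi,\psi$, $f_c$, $f_k$, $f_k'$ be as defined in the context. If (i) $\mathrm{IQ}(c_{eq},c_{in})+\mathrm{IQ}(\phi,\psi)$ is archimedean, or (ii) $\mathrm{IQ}(c_{eq},c_{in})$ is archimedean, or (iii) Assumption B holds, then $f_k=f_k'=f_c$ for all $k$ sufficiently large. Consequently, if the minimum value $f_{\min}$ is achieved at a critical point (i.e., at a feasible point $u\in\mathcal{K}_c$), then $f_k=f_k'=f_{\min}$ for all $k$ sufficiently large provided one of (i)–(iii) holds.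
   Context: Notation: $\mathbb{R}[x]_d$ is the space of real polynomials of degree $\le d$; $\Sigma[x]$ is the cone of sums of squares of polynomials and $\Sigma[x]_d=\Sigma[x]\cap\mathbb{R}[x]_d$. Write $c_{eq}=(c_i)_{i\in\mathcal{E}}$, $c_{in}=(c_j)_{j\in\mathcal{I}}$. Critical pairs: $\mathcal{K}=\{(x,\lambda)\in\mathbb{R}^n\times\mathbb{R}^{\mathcal{E}\cup\mathcal{I}} : c_i(x)=0\ (i\in\mathcal{E}),\ \lambda_jc_j(x)=0\ (j\in\mathcal{I}),\ \nabla f(x)=\sum_{i\in\mathcal{E}\cup\mathcal{I}}\lambda_i\nabla c_i(x)\}$, and $\mathcal{K}_c=\{u:\exists\lambda,\ (u,\lambda)\in\mathcal{K}\}$ (the real critical points). Assumption A: for each $i\in\mathcal{E}\cup\mathcal{I}$ there is a polynomial $p_i\in\mathbb{R}[x]$ such that $\lambda_i=p_i(x)$ for all $(x,\lambda)\in\mathcal{K}$. Given such $p_i$, define the polynomial tuples $\phi=\big(\nabla f-\sum_{i\in\mathcal{E}\cup\mathcal{I}}p_i\nabla c_i,\ (p_jc_j)_{j\in\mathcal{I}}\big)$ (the $n$ entries of the vector followed by the products $p_jc_j$) and $\psi=(p_j)_{j\in\mathcal{I}}$. Let $f_c$ be the optimal value of $\min f(x)$ s.t. $c_{eq}(x)=0,\ c_{in}(x)\ge0,\ \phi(x)=0,\ \psi(x)\ge0$, with $f_c=+\infty$ if this problem is infeasible. For tuples $h=(h_1,\dots,h_s)$, $g=(g_1,\dots,g_t)$: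 $\mathrm{Ideal}(h)=\sum h_i\mathbb{R}[x]$, $\mathrm{Ideal}(h)_{2k}=\sum h_i\mathbb{R}[x]_{2k-\deg h_i}$; $\mathrm{Qmod}(g)=\Sigma[x]+\sum g_i\Sigma[x]$, $\mathrm{Qmod}(g)_{2k}=\Sigma[x]_{2k}+\sum g_i\Sigma[x]_{2k-\deg g_i}$; $\mathrm{IQ}(h,g)=\mathrm{Ideal}(h)+\mathrm{Qmod}(g)$ and $\mathrm{IQ}(h,g)_{2k}=\mathrm{Ideal}(h)_{2k}+\mathrm{Qmod}(g)_{2k}$. A set $\mathrm{IQ}(h,g)$ (or a sum of such sets) is archimedean if it contains a polynomial $p$ such that $\{x\in\mathbb{R}^n:p(x)\ge0\}$ is compact. Assumption B: there exists $\rho\in\mathrm{Qmod}(c_{in},\psi)$ such that for every $u\in\mathcal{K}_c$ with $f(u)<f_c$ one has $\rho(u)<0$. Moment relaxations: for $y=(y_\alpha)_{\alpha\in\mathbb{N}^n_{2k}}$ (indexed by exponents with $|\alpha|\le 2k$), let $\langle\sum f_\alpha x^\alpha,y\rangle=\sum f_\alpha y_\alpha$. For $q\in\mathbb{R}[x]_{2k}$ the localizing matrix $L_q^{(k)}(y)$ is the symmetric matrix with $\mathrm{vec}(a_1)^TL_q^{(k)}(y)\mathrm{vec}(a_2)=\langle qa_1a_2,y\rangle$ for all $a_1,a_2\in\mathbb{R}[x]_{k-\lceil\deg(q)/2\rceil}$ (vec = coefficient vector); $M_k(y)=L_1^{(k)}(y)$; for a tuple $q$, $L_q^{(k)}(y)$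 is the block diagonal matrix of the $L_{q_i}^{(k)}(y)$. Define $f_k'=\min\langle f,y\rangle$ s.t. $\langle1,y\rangle=1$, $M_k(y)\succeq0$, $L_{c_{eq}}^{(k)}(y)=0$, $L_{c_{in}}^{(k)}(y)\succeq0$, $L_\phi^{(k)}(y)=0$, $L_\psi^{(k)}(y)\succeq0$, $y\in\mathbb{R}^{\mathbb{N}^n_{2k}}$; and $f_k=\max\gamma$ s.t. $f-\gamma\in\mathrm{IQ}(c_{eq},c_{in})_{2k}+\mathrm{IQ}(\phi,\psi)_{2k}$. *)

theory Defs
  imports "HOL-Analysis.Analysis" "HOL-Library.Poly_Mapping"
begin

text \<open>Real multivariate polynomials in the variables indexed by the finite type 'v
  (so n = CARD('v)), represented by their coefficients: a polynomial is a finitely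
  supported map from exponent vectors (monomials) to real coefficients.
  Points of R^n are vectors of type real^'v.\<close>

type_synonym 'v mpoly = "('v \<Rightarrow>\<^sub>0 nat) \<Rightarrow>\<^sub>0 real"

definition mdeg_mono :: "('v::finite \<Rightarrow>\<^sub>0 nat) \<Rightarrow> nat" where
  "mdeg_mono a = (\<Sum>v\<in>UNIV. Poly_Mapping.lookup a v)"

text \<open>Total degree (the zero polynomial gets degree 0; it lies in every R[x]_d with d \<ge> 0).\<close>
definition mdeg :: "'v::finite mpoly \<Rightarrow> nat" where
  "mdeg p = Max (insert 0 (mdeg_mono ` Poly_Mapping.keys p))"

definition mconst :: "real \<Rightarrow> 'v::finite mpoly" where
  "mconst c = Poly_Mapping.single 0 c"

definition meval :: "'v::finite mpoly \<Rightarrow> real^'v \<Rightarrow> real" where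
  "meval p x = (\<Sum>a\<in>Poly_Mapping.keys p. Poly_Mapping.lookup p a * (\<Prod>v\<in>UNIV. (x $ v) ^ Poly_Mapping.lookup a v))"

definition mpderiv :: "'v::finite \<Rightarrow> 'v mpoly \<Rightarrow> 'v mpoly" where
  "mpderiv v p = (\<Sum>a\<in>Poly_Mapping.keys p.
     Poly_Mapping.single (a - Poly_Mapping.single v 1) (Poly_Mapping.lookup p a * real (Poly_Mapping.lookup a v)))"

definition poly_space :: "int \<Rightarrow> 'v::finite mpoly set" where
  "poly_space d = {p. p = 0 \<or> int (mdeg p) \<le> d}"

definition SOS :: "'v::finite mpoly set" where
  "SOS = {p. \<exists>qs. p = sum_list (map (\<lambda>q. q * q) qs)}"

definition SOS_trunc :: "int \<Rightarrow> 'v::finite mpoly set" where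
  "SOS_trunc d = SOS \<inter> poly_space d"

text \<open>Tuples of polynomials are represented by finite sets of polynomials
  (Ideal and Qmod, and their truncations, depend only on the set of entries).\<close>

definition Ideal :: "'v::finite mpoly set \<Rightarrow> 'v mpoly set" where
  "Ideal H = {q. \<exists>a. q = (\<Sum>h\<in>H. h * a h)}"

definition Ideal_trunc :: "'v::finite mpoly set \<Rightarrow> nat \<Rightarrow> 'v mpoly set" where
  "Ideal_trunc H d = {q. \<exists>a. (\<forall>h\<in>H. a h \<in> poly_space (int d - int (mdeg h)))
      \<and> q = (\<Sum>h\<in>H. h * a h)}"

definition Qmod :: "'v::finite mpoly set \<Rightarrow> 'v mpoly set" where
  "Qmod G = {q. \<exists>s0 s. s0 \<in> SOS \<and> (\<forall>g\<in>G. s g \<in> SOS) \<and> q = s0 + (\<Sum>g\<in>G. g * s g)}"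

definition Qmod_trunc :: "'v::finite mpoly set \<Rightarrow> nat \<Rightarrow> 'v mpoly set" where
  "Qmod_trunc G d = {q. \<exists>s0 s. s0 \<in> SOS_trunc (int d)
      \<and> (\<forall>g\<in>G. s g \<in> SOS_trunc (int d - int (mdeg g))) \<and> q = s0 + (\<Sum>g\<in>G. g * s g)}"

definition IQ :: "'v::finite mpoly set \<Rightarrow> 'v mpoly set \<Rightarrow> 'v mpoly set" where
  "IQ H G = {a + b | a b. a \<in> Ideal H \<and> b \<in> Qmod G}"

definition IQ_trunc :: "'v::finite mpoly set \<Rightarrow> 'v mpoly set \<Rightarrow> nat \<Rightarrow> 'v mpoly set" where
  "IQ_trunc H G d = {a + b | a b. a \<in> Ideal_trunc H d \<and> b \<in> Qmod_trunc G d}"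

definition set_plus_mp :: "'v::finite mpoly set \<Rightarrow> 'v mpoly set \<Rightarrow> 'v mpoly set" where
  "set_plus_mp A B = {a + b | a b. a \<in> A \<and> b \<in> B}"

definition archimedean :: "'v::finite mpoly set \<Rightarrow> bool" where
  "archimedean S \<longleftrightarrow> (\<exists>p\<in>S. compact {x. meval p x \<ge> 0})"

text \<open>Moment vectors y indexed by monomials; a y \<in> R^{N^n_{2k}} is represented as a
  function vanishing on monomials of degree > 2k.\<close>
definition mpair :: "'v::finite mpoly \<Rightarrow> (('v \<Rightarrow>\<^sub>0 nat) \<Rightarrow> real) \<Rightarrow> real" where
  "mpair p y = (\<Sum>a\<in>Poly_Mapping.keys p. Poly_Mapping.lookup p a * y a)"

text \<open>L_q^{(k)}(y) is the symmetric matrix of the bilinear form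
  (a1,a2) \<mapsto> <q a1 a2, y> on R[x]_{k - ceil(deg q / 2)}; these predicates say it is
  positive semidefinite, resp. zero.\<close>
definition loc_psd :: "nat \<Rightarrow> 'v::finite mpoly \<Rightarrow> (('v \<Rightarrow>\<^sub>0 nat) \<Rightarrow> real) \<Rightarrow> bool" where
  "loc_psd k q y \<longleftrightarrow> (\<forall>a\<in>poly_space (int k - int ((mdeg q + 1) div 2)). mpair (q * a * a) y \<ge> 0)"

definition loc_zero :: "nat \<Rightarrow> 'v::finite mpoly \<Rightarrow> (('v \<Rightarrow>\<^sub>0 nat) \<Rightarrow> real) \<Rightarrow> bool" where
  "loc_zero k q y \<longleftrightarrow> (\<forall>a1\<in>poly_space (int k - int ((mdeg q + 1) div 2)).
      \<forall>a2\<in>poly_space (int k - int ((mdeg q + 1) div 2)). mpair (q * a1 * a2) y = 0)"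

definition crit_pairs :: "'v::finite mpoly \<Rightarrow> ('i \<Rightarrow> 'v mpoly) \<Rightarrow> 'i set \<Rightarrow> 'i set
    \<Rightarrow> ((real^'v) \<times> ('i \<Rightarrow> real)) set" where
  "crit_pairs f c E I = {(x, lam).
      (\<forall>i\<in>E. meval (c i) x = 0) \<and> (\<forall>j\<in>I. lam j * meval (c j) x = 0) \<and>
      (\<forall>v. meval (mpderiv v f) x = (\<Sum>i\<in>E \<union> I. lam i * meval (mpderiv v (c i)) x))}"

definition crit_points :: "'v::finite mpoly \<Rightarrow> ('i \<Rightarrow> 'v mpoly) \<Rightarrow> 'i set \<Rightarrow> 'i set
    \<Rightarrow> (real^'v) set" where
  "crit_points f c E I = {u. \<exists>lam. (u, lam) \<in> crit_pairs f c E I}"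

definition phi_set :: "'v::finite mpoly \<Rightarrow> ('i \<Rightarrow> 'v mpoly) \<Rightarrow> ('i \<Rightarrow> 'v mpoly)
    \<Rightarrow> 'i set \<Rightarrow> 'i set \<Rightarrow> 'v mpoly set" where
  "phi_set f c p E I =
     range (\<lambda>v. mpderiv v f - (\<Sum>i\<in>E \<union> I. p i * mpderiv v (c i))) \<union> (\<lambda>j. p j * c j) ` I"

definition psi_set :: "('i \<Rightarrow> 'v::finite mpoly) \<Rightarrow> 'i set \<Rightarrow> 'v mpoly set" where
  "psi_set p I = p ` I"

definition feasible :: "('i \<Rightarrow> 'v::finite mpoly) \<Rightarrow> 'i set \<Rightarrow> 'i set \<Rightarrow> real^'v \<Rightarrow> bool" where
  "feasible c E I x \<longleftrightarrow> (\<forall>i\<in>E. meval (c i) x = 0) \<and> (\<forall>j\<in>I. meval (c j) x \<ge> 0)"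

text \<open>f_c (= +\<infinity> if infeasible).\<close>
definition f_c :: "'v::finite mpoly \<Rightarrow> ('i \<Rightarrow> 'v mpoly) \<Rightarrow> ('i \<Rightarrow> 'v mpoly)
    \<Rightarrow> 'i set \<Rightarrow> 'i set \<Rightarrow> ereal" where
  "f_c f c p E I = Inf {ereal (meval f x) | x. feasible c E I x
      \<and> (\<forall>q\<in>phi_set f c p E I. meval q x = 0) \<and> (\<forall>q\<in>psi_set p I. meval q x \<ge> 0)}"

definition f_mom :: "nat \<Rightarrow> 'v::finite mpoly \<Rightarrow> ('i \<Rightarrow> 'v mpoly) \<Rightarrow> ('i \<Rightarrow> 'v mpoly)
    \<Rightarrow> 'i set \<Rightarrow> 'i set \<Rightarrow> ereal" where
  "f_mom k f c p E I = Inf {ereal (mpair f y) | y.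
      (\<forall>a. mdeg_mono a > 2 * k \<longrightarrow> y a = 0) \<and>
      mpair 1 y = 1 \<and> loc_psd k 1 y \<and>
      (\<forall>i\<in>E. loc_zero k (c i) y) \<and> (\<forall>j\<in>I. loc_psd k (c j) y) \<and>
      (\<forall>q\<in>phi_set f c p E I. loc_zero k q y) \<and> (\<forall>q\<in>psi_set p I. loc_psd k q y)}"

definition f_sos :: "nat \<Rightarrow> 'v::finite mpoly \<Rightarrow> ('i \<Rightarrow> 'v mpoly) \<Rightarrow> ('i \<Rightarrow> 'v mpoly)
    \<Rightarrow> 'i set \<Rightarrow> 'i set \<Rightarrow> ereal" where
  "f_sos k f c p E I = Sup {ereal \<gamma> | \<gamma>. f - mconst \<gamma> \<in>
      set_plus_mp (IQ_trunc (c ` E) (c ` I) (2 * k)) (IQ_trunc (phi_set f c p E I) (psi_set p I) (2 * k))}"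

end

theory Submission
  imports Defs "HOL-Algebra.Algebraic_Closure_Type" "Berlekamp_Zassenhaus.Finite_Field"
begin

text \<open>
  Let \<open>M\<close> be the quadratic module with ideal generated by all constraints of the problem defining \<open>f\<^sub>c\<close>.
  It suffices to find reals \<open>v\<^sub>i \<ge> f\<^sub>c\<close> with \<open>- \<pi>(f)\<^sup>2 \<in> M\<close> for \<open>\<pi> = \<Prod>\<^sub>i (t - v\<^sub>i)\<close>: for \<open>\<gamma> < f\<^sub>c\<close> the
  univariate polynomial \<open>t - \<gamma> + C \<pi>\<^sup>2\<close> is nonnegative for large \<open>C\<close>, hence a sum of squares, and
  substituting \<open>f\<close> certifies \<open>f - \<gamma>\<close> in a degree that does not depend on \<open>\<gamma>\<close>.

  Suppose \<open>\<rho> \<in> M\<close> is negative at all critical points with \<open>f < f\<^sub>c\<close>. If no such \<open>\<pi>\<close> existed, Zorn's lemma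
  would give a prime cone of the polynomial ring containing \<open>\<rho>\<close> and, in its support, the critical
  equations, but no \<open>\<pi>(f)\<close>. In its residue field every derivation kills \<open>f\<close>, because \<open>df = \<Sum> p\<^sub>i dc\<^sub>i\<close> and
  \<open>p\<^sub>i = 0\<close> or \<open>c\<^sub>i = 0\<close>; hence \<open>f\<close> is algebraic over the reals, so it is a real number \<open>v\<close>, and \<open>v < f\<^sub>c\<close>. By the
  Artin--Lang theorem there is a real critical point with \<open>f = v\<close> and \<open>\<rho> \<ge> 0\<close>, a contradiction. The
  Artin--Lang theorem is proved by embedding the residue field into a real closed field and transferring
  sign conditions to the reals one variable at a time.

  In the archimedean cases such a \<open>\<rho>\<close> is constructed: \<open>f\<close> takes finitely many values at the critical points,
  on the compact set of those with \<open>f < f\<^sub>c\<close> some combination \<open>\<Sum> g (1 - g / N)\<^sup>2\<^sup>l\<close> of the inequality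
  constraints is negative, and Woermann's argument extends this to all critical points with \<open>f < f\<^sub>c\<close>.

  At a minimizer, Assumption A makes the multipliers unique, so the active gradients are linearly
  independent and the multipliers of the inequalities are nonnegative; therefore \<open>f\<^sub>c = f\<^sub>m\<^sub>i\<^sub>n\<close>.
\<close>

hide_const (open) Polynomials.degree Polynomials.lead_coeff up_ring.monom up_ring.coeff module.smult Coset.order

section \<open>Real closed fields\<close>

(* The intermediate value property is stated for coefficient sequences because polynomials over the
   type variable of a class are not available inside the class. *)

class real_closed_field = linordered_field +
  assumes sum_IVT: "a < b \<Longrightarrow> (\<Sum>k\<le>n. f k * a ^ k) < 0 \<Longrightarrow> (\<Sum>k\<le>n. f k * b ^ k) > 0 \<Longrightarrow>
    \<exists>x>a. x < b \<and> (\<Sum>k\<le>n. f k * x ^ k) = 0"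

lemma sum_powers_conv_poly:
  "(\<Sum>k\<le>n. f k * x ^ k) = poly (\<Sum>k\<le>n. monom (f k) k) (x::'a::comm_semiring_1)"
  by (simp add: poly_sum poly_monom)

instance real :: real_closed_field
  by standard (unfold sum_powers_conv_poly, rule poly_IVT_pos)

lemma real_closed_IVT_pos:
  fixes f :: "'a::real_closed_field poly"
  assumes "a < b" "poly f a < 0" "poly f b > 0"
  shows "\<exists>x>a. x < b \<and> poly f x = 0"
  using sum_IVT[where a=a and b=b and n="degree f" and f="coeff f"] assms by (simp add: poly_altdef)

lemma real_closed_IVT:
  fixes f :: "'a::real_closed_field poly"
  assumes "a < b" "poly f a * poly f b < 0"
  shows "\<exists>x>a. x < b \<and> poly f x = 0"
proof (cases "poly f a < 0")
  case True
  with assms show ?thesis using real_closed_IVT_pos[of a b f] by (auto simp: mult_less_0_iff)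
next
  case False
  with assms show ?thesis using real_closed_IVT_pos[of a b "-f"] by (auto simp: mult_less_0_iff)
qed

lemma next_root_exists:
  fixes f :: "'a::linordered_field poly"
  assumes "f \<noteq> 0" "a < b" "poly f b = 0"
  obtains d where "a < d" "d \<le> b" "poly f d = 0" "\<And>x. a < x \<Longrightarrow> x < d \<Longrightarrow> poly f x \<noteq> 0"
proof -
  define S where "S = {x. a < x \<and> x \<le> b \<and> poly f x = 0}"
  have "finite S" by (rule finite_subset[OF _ poly_roots_finite[OF assms(1)]]) (auto simp: S_def)
  moreover have "b \<in> S" using assms by (simp add: S_def)
  ultimately have Min_S: "Min S \<in> S" "\<And>x. x \<in> S \<Longrightarrow> Min S \<le> x" by (auto intro: Min_in)
  show thesis
  proof (rule that[of "Min S"])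
    show "a < Min S" "Min S \<le> b" "poly f (Min S) = 0" using Min_S(1) by (auto simp: S_def)
    show "poly f x \<noteq> 0" if "a < x" "x < Min S" for x
      using that Min_S(2)[of x] \<open>Min S \<le> b\<close> by (force simp: S_def)
  qed
qed

lemma root_order_factorization:
  fixes f :: "'a::idom poly"
  assumes "f \<noteq> 0" "poly f a = 0"
  obtains n g where "f = [:-a, 1:] ^ Suc n * g" "poly g a \<noteq> 0"
proof -
  obtain g where "f = [:-a, 1:] ^ order a f * g" "\<not> [:-a, 1:] dvd g"
    using order_decomp[OF assms(1)] by blast
  moreover have "order a f \<noteq> 0" using assms by (simp add: order_root)
  ultimately show thesis using that by (metis not0_implies_Suc poly_eq_0_iff_dvd)
qed

lemma two_roots_factorization:
  fixes f :: "'a::idom poly"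
  assumes "f \<noteq> 0" "a \<noteq> d" "poly f a = 0" "poly f d = 0"
  obtains m n g where "f = [:-a, 1:] ^ Suc m * ([:-d, 1:] ^ Suc n * g)" "poly g a \<noteq> 0" "poly g d \<noteq> 0"
proof -
  obtain m g where g: "f = [:-a, 1:] ^ Suc m * g" "poly g a \<noteq> 0"
    by (rule root_order_factorization[OF assms(1,3)])
  have "g \<noteq> 0" "poly g d = 0" using g assms by (auto simp: poly_power)
  then obtain n h where "g = [:-d, 1:] ^ Suc n * h" "poly h d \<noteq> 0" by (rule root_order_factorization)
  moreover from this have "poly h a \<noteq> 0" using g(2) by auto
  ultimately show thesis using that g(1) by blast
qed

lemma pderiv_powers_mult:
  fixes p q g :: "'a::idom poly"
  assumes "pderiv p = 1" "pderiv q = 1"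
  shows "pderiv (p ^ Suc m * (q ^ Suc n * g)) =
    p ^ m * q ^ n * (of_nat (Suc m) * (q * g) + of_nat (Suc n) * (p * g) + p * q * pderiv g)"
proof -
  have "smult (of_nat k) r = of_nat k * r" for k and r :: "'a poly" by (simp add: of_nat_poly)
  then show ?thesis
    unfolding pderiv_mult pderiv_power_Suc assms by (simp add: algebra_simps del: of_nat_Suc)
qed

(* With f = (X - a)^(m+1) (X - d)^(n+1) g, the derivative is (X - a)^m (X - d)^n h, and h has
   opposite signs at a and d because g has the same sign there. *)

lemma Rolle_consecutive_roots:
  fixes f :: "'a::real_closed_field poly"
  assumes "f \<noteq> 0" "a < d" "poly f a = 0" "poly f d = 0"
    and no_root: "\<And>x. a < x \<Longrightarrow> x < d \<Longrightarrow> poly f x \<noteq> 0"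
  shows "\<exists>x>a. x < d \<and> poly (pderiv f) x = 0"
proof -
  have "a \<noteq> d" using assms(2) by simp
  then obtain m n g where f: "f = [:-a, 1:] ^ Suc m * ([:-d, 1:] ^ Suc n * g)"
    and g: "poly g a \<noteq> 0" "poly g d \<noteq> 0"
    using two_roots_factorization assms(1,3,4) by metis
  have "\<not> poly g a * poly g d < 0"
    using real_closed_IVT[OF assms(2), of g] no_root unfolding f by auto
  with g have g_pos: "poly g a * poly g d > 0" by (metis mult_eq_0_iff linorder_neqE)
  define h where
    "h = of_nat (Suc m) * ([:-d, 1:] * g) + of_nat (Suc n) * ([:-a, 1:] * g) + [:-a, 1:] * [:-d, 1:] * pderiv g"
  have pderiv_f: "pderiv f = [:-a, 1:] ^ m * [:-d, 1:] ^ n * h"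
    unfolding f h_def by (rule pderiv_powers_mult) (simp_all add: pderiv_pCons)
  have h_a: "poly h a = of_nat (Suc m) * (a - d) * poly g a"
    and h_d: "poly h d = of_nat (Suc n) * (d - a) * poly g d"
    by (simp_all add: h_def of_nat_poly algebra_simps)
  have "poly h a * poly h d =
      - (of_nat (Suc m) * of_nat (Suc n) * ((d - a) * (d - a)) * (poly g a * poly g d))"
    unfolding h_a h_d by (simp add: algebra_simps del: of_nat_Suc)
  also have "\<dots> < 0" using assms(2) g_pos by (simp del: of_nat_Suc)
  finally obtain x where "x > a" "x < d" "poly h x = 0" using real_closed_IVT[OF assms(2)] by blast
  then show ?thesis using pderiv_f by auto
qed

lemma real_closed_Rolle:
  fixes f :: "'a::real_closed_field poly"
  assumes "a < b" "poly f a = 0" "poly f b = 0"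
  shows "\<exists>x>a. x < b \<and> poly (pderiv f) x = 0"
proof (cases "f = 0")
  case True
  then show ?thesis using dense[OF assms(1)] by auto
next
  case False
  obtain d where "a < d" "d \<le> b" "poly f d = 0" "\<And>x. a < x \<Longrightarrow> x < d \<Longrightarrow> poly f x \<noteq> 0"
    using next_root_exists[OF False assms(1,3)] by blast
  with Rolle_consecutive_roots[OF False _ assms(2)] show ?thesis by force
qed

lemma real_closed_MVT:
  fixes f :: "'a::real_closed_field poly"
  assumes "a < b"
  shows "\<exists>x>a. x < b \<and> poly f b - poly f a = (b - a) * poly (pderiv f) x"
proof -
  define s where "s = (poly f b - poly f a) / (b - a)"
  define g where "g = f - [:poly f a - s * a, s:]"
  have s: "s * (b - a) = poly f b - poly f a" using assms by (simp add: s_def)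
  then have "poly g a = 0" "poly g b = 0" by (auto simp: g_def algebra_simps)
  from real_closed_Rolle[OF assms this]
  obtain x where "x > a" "x < b" "poly (pderiv g) x = 0" by blast
  then show ?thesis using s by (auto simp: g_def pderiv_diff pderiv_pCons mult.commute)
qed

lemma real_closed_increasing:
  fixes f :: "'a::real_closed_field poly"
  assumes "a < b" "\<And>x. a < x \<Longrightarrow> x < b \<Longrightarrow> poly (pderiv f) x > 0"
  shows "poly f a < poly f b"
proof -
  obtain x where x: "x > a" "x < b" "poly f b - poly f a = (b - a) * poly (pderiv f) x"
    using real_closed_MVT[OF assms(1), of f] by blast
  have "(b - a) * poly (pderiv f) x > 0" using assms x by simp
  then show ?thesis using x(3) by simp
qed

lemma poly_zero_on_interval:
  fixes f :: "'a::linordered_field poly"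
  assumes "a < b" "\<And>x. a < x \<Longrightarrow> x < b \<Longrightarrow> poly f x = 0"
  shows "f = 0"
proof (rule ccontr)
  assume "f \<noteq> 0"
  then have "finite {x. poly f x = 0}" by (rule poly_roots_finite)
  moreover have "{a<..<b} \<subseteq> {x. poly f x = 0}" using assms by auto
  ultimately show False using infinite_Ioo[OF assms(1)] finite_subset by blast
qed

section \<open>Signs\<close>

definition same_sign :: "'a::linordered_idom \<Rightarrow> 'b::linordered_idom \<Rightarrow> bool" where
  "same_sign u v \<longleftrightarrow> (u > 0 \<longleftrightarrow> v > 0) \<and> (u < 0 \<longleftrightarrow> v < 0)"

lemma same_sign_0 [simp]: "same_sign 0 0"
  by (simp add: same_sign_def)

lemma same_sign_zero_iff: "same_sign u v \<Longrightarrow> u = 0 \<longleftrightarrow> v = 0"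
  by (metis same_sign_def linorder_neq_iff)

lemma same_sign_nonneg_iff: "same_sign u v \<Longrightarrow> 0 \<le> u \<longleftrightarrow> 0 \<le> v"
  by (simp add: same_sign_def not_less[symmetric])

lemma same_sign_mult_pos_iff: "c > 0 \<Longrightarrow> d > 0 \<Longrightarrow> same_sign (c * u) (d * v) \<longleftrightarrow> same_sign u v"
  by (auto simp: same_sign_def zero_less_mult_iff mult_less_0_iff)

lemma same_sign_uminus_iff [simp]: "same_sign (- u) (- v) \<longleftrightarrow> same_sign u v"
  by (auto simp: same_sign_def)

lemma filterlim_poly_at_top:
  fixes f :: "'a::linordered_field poly"
  assumes "degree f > 0" "lead_coeff f > 0"
  shows "filterlim (poly f) at_top at_top"
  using assms
proof (induction f)
  case (pCons c g)
  have "g \<noteq> 0" using pCons.prems(1) by auto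
  then have lead_g: "lead_coeff g > 0" using pCons.prems by simp
  show ?case
    unfolding filterlim_at_top
  proof
    fix b
    show "\<forall>\<^sub>F x in at_top. b \<le> poly (pCons c g) x"
    proof (cases "degree g = 0")
      case True
      then obtain l where l: "g = [:l:]" by (rule degree_eq_zeroE)
      show ?thesis
        using eventually_ge_at_top[of "(b - c) / l"]
        by (rule eventually_mono) (use lead_g l in \<open>simp add: field_simps\<close>)
    next
      case False
      then have "\<forall>\<^sub>F x in at_top. 1 \<le> poly g x"
        using pCons.IH lead_g by (simp add: filterlim_at_top)
      with eventually_ge_at_top[of "max 0 (b - c)"] show ?thesis
      proof eventually_elim
        case (elim x)
        then have "x * 1 \<le> x * poly g x" by (intro mult_left_mono) auto
        with elim show ?case by simp
      qed
    qed
  qed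
qed simp

lemma eventually_same_sign_lead_coeff:
  fixes f :: "'a::linordered_field poly"
  shows "\<forall>\<^sub>F x in at_top. same_sign (poly f x) (lead_coeff f)"
proof (cases "degree f = 0")
  case True
  then show ?thesis by (auto elim!: degree_eq_zeroE simp: same_sign_def)
next
  case False
  have eventually_pos: "\<forall>\<^sub>F x in at_top. poly g x > 0" if "degree g > 0" "lead_coeff g > 0" for g :: "'a poly"
    using filterlim_poly_at_top[OF that] by (simp add: filterlim_at_top_dense)
  have "lead_coeff f \<noteq> 0" using False by auto
  then consider "lead_coeff f > 0" | "lead_coeff f < 0" by (rule linorder_neqE)
  then show ?thesis
  proof cases
    case 1
    with eventually_pos[of f] False show ?thesis by (auto elim!: eventually_mono simp: same_sign_def)
  next
    case 2
    with eventually_pos[of "- f"] False show ?thesis by (auto elim!: eventually_mono simp: same_sign_def)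
  qed
qed

lemma right_end_same_sign:
  fixes f :: "'a::linordered_field poly" and g :: "'b::linordered_field poly"
  assumes "same_sign (lead_coeff f) (lead_coeff g)"
  shows "\<exists>s>x. \<exists>t>y. same_sign (poly f s) (poly g t)"
proof -
  obtain s where s: "s > x" "same_sign (poly f s) (lead_coeff f)"
    using eventually_happens'[OF trivial_limit_at_top_linorder
      eventually_conj[OF eventually_gt_at_top[of x] eventually_same_sign_lead_coeff[of f]]] by blast
  obtain t where t: "t > y" "same_sign (poly g t) (lead_coeff g)"
    using eventually_happens'[OF trivial_limit_at_top_linorder
      eventually_conj[OF eventually_gt_at_top[of y] eventually_same_sign_lead_coeff[of g]]] by blast
  show ?thesis using s t assms unfolding same_sign_def by blast
qed

lemma lead_coeff_pcompose_uminus: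
  "lead_coeff (pcompose h [:0, -1:]) = (-1) ^ degree h * lead_coeff (h::'a::idom poly)"
  by (subst lead_coeff_comp) simp_all

lemma left_end_same_sign:
  fixes f :: "'a::linordered_field poly" and g :: "'b::linordered_field poly"
  assumes "degree f = degree g" "same_sign (lead_coeff f) (lead_coeff g)"
  shows "\<exists>s<x. \<exists>t<y. same_sign (poly f s) (poly g t)"
proof -
  have "same_sign (lead_coeff (pcompose f [:0, -1:])) (lead_coeff (pcompose g [:0, -1:]))"
    unfolding lead_coeff_pcompose_uminus
    using assms by (cases "even (degree g)") simp_all
  from right_end_same_sign[OF this, of "-x" "-y"]
  obtain s t where "s > - x" "t > - y" "same_sign (poly f (- s)) (poly g (- t))"
    by (auto simp: poly_pcompose)
  then show ?thesis by (intro exI[of _ "- s"] conjI exI[of _ "- t"]) (auto simp: minus_less_iff)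
qed

section \<open>Sign diagrams\<close>

(* Z pairs corresponding points of two ordered fields; x and y are matched if they lie in
   corresponding cells of the two subdivisions. *)

definition matched :: "('a::linordered_field \<times> 'b::linordered_field) set \<Rightarrow> 'a \<Rightarrow> 'b \<Rightarrow> bool" where
  "matched Z x y \<longleftrightarrow> (\<forall>(z, w)\<in>Z. (x < z \<longleftrightarrow> y < w) \<and> (x = z \<longleftrightarrow> y = w))"

definition subdivision :: "('a::linordered_field \<times> 'b::linordered_field) set \<Rightarrow> bool" where
  "subdivision Z \<longleftrightarrow> finite Z \<and> (\<forall>(z, w)\<in>Z. matched Z z w)"

definition sign_diagram ::
    "('a::linordered_field poly \<times> 'b::linordered_field poly) set \<Rightarrow> ('a \<times> 'b) set \<Rightarrow> bool" where
  "sign_diagram F Z \<longleftrightarrow> subdivision Z \<and>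
     (\<forall>(x, y)\<in>Z. \<exists>(p, q)\<in>F. p \<noteq> 0 \<and> poly p x = 0) \<and>
     (\<forall>x y. matched Z x y \<longrightarrow> (\<forall>(p, q)\<in>F. same_sign (poly p x) (poly q y)))"

lemma matched_iff:
  assumes "matched Z x y" "(z, w) \<in> Z"
  shows "x < z \<longleftrightarrow> y < w" "x = z \<longleftrightarrow> y = w" "z < x \<longleftrightarrow> w < y" "x \<le> z \<longleftrightarrow> y \<le> w" "z \<le> x \<longleftrightarrow> w \<le> y"
  using bspec[OF assms(1)[unfolded matched_def] assms(2)] by (auto simp: not_less[symmetric] neq_iff)

lemma matched_converse: "matched (Z\<inverse>) y x \<longleftrightarrow> matched Z x y"
  by (auto simp: matched_def)

lemma matched_uminus: "matched (map_prod uminus uminus ` Z) (- x) (- y) \<longleftrightarrow> matched Z x y"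
  unfolding matched_def by (force simp: neq_iff)

lemma subdivision_uminus: "subdivision Z \<Longrightarrow> subdivision (map_prod uminus uminus ` Z)"
  by (force simp: subdivision_def matched_uminus)

lemma subdivision_matched: "subdivision Z \<Longrightarrow> (z, w) \<in> Z \<Longrightarrow> matched Z z w"
  by (auto simp: subdivision_def)

lemma finite_sets_separated:
  fixes L U :: "'a::linordered_field set"
  assumes "finite L" "finite U" and less: "\<And>l u. l \<in> L \<Longrightarrow> u \<in> U \<Longrightarrow> l < u"
  obtains x where "\<And>l. l \<in> L \<Longrightarrow> l < x" "\<And>u. u \<in> U \<Longrightarrow> x < u"
proof -
  define l0 u0 where "l0 = Min (insert 0 U) - 1" and "u0 = Max (insert 0 L) + 1"
  have l0: "l0 < u" if "u \<in> insert 0 U" for u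
    using Min_le[OF _ that] assms(2) by (simp add: l0_def algebra_simps add_strict_increasing)
  have u0: "l < u0" if "l \<in> insert 0 L" for l
    using Max_ge[OF _ that] assms(1) by (simp add: u0_def add_strict_increasing2 add.commute)
  have "l < u" if "l \<in> insert l0 L" "u \<in> insert u0 U" for l u
    using that less l0 u0 less_trans[of l0 0 u0] by auto
  then have "Max (insert l0 L) < Min (insert u0 U)" using assms by simp
  then obtain x where "Max (insert l0 L) < x" "x < Min (insert u0 U)" using dense by blast
  then show thesis using that[of x] assms by simp
qed

lemma matched_exists:
  assumes Z: "subdivision Z"
  shows "\<exists>x. matched Z x y"
proof (cases "y \<in> snd ` Z")
  case True
  then show ?thesis using subdivision_matched[OF Z] by force
next
  case False
  define L U where "L = fst ` {p \<in> Z. snd p < y}" and "U = fst ` {p \<in> Z. y < snd p}"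
  have "l < u" if "l \<in> L" "u \<in> U" for l u
  proof -
    from that obtain w w' where "(l, w) \<in> Z" "w < y" "(u, w') \<in> Z" "y < w'" by (auto simp: L_def U_def)
    then show ?thesis using matched_iff(1)[OF subdivision_matched[OF Z], of l w u w'] by simp
  qed
  moreover have "finite L" "finite U" using Z by (simp_all add: L_def U_def subdivision_def)
  ultimately obtain x where x: "\<And>l. l \<in> L \<Longrightarrow> l < x" "\<And>u. u \<in> U \<Longrightarrow> x < u"
    using finite_sets_separated by metis
  have "z < x \<and> w < y \<or> x < z \<and> y < w" if "(z, w) \<in> Z" for z w
  proof -
    have "w \<noteq> y" using that False by force
    then show ?thesis using that x[of z] by (force simp: L_def U_def neq_iff)
  qed
  then have "matched Z x y" by (force simp: matched_def)
  then show ?thesis ..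
qed

lemma left_neighbour:
  assumes Z: "subdivision Z" and xy: "matched Z x y"
    and R_Z: "\<And>z w. (z, w) \<in> Z \<Longrightarrow> R z w" and R_left: "\<exists>s<x. \<exists>t<y. R s t"
  obtains a b where "a < x" "b < y" "R a b" "\<And>z w. (z, w) \<in> Z \<Longrightarrow> z < x \<Longrightarrow> z \<le> a \<and> w \<le> b"
proof (cases "\<exists>p\<in>Z. fst p < x")
  case False
  with R_left that show thesis by fastforce
next
  case True
  define L where "L = fst ` {p \<in> Z. fst p < x}"
  have L: "finite L" "L \<noteq> {}" using Z True by (auto simp: L_def subdivision_def)
  from Max_in[OF L] obtain b where b: "(Max L, b) \<in> Z" "Max L < x" by (auto simp: L_def)
  show thesis
  proof (rule that[of "Max L" b])
    show "Max L < x" "R (Max L) b" using b R_Z by auto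
    show "b < y" using matched_iff(3)[OF xy b(1)] b(2) by simp
    show "z \<le> Max L \<and> w \<le> b" if "(z, w) \<in> Z" "z < x" for z w
    proof -
      have "z \<in> L" using that by (force simp: L_def)
      then show ?thesis using L(1) matched_iff(4)[OF subdivision_matched[OF Z that(1)] b(1)] by simp
    qed
  qed
qed

lemma right_neighbour:
  assumes Z: "subdivision Z" and xy: "matched Z x y"
    and R_Z: "\<And>z w. (z, w) \<in> Z \<Longrightarrow> R z w" and R_right: "\<exists>s>x. \<exists>t>y. R s t"
  obtains a b where "x < a" "y < b" "R a b" "\<And>z w. (z, w) \<in> Z \<Longrightarrow> x < z \<Longrightarrow> a \<le> z \<and> b \<le> w"
proof -
  let ?Z = "map_prod uminus uminus ` Z"
  have Z': "subdivision ?Z" and xy': "matched ?Z (- x) (- y)"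
    using subdivision_uminus[OF Z] xy by (simp_all add: matched_uminus)
  from R_right obtain s t where "s > x" "t > y" "R s t" by blast
  then have R_left: "\<exists>s< - x. \<exists>t< - y. R (- s) (- t)" by (intro exI[of _ "- s"] conjI exI[of _ "- t"]) auto
  obtain a b where ab: "a < - x" "b < - y" "R (- a) (- b)"
    "\<And>z w. (z, w) \<in> ?Z \<Longrightarrow> z < - x \<Longrightarrow> z \<le> a \<and> w \<le> b"
    by (rule left_neighbour[OF Z' xy', of "\<lambda>s t. R (- s) (- t)", OF _ R_left]) (use R_Z in auto)
  show thesis
  proof (rule that[of "- a" "- b"])
    show "- a \<le> z \<and> - b \<le> w" if "(z, w) \<in> Z" "x < z" for z w
      using that ab(4)[of "- z" "- w"] by (force simp: minus_le_iff)
  qed (use ab in \<open>auto simp: less_minus_iff\<close>)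
qed

lemma matched_cell:
  assumes Z: "subdivision Z" and xy: "matched Z x y" "(x, y) \<notin> Z"
    and R_Z: "\<And>z w. (z, w) \<in> Z \<Longrightarrow> R z w"
    and R_left: "\<exists>s<x. \<exists>t<y. R s t" and R_right: "\<exists>s>x. \<exists>t>y. R s t"
  obtains a b a' b' where "a < x" "x < b" "a' < y" "y < b'" "R a a'" "R b b'"
    "\<And>u w. a < u \<Longrightarrow> u < b \<Longrightarrow> a' < w \<Longrightarrow> w < b' \<Longrightarrow> matched Z u w"
proof -
  obtain a a' where a: "a < x" "a' < y" "R a a'" "\<And>z w. (z, w) \<in> Z \<Longrightarrow> z < x \<Longrightarrow> z \<le> a \<and> w \<le> a'"
    using left_neighbour[of Z x y R] assms by blast
  obtain b b' where b: "x < b" "y < b'" "R b b'" "\<And>z w. (z, w) \<in> Z \<Longrightarrow> x < z \<Longrightarrow> b \<le> z \<and> b' \<le> w"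
    using right_neighbour[of Z x y R] assms by blast
  have "matched Z u w" if "a < u" "u < b" "a' < w" "w < b'" for u w
    unfolding matched_def
  proof clarify
    fix z v assume zv: "(z, v) \<in> Z"
    have "x \<noteq> z" using matched_iff(2)[OF xy(1) zv] xy(2) zv by auto
    then have "z \<le> a \<and> v \<le> a' \<or> b \<le> z \<and> b' \<le> v" using a(4)[OF zv] b(4)[OF zv] by (auto simp: neq_iff)
    then show "(u < z) = (w < v) \<and> (u = z) = (w = v)" using that by auto
  qed
  with a b that show thesis by blast
qed

lemma matched_roots_separated:
  fixes f :: "'a::real_closed_field poly"
  assumes "x < z" and xy: "matched Z x y" and roots: "poly f x = 0" "poly f z = 0"
    and pderiv: "\<And>u. matched Z u y \<Longrightarrow> (u, y) \<notin> Z \<Longrightarrow> poly (pderiv f) u \<noteq> 0"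
  shows "\<exists>(a, b)\<in>Z. x \<le> a \<and> a \<le> z"
proof (rule ccontr)
  assume "\<not> ?thesis"
  then have outside: "a < x \<or> z < a" if "(a, b) \<in> Z" for a b using that by force
  obtain u where u: "x < u" "u < z" "poly (pderiv f) u = 0"
    using real_closed_Rolle[OF assms(1) roots] by blast
  have "matched Z u y" unfolding matched_def
  proof clarify
    fix a b assume ab: "(a, b) \<in> Z"
    show "(u < a) = (y < b) \<and> (u = a) = (y = b)"
      using outside[OF ab] matched_iff[OF xy ab] u assms(1) by auto
  qed
  moreover have "(u, y) \<notin> Z" using outside[of u y] u by auto
  ultimately show False using pderiv u(3) by blast
qed

lemma matched_roots_less:
  fixes f :: "'a::real_closed_field poly"
  assumes "x < z" and xy: "matched Z x y" "poly f x = 0" and zw: "matched Z z w" "poly f z = 0"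
    and pderiv: "\<And>u. matched Z u y \<Longrightarrow> (u, y) \<notin> Z \<Longrightarrow> poly (pderiv f) u \<noteq> 0"
  shows "y < w"
proof -
  obtain a b where ab: "(a, b) \<in> Z" "x \<le> a" "a \<le> z"
    using matched_roots_separated[OF assms(1) xy zw(2) pderiv] by blast
  then show ?thesis
    using matched_iff[OF xy(1) ab(1)] matched_iff[OF zw(1) ab(1)] assms(1) by (auto simp: le_less)
qed

lemma increasing_same_sign:
  fixes f :: "'a::real_closed_field poly" and g :: "'b::real_closed_field poly"
  assumes x: "a < x" "x < b" and y: "a' < y" "y < b'"
    and f': "\<And>u. a < u \<Longrightarrow> u < b \<Longrightarrow> poly (pderiv f) u > 0"
    and g': "\<And>w. a' < w \<Longrightarrow> w < b' \<Longrightarrow> poly (pderiv g) w > 0"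
    and ends: "same_sign (poly f a) (poly g a')" "same_sign (poly f b) (poly g b')"
    and at_roots: "\<And>u w. a < u \<Longrightarrow> u < b \<Longrightarrow> a' < w \<Longrightarrow> w < b' \<Longrightarrow> poly f u = 0 \<Longrightarrow> poly g w = 0 \<Longrightarrow>
      (x < u \<longleftrightarrow> y < w) \<and> (x = u \<longleftrightarrow> y = w)"
  shows "same_sign (poly f x) (poly g y)"
proof -
  have f_less: "poly f u < poly f v" if "a \<le> u" "u < v" "v \<le> b" for u v
    using real_closed_increasing[OF that(2), of f] f' that by force
  have g_less: "poly g u < poly g v" if "a' \<le> u" "u < v" "v \<le> b'" for u v
    using real_closed_increasing[OF that(2), of g] g' that by force
  consider (pos) "poly f a \<ge> 0" | (neg) "poly f b \<le> 0" | (root) "poly f a < 0" "poly f b > 0" by linarith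
  then show ?thesis
  proof cases
    case pos
    then have "poly g a' \<ge> 0" using same_sign_nonneg_iff[OF ends(1)] by simp
    then show ?thesis using pos f_less[of a x] g_less[of a' y] x y by (simp add: same_sign_def)
  next
    case neg
    then have "poly g b' \<le> 0" using ends(2) by (simp add: same_sign_def not_less[symmetric])
    then show ?thesis using neg f_less[of x b] g_less[of y b'] x y by (simp add: same_sign_def)
  next
    case root
    then have g_ends: "poly g a' < 0" "poly g b' > 0" using ends by (simp_all add: same_sign_def)
    obtain u where u: "a < u" "u < b" "poly f u = 0" using real_closed_IVT_pos[OF _ root] x by force
    obtain w where w: "a' < w" "w < b'" "poly g w = 0" using real_closed_IVT_pos[OF _ g_ends] y by force
    have "(x < u \<longleftrightarrow> y < w) \<and> (x = u \<longleftrightarrow> y = w)" using at_roots u w by blast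
    then consider "x = u" "y = w" | "x < u" "y < w" | "u < x" "w < y" by (auto simp: neq_iff)
    then show ?thesis
      by cases (use u w x y f_less[of x u] f_less[of u x] g_less[of y w] g_less[of w y] in
        \<open>auto simp: same_sign_def\<close>)
  qed
qed

lemma monotone_same_sign:
  fixes f :: "'a::real_closed_field poly" and g :: "'b::real_closed_field poly"
  assumes x: "a < x" "x < b" and y: "a' < y" "y < b'"
    and f'_nonzero: "poly (pderiv f) x \<noteq> 0"
    and pderivs: "\<And>u w. a < u \<Longrightarrow> u < b \<Longrightarrow> a' < w \<Longrightarrow> w < b' \<Longrightarrow>
      same_sign (poly (pderiv f) u) (poly (pderiv g) w)"
    and ends: "same_sign (poly f a) (poly g a')" "same_sign (poly f b) (poly g b')"
    and at_roots: "\<And>u w. a < u \<Longrightarrow> u < b \<Longrightarrow> a' < w \<Longrightarrow> w < b' \<Longrightarrow> poly f u = 0 \<Longrightarrow> poly g w = 0 \<Longrightarrow>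
      (x < u \<longleftrightarrow> y < w) \<and> (x = u \<longleftrightarrow> y = w)"
  shows "same_sign (poly f x) (poly g y)"
proof (cases "poly (pderiv f) x > 0")
  case True
  have "poly (pderiv g) w > 0" if "a' < w" "w < b'" for w
    using pderivs[of x w] True x that by (simp add: same_sign_def)
  moreover from this have "poly (pderiv f) u > 0" if "a < u" "u < b" for u
    using pderivs[of u y] y that by (simp add: same_sign_def)
  ultimately show ?thesis by (intro increasing_same_sign[OF x y]) (use ends at_roots in auto)
next
  case False
  then have "poly (pderiv f) x < 0" using f'_nonzero by simp
  then have "poly (pderiv g) w < 0" if "a' < w" "w < b'" for w
    using pderivs[of x w] x that by (simp add: same_sign_def)
  moreover from this have "poly (pderiv f) u < 0" if "a < u" "u < b" for u
    using pderivs[of u y] y that by (simp add: same_sign_def)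
  ultimately have "same_sign (poly (- f) x) (poly (- g) y)"
    by (intro increasing_same_sign[OF x y]) (use ends at_roots in \<open>auto simp: pderiv_minus\<close>)
  then show ?thesis by simp
qed

definition common_remainder :: "('a::linordered_field poly \<times> 'b::linordered_field poly) set \<Rightarrow>
    'a poly \<Rightarrow> 'b poly \<Rightarrow> 'a poly \<Rightarrow> 'b poly \<Rightarrow> bool" where
  "common_remainder H f g p q \<longleftrightarrow> (\<exists>c d u v r s. c > 0 \<and> d > 0 \<and> degree r < degree p \<and> (r, s) \<in> H \<and>
     smult c f = p * u + r \<and> smult d g = q * v + s)"

locale sign_diagram_extension =
  fixes F :: "('a::real_closed_field poly \<times> 'b::real_closed_field poly) set" and Z f g
  assumes diagram: "sign_diagram F Z"
    and degree_eq: "degree f = degree g" and degree_pos: "degree f > 0"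
    and same_sign_lead: "same_sign (lead_coeff f) (lead_coeff g)"
    and pderiv_mem: "(pderiv f, pderiv g) \<in> F"
    and remainder: "\<And>p q. (p, q) \<in> F \<Longrightarrow> degree p > 0 \<Longrightarrow> common_remainder F f g p q"
begin

lemma subdivision: "subdivision Z"
  using diagram by (simp add: sign_diagram_def)

lemma same_sign_F: "matched Z x y \<Longrightarrow> (p, q) \<in> F \<Longrightarrow> same_sign (poly p x) (poly q y)"
  using diagram by (fastforce simp: sign_diagram_def)

lemma same_sign_on_subdivision:
  assumes "(x, y) \<in> Z"
  shows "same_sign (poly f x) (poly g y)"
proof -
  have xy: "matched Z x y" by (rule subdivision_matched[OF subdivision assms])
  obtain p q where pq: "(p, q) \<in> F" "p \<noteq> 0" "poly p x = 0"
    using diagram assms by (fastforce simp: sign_diagram_def)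
  have "poly q y = 0" using same_sign_zero_iff[OF same_sign_F[OF xy pq(1)]] pq(3) by blast
  have "degree p > 0" using pq(2,3) by (auto intro!: gr0I elim!: degree_eq_zeroE)
  then obtain c d u v r s where rs: "c > 0" "d > 0" "(r, s) \<in> F"
    "smult c f = p * u + r" "smult d g = q * v + s"
    using remainder[OF pq(1)] unfolding common_remainder_def by blast
  have "c * poly f x = poly r x" "d * poly g y = poly s y"
    using arg_cong[OF rs(4), of "\<lambda>w. poly w x"] arg_cong[OF rs(5), of "\<lambda>w. poly w y"]
      pq(3) \<open>poly q y = 0\<close> by simp_all
  then show ?thesis using same_sign_mult_pos_iff[OF rs(1,2)] same_sign_F[OF xy rs(3)] by metis
qed

lemma cell:
  assumes "matched Z x y" "(x, y) \<notin> Z"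
  obtains a b a' b' where "a < x" "x < b" "a' < y" "y < b'"
    "same_sign (poly f a) (poly g a')" "same_sign (poly f b) (poly g b')"
    "\<And>u w. a < u \<Longrightarrow> u < b \<Longrightarrow> a' < w \<Longrightarrow> w < b' \<Longrightarrow> matched Z u w"
  by (rule matched_cell[OF subdivision assms, of "\<lambda>s t. same_sign (poly f s) (poly g t)"])
    (simp_all add: same_sign_on_subdivision right_end_same_sign[OF same_sign_lead]
      left_end_same_sign[OF degree_eq same_sign_lead])

lemma pderiv_nonzero_off_subdivision:
  assumes "matched Z x y" "(x, y) \<notin> Z"
  shows "poly (pderiv f) x \<noteq> 0" "poly (pderiv g) y \<noteq> 0"
proof -
  have nonzero: "pderiv f \<noteq> 0" "pderiv g \<noteq> 0"
    using degree_eq degree_pos by (auto simp: pderiv_eq_0_iff)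
  obtain a b a' b' where cell: "a < x" "x < b" "a' < y" "y < b'"
    "\<And>u w. a < u \<Longrightarrow> u < b \<Longrightarrow> a' < w \<Longrightarrow> w < b' \<Longrightarrow> matched Z u w"
    using cell[OF assms] by metis
  have zero_iff: "poly (pderiv f) u = 0 \<longleftrightarrow> poly (pderiv g) w = 0"
    if "a < u" "u < b" "a' < w" "w < b'" for u w
    by (rule same_sign_zero_iff[OF same_sign_F[OF cell(5)[OF that] pderiv_mem]])
  show "poly (pderiv f) x \<noteq> 0"
    using poly_zero_on_interval[of a' b' "pderiv g"] zero_iff[of x] nonzero(2) cell by force
  show "poly (pderiv g) y \<noteq> 0"
    using poly_zero_on_interval[of a b "pderiv f"] zero_iff[of _ y] nonzero(1) cell by force
qed

lemma same_sign_off_subdivision: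
  assumes xy: "matched Z x y" "(x, y) \<notin> Z"
    and at_roots: "\<And>u w. matched Z u w \<Longrightarrow> poly f u = 0 \<Longrightarrow> poly g w = 0 \<Longrightarrow>
      (x < u \<longleftrightarrow> y < w) \<and> (x = u \<longleftrightarrow> y = w)"
  shows "same_sign (poly f x) (poly g y)"
proof -
  obtain a b a' b' where cell: "a < x" "x < b" "a' < y" "y < b'"
    "same_sign (poly f a) (poly g a')" "same_sign (poly f b) (poly g b')"
    "\<And>u w. a < u \<Longrightarrow> u < b \<Longrightarrow> a' < w \<Longrightarrow> w < b' \<Longrightarrow> matched Z u w"
    using cell[OF xy] by metis
  show ?thesis
    by (rule monotone_same_sign[OF cell(1-4) pderiv_nonzero_off_subdivision(1)[OF xy] _ cell(5,6)])
      (use cell(7) at_roots same_sign_F[OF _ pderiv_mem] in blast)+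
qed

definition refinement :: "('a \<times> 'b) set" where
  "refinement = Z \<union> {(x, y). matched Z x y \<and> poly f x = 0 \<and> poly g y = 0}"

lemma refinement_matched_Z: "(x, y) \<in> refinement \<Longrightarrow> matched Z x y"
  using subdivision_matched[OF subdivision] by (auto simp: refinement_def)

lemma new_roots_less_iff:
  assumes xy: "matched Z x y" "poly f x = 0" "poly g y = 0"
    and zw: "matched Z z w" "poly f z = 0" "poly g w = 0"
  shows "x < z \<longleftrightarrow> y < w"
proof
  show "y < w" if "x < z"
    by (rule matched_roots_less[OF that xy(1,2) zw(1,2)]) (rule pderiv_nonzero_off_subdivision(1))
  show "x < z" if "y < w"
    by (rule matched_roots_less[OF that, of "Z\<inverse>" _ g])
      (use xy zw pderiv_nonzero_off_subdivision(2) in \<open>auto simp: matched_converse\<close>)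
qed

lemma refinement_matched:
  assumes xy: "(x, y) \<in> refinement"
  shows "matched refinement x y"
  unfolding matched_def
proof clarify
  fix z w assume zw: "(z, w) \<in> refinement"
  note matched = refinement_matched_Z[OF xy] refinement_matched_Z[OF zw]
  show "(x < z) = (y < w) \<and> (x = z) = (y = w)"
  proof (cases "(x, y) \<in> Z \<or> (z, w) \<in> Z")
    case True
    then show ?thesis using matched_iff[OF matched(1)] matched_iff[OF matched(2)] by metis
  next
    case False
    then have "poly f x = 0" "poly g y = 0" "poly f z = 0" "poly g w = 0"
      using xy zw by (auto simp: refinement_def)
    then have "x < z \<longleftrightarrow> y < w" "z < x \<longleftrightarrow> w < y" using new_roots_less_iff matched by blast+
    then show ?thesis by (auto simp: neq_iff)
  qed
qed

lemma finite_refinement: "finite refinement"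
proof -
  have "f \<noteq> 0" using degree_pos by auto
  then have "finite (fst ` Z \<union> {x. poly f x = 0})"
    using subdivision by (simp add: subdivision_def poly_roots_finite)
  moreover have "fst ` refinement \<subseteq> fst ` Z \<union> {x. poly f x = 0}" by (auto simp: refinement_def)
  ultimately have "finite (fst ` refinement)" by (rule rev_finite_subset)
  moreover have "inj_on fst refinement"
    by (rule inj_onI) (use refinement_matched in \<open>fastforce simp: matched_def\<close>)
  ultimately show ?thesis by (rule finite_imageD)
qed

lemma sign_diagram_insert: "sign_diagram (insert (f, g) F) refinement"
proof -
  have matched_Z: "matched Z x y" if "matched refinement x y" for x y
    using that by (auto simp: matched_def refinement_def)
  have "same_sign (poly f x) (poly g y)" if xy: "matched refinement x y" for x y
  proof (cases "(x, y) \<in> Z")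
    case True
    then show ?thesis by (rule same_sign_on_subdivision)
  next
    case False
    have "(u, w) \<in> refinement" if "matched Z u w" "poly f u = 0" "poly g w = 0" for u w
      using that by (simp add: refinement_def)
    then show ?thesis
      by (intro same_sign_off_subdivision[OF matched_Z[OF xy] False]) (use matched_iff[OF xy] in blast)
  qed
  moreover have "\<forall>(x, y)\<in>refinement. \<exists>(p, q)\<in>insert (f, g) F. p \<noteq> 0 \<and> poly p x = 0"
    using diagram degree_pos by (fastforce simp: refinement_def sign_diagram_def)
  ultimately show ?thesis
    unfolding sign_diagram_def subdivision_def
    using finite_refinement refinement_matched same_sign_F[OF matched_Z] by auto
qed

end

lemma sign_diagram_insert_const:
  assumes "sign_diagram F Z" "degree f = 0" "degree g = 0" "same_sign (lead_coeff f) (lead_coeff g)"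
  shows "sign_diagram (insert (f, g) F) Z"
  using assms unfolding sign_diagram_def by (auto elim!: degree_eq_zeroE)

definition muchnik_family :: "('a::linordered_field poly \<times> 'b::linordered_field poly) set \<Rightarrow> bool" where
  "muchnik_family H \<longleftrightarrow> (\<forall>f g. (f, g) \<in> H \<longrightarrow>
     degree f = degree g \<and> same_sign (lead_coeff f) (lead_coeff g) \<and>
     (degree f > 0 \<longrightarrow> (pderiv f, pderiv g) \<in> H) \<and>
     (\<forall>p q. (p, q) \<in> H \<longrightarrow> 0 < degree p \<longrightarrow> degree p \<le> degree f \<longrightarrow> common_remainder H f g p q))"

lemma muchnik_familyD:
  assumes "muchnik_family H" "(f, g) \<in> H"
  shows "degree f = degree g" "same_sign (lead_coeff f) (lead_coeff g)"
    "degree f > 0 \<Longrightarrow> (pderiv f, pderiv g) \<in> H"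
    "(p, q) \<in> H \<Longrightarrow> 0 < degree p \<Longrightarrow> degree p \<le> degree f \<Longrightarrow> common_remainder H f g p q"
  using assms unfolding muchnik_family_def by blast+

lemma common_remainder_insert_iff:
  "degree p \<le> degree f' \<Longrightarrow> common_remainder (insert (f', g') H) f g p q \<longleftrightarrow> common_remainder H f g p q"
  unfolding common_remainder_def by (intro iff_exI conj_cong refl) auto

lemma muchnik_family_remove_max:
  assumes "muchnik_family (insert (f, g) H)" and max: "\<And>p q. (p, q) \<in> H \<Longrightarrow> degree p \<le> degree f"
  shows "muchnik_family H"
  unfolding muchnik_family_def
proof (intro allI impI conjI)
  fix p q assume pq: "(p, q) \<in> H"
  note D = muchnik_familyD[OF assms(1) insertI2[OF pq]]
  show "degree p = degree q" "same_sign (lead_coeff p) (lead_coeff q)" by (rule D)+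
  show "(pderiv p, pderiv q) \<in> H" if "degree p > 0"
    using D(3)[OF that] that max[OF pq] by (auto simp: degree_pderiv)
  show "common_remainder H p q p' q'"
    if "(p', q') \<in> H" "0 < degree p'" "degree p' \<le> degree p" for p' q'
    using D(4)[OF insertI2[OF that(1)] that(2,3)] common_remainder_insert_iff[OF max[OF that(1)]] by blast
qed

lemma muchnik_family_sign_diagram:
  fixes H :: "('a::real_closed_field poly \<times> 'b::real_closed_field poly) set"
  assumes "finite H" "muchnik_family H"
  shows "\<exists>Z. sign_diagram H Z"
  using assms
proof (induction H rule: finite_ranking_induct[where f = "\<lambda>h. degree (fst h)"])
  case empty
  show ?case by (rule exI[of _ "{}"]) (simp add: sign_diagram_def subdivision_def)
next
  case (insert h H)
  obtain f g where h: "h = (f, g)" by (cases h)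
  note D = muchnik_familyD[OF insert.prems[unfolded h] insertI1]
  have max: "degree p \<le> degree f" if "(p, q) \<in> H" for p q using insert.hyps(2)[OF that] by (simp add: h)
  then obtain Z where Z: "sign_diagram H Z"
    using insert.IH muchnik_family_remove_max[OF insert.prems[unfolded h]] by blast
  show ?case
  proof (cases "degree f = 0")
    case True
    then show ?thesis using sign_diagram_insert_const[OF Z] D(1,2) h by auto
  next
    case False
    have "sign_diagram_extension H Z f g"
    proof
      show "(pderiv f, pderiv g) \<in> H" using D(3) False degree_pderiv[of f] by auto
      show "common_remainder H f g p q" if "(p, q) \<in> H" "degree p > 0" for p q
        using D(4)[OF insertI2[OF that(1)] that(2) max[OF that(1)]]
          common_remainder_insert_iff[OF max[OF that(1)]] by blast
    qed (use Z D(1,2) False in auto)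
    then show ?thesis using sign_diagram_extension.sign_diagram_insert h by blast
  qed
qed

section \<open>Polynomials over subrings\<close>

definition coeffs_in :: "'a::zero set \<Rightarrow> 'a poly \<Rightarrow> bool" where
  "coeffs_in L p \<longleftrightarrow> (\<forall>i. coeff p i \<in> L)"

definition adjoin :: "'a::comm_ring_1 set \<Rightarrow> 'a \<Rightarrow> 'a set" where
  "adjoin L \<alpha> = {poly p \<alpha> | p. coeffs_in L p}"

lemma adjoinI: "coeffs_in L p \<Longrightarrow> poly p \<alpha> \<in> adjoin L \<alpha>"
  by (auto simp: adjoin_def)

lemma adjoinE:
  assumes "x \<in> adjoin L \<alpha>"
  obtains p where "coeffs_in L p" "x = poly p \<alpha>"
  using assms by (auto simp: adjoin_def)

lemma coeffs_in_pCons_iff [simp]: "coeffs_in L (pCons c p) \<longleftrightarrow> c \<in> L \<and> coeffs_in L p"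
  by (force simp: coeffs_in_def coeff_pCons split: nat.splits)

locale unital_subring =
  fixes L :: "'a::comm_ring_1 set"
  assumes one_mem: "1 \<in> L"
    and diff_mem: "x \<in> L \<Longrightarrow> y \<in> L \<Longrightarrow> x - y \<in> L"
    and mult_mem: "x \<in> L \<Longrightarrow> y \<in> L \<Longrightarrow> x * y \<in> L"
begin

lemma zero_mem: "0 \<in> L"
  using diff_mem[OF one_mem one_mem] by simp

lemma uminus_mem: "x \<in> L \<Longrightarrow> - x \<in> L"
  using diff_mem[OF zero_mem] by simp

lemma add_mem: "x \<in> L \<Longrightarrow> y \<in> L \<Longrightarrow> x + y \<in> L"
  using diff_mem[OF _ uminus_mem] by simp

lemma sum_mem: "(\<And>i. i \<in> A \<Longrightarrow> f i \<in> L) \<Longrightarrow> sum f A \<in> L"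
  by (induction A rule: infinite_finite_induct) (simp_all add: zero_mem add_mem)

lemma power_mem: "x \<in> L \<Longrightarrow> x ^ n \<in> L"
  by (induction n) (simp_all add: one_mem mult_mem)

lemma of_nat_mem: "of_nat n \<in> L"
  by (induction n) (simp_all add: zero_mem one_mem add_mem)

lemma coeffs_in_0: "coeffs_in L 0"
  by (simp add: coeffs_in_def zero_mem)

lemma coeffs_in_const: "c \<in> L \<Longrightarrow> coeffs_in L [:c:]"
  by (simp add: coeffs_in_0)

lemma coeffs_in_1: "coeffs_in L 1"
  unfolding one_pCons by (rule coeffs_in_const[OF one_mem])

lemma coeffs_in_monom: "c \<in> L \<Longrightarrow> coeffs_in L (monom c n)"
  by (simp add: coeffs_in_def zero_mem)

lemma coeffs_in_add: "coeffs_in L p \<Longrightarrow> coeffs_in L q \<Longrightarrow> coeffs_in L (p + q)"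
  by (simp add: coeffs_in_def add_mem)

lemma coeffs_in_diff: "coeffs_in L p \<Longrightarrow> coeffs_in L q \<Longrightarrow> coeffs_in L (p - q)"
  by (simp add: coeffs_in_def diff_mem)

lemma coeffs_in_uminus: "coeffs_in L p \<Longrightarrow> coeffs_in L (- p)"
  by (simp add: coeffs_in_def uminus_mem)

lemma coeffs_in_mult: "coeffs_in L p \<Longrightarrow> coeffs_in L q \<Longrightarrow> coeffs_in L (p * q)"
  by (simp add: coeffs_in_def coeff_mult sum_mem mult_mem)

lemma coeffs_in_smult: "c \<in> L \<Longrightarrow> coeffs_in L p \<Longrightarrow> coeffs_in L (smult c p)"
  by (simp add: coeffs_in_def mult_mem)

lemma poly_mem: "coeffs_in L p \<Longrightarrow> x \<in> L \<Longrightarrow> poly p x \<in> L"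
  by (induction p) (simp_all add: zero_mem add_mem mult_mem)

lemma coeffs_in_pseudo_divmod_main:
  assumes "pseudo_divmod_main lc q r d dr n = (q', r')"
    and "lc \<in> L" "coeffs_in L q" "coeffs_in L r" "coeffs_in L d"
  shows "coeffs_in L q' \<and> coeffs_in L r'"
  using assms
proof (induction n arbitrary: q r dr)
  case (Suc n)
  have coeff_r: "coeff r dr \<in> L" using Suc.prems by (simp add: coeffs_in_def)
  have step: "pseudo_divmod_main lc (smult lc q + monom (coeff r dr) n)
      (smult lc r - monom (coeff r dr) n * d) d (dr - 1) n = (q', r')"
    using Suc.prems(1) by (simp add: Let_def)
  show ?case
    by (rule Suc.IH[OF step]) (use Suc.prems coeff_r in \<open>auto intro!: coeffs_in_add coeffs_in_diff
      coeffs_in_mult coeffs_in_smult coeffs_in_monom\<close>)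
qed simp

lemma pseudo_division:
  assumes "coeffs_in L f" "coeffs_in L g" "g \<noteq> 0"
  obtains n q r where "coeffs_in L q" "coeffs_in L r" "smult (lead_coeff g ^ n) f = g * q + r"
    "r = 0 \<or> degree r < degree g"
proof -
  obtain q r where qr: "pseudo_divmod f g = (q, r)" by fastforce
  then have "pseudo_divmod_main (lead_coeff g) 0 f g (degree f) (1 + length (coeffs f) - length (coeffs g)) = (q, r)"
    using assms(3) by (simp add: pseudo_divmod_def)
  moreover have "lead_coeff g \<in> L" using assms(2) by (simp add: coeffs_in_def)
  ultimately have "coeffs_in L q \<and> coeffs_in L r"
    using assms(1,2) by (rule coeffs_in_pseudo_divmod_main[OF _ _ coeffs_in_0])
  with pseudo_divmod[OF assms(3) qr] that show thesis by blast
qed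

lemma unital_subring_adjoin: "unital_subring (adjoin L \<alpha>)"
proof
  show "1 \<in> adjoin L \<alpha>" using adjoinI[OF coeffs_in_const[OF one_mem]] by simp
  fix x y assume "x \<in> adjoin L \<alpha>" "y \<in> adjoin L \<alpha>"
  then obtain p q where pq: "coeffs_in L p" "coeffs_in L q" "x = poly p \<alpha>" "y = poly q \<alpha>" by (auto elim!: adjoinE)
  show "x - y \<in> adjoin L \<alpha>" "x * y \<in> adjoin L \<alpha>"
    using adjoinI[OF coeffs_in_diff[OF pq(1,2)]] adjoinI[OF coeffs_in_mult[OF pq(1,2)]] pq(3,4) by simp_all
qed

lemma subset_adjoin: "L \<subseteq> adjoin L \<alpha>"
  using adjoinI[OF coeffs_in_const] by fastforce

lemma mem_adjoin: "\<alpha> \<in> adjoin L \<alpha>"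
  using adjoinI[of L "[:0, 1:]" \<alpha>] by (simp add: zero_mem one_mem coeffs_in_0)

end

lemma coeffs_in_pderiv:
  fixes L :: "'a::idom set"
  assumes "unital_subring L" "coeffs_in L p"
  shows "coeffs_in L (pderiv p)"
proof -
  interpret unital_subring L by fact
  show ?thesis
    using assms(2) by (simp add: coeffs_in_def coeff_pderiv mult_mem of_nat_mem del: of_nat_Suc)
qed

section \<open>Transfer of sign conditions\<close>

(* Muchnik's proof of quantifier elimination: the signs of the coefficients of finitely many polynomials
   derived from F determine which sign vectors F realizes on the line. Coefficients are taken in an
   arbitrary commutative ring, where formal derivatives are not in the library. *)

definition formal_deriv :: "'c::comm_ring_1 poly \<Rightarrow> 'c poly" where
  "formal_deriv f = Poly (map (\<lambda>i. of_nat (Suc i) * coeff f (Suc i)) [0..<degree f])"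

definition truncate_poly :: "'c::comm_ring_1 poly \<Rightarrow> 'c poly" where
  "truncate_poly f = f - monom (lead_coeff f) (degree f)"

(* An even power of the leading coefficient stays positive under every specialization that does not kill it. *)

definition even_pseudo_mod :: "'c::comm_ring_1 poly \<Rightarrow> 'c poly \<Rightarrow> 'c poly" where
  "even_pseudo_mod f p = smult (lead_coeff p ^ (Suc (degree f) - degree p)) (snd (pseudo_divmod f p))"

lemma coeff_formal_deriv: "coeff (formal_deriv f) n = of_nat (Suc n) * coeff f (Suc n)"
  by (cases "n < degree f")
    (simp_all add: formal_deriv_def nth_default_def coeff_eq_0 del: of_nat_Suc)

lemma degree_formal_deriv_less: "degree f > 0 \<Longrightarrow> degree (formal_deriv f) < degree f"
  using degree_le[of "degree f - 1" "formal_deriv f"]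
  by (fastforce simp: coeff_formal_deriv coeff_eq_0)

lemma degree_truncate_poly_less: "degree f > 0 \<Longrightarrow> degree (truncate_poly f) < degree f"
  using degree_le[of "degree f - 1" "truncate_poly f"]
  by (fastforce simp: truncate_poly_def coeff_eq_0)

lemma even_pseudo_mod:
  assumes "p \<noteq> 0"
  obtains n q where "smult (lead_coeff p ^ (2 * n)) f = p * q + even_pseudo_mod f p"
proof -
  define n where "n = Suc (degree f) - degree p"
  obtain q r where qr: "pseudo_divmod f p = (q, r)" by fastforce
  have "smult (lead_coeff p ^ (2 * n)) f = smult (lead_coeff p ^ n) (smult (lead_coeff p ^ n) f)"
    by (simp add: mult_2 power_add)
  also have "\<dots> = p * smult (lead_coeff p ^ n) q + even_pseudo_mod f p"
    using pseudo_divmod(1)[OF assms qr] qr by (simp add: n_def even_pseudo_mod_def smult_add_right)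
  finally show thesis by (rule that)
qed

lemma degree_even_pseudo_mod_less:
  assumes "degree p > 0"
  shows "degree (even_pseudo_mod f p) < degree p"
proof -
  obtain q r where qr: "pseudo_divmod f p = (q, r)" by fastforce
  moreover have "p \<noteq> 0" using assms by auto
  ultimately have "degree r < degree p" using pseudo_divmod(2) assms by fastforce
  then show ?thesis using qr le_less_trans[OF degree_smult_le] by (simp add: even_pseudo_mod_def)
qed

inductive_set muchnik_closure :: "'c::comm_ring_1 poly set \<Rightarrow> 'c poly set" for F where
  base: "f \<in> F \<Longrightarrow> f \<in> muchnik_closure F"
| deriv: "f \<in> muchnik_closure F \<Longrightarrow> degree f > 0 \<Longrightarrow> formal_deriv f \<in> muchnik_closure F"
| truncate: "f \<in> muchnik_closure F \<Longrightarrow> degree f > 0 \<Longrightarrow> truncate_poly f \<in> muchnik_closure F"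
| remainder: "f \<in> muchnik_closure F \<Longrightarrow> p \<in> muchnik_closure F \<Longrightarrow> 0 < degree p \<Longrightarrow> degree p \<le> degree f \<Longrightarrow>
    even_pseudo_mod f p \<in> muchnik_closure F"

lemma muchnik_closure_degree_le:
  assumes "\<And>f. f \<in> F \<Longrightarrow> degree f \<le> d" "f \<in> muchnik_closure F"
  shows "degree f \<le> d"
  using assms(2)
proof (induction rule: muchnik_closure.induct)
  case (deriv f)
  then show ?case using degree_formal_deriv_less[of f] by simp
next
  case (truncate f)
  then show ?case using degree_truncate_poly_less[of f] by simp
next
  case (remainder f p)
  then show ?case using degree_even_pseudo_mod_less[of p f] by simp
qed (rule assms(1))

lemma finite_muchnik_closure:
  assumes "finite F"
  shows "finite (muchnik_closure F)"
proof -
  define d where "d = Max (insert 0 (degree ` F))"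
  have d: "degree f \<le> d" if "f \<in> F" for f using that assms by (simp add: d_def)
  define S where "S k = {f \<in> muchnik_closure F. d < degree f + k}" for k
  have "finite (S k)" for k
  proof (induction k)
    case 0
    have "S 0 = {}" using muchnik_closure_degree_le[OF d] by (force simp: S_def)
    then show ?case by simp
  next
    case (Suc k)
    have "S (Suc k) \<subseteq> F \<union> formal_deriv ` S k \<union> truncate_poly ` S k \<union> case_prod even_pseudo_mod ` (S k \<times> S k)"
    proof
      fix f assume "f \<in> S (Suc k)"
      then have "f \<in> muchnik_closure F" "d < degree f + Suc k" by (simp_all add: S_def)
      then show "f \<in> F \<union> formal_deriv ` S k \<union> truncate_poly ` S k \<union> case_prod even_pseudo_mod ` (S k \<times> S k)"
      proof (cases rule: muchnik_closure.cases)
        case (deriv g)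
        then have "g \<in> S k" using \<open>d < _\<close> degree_formal_deriv_less[of g] by (simp add: S_def)
        with deriv show ?thesis by blast
      next
        case (truncate g)
        then have "g \<in> S k" using \<open>d < _\<close> degree_truncate_poly_less[of g] by (simp add: S_def)
        with truncate show ?thesis by blast
      next
        case (remainder g p)
        then have "g \<in> S k" "p \<in> S k" using \<open>d < _\<close> degree_even_pseudo_mod_less[of p g] by (simp_all add: S_def)
        with remainder show ?thesis by (auto intro!: image_eqI[of _ _ "(g, p)"])
      qed simp
    qed
    moreover have "finite \<dots>" using assms Suc by simp
    ultimately show ?case by (rule finite_subset)
  qed
  moreover have "muchnik_closure F = S (Suc d)" by (auto simp: S_def)
  ultimately show ?thesis by simp
qed

definition muchnik_coeffs :: "'c::comm_ring_1 poly set \<Rightarrow> 'c set" where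
  "muchnik_coeffs F = (\<Union>f\<in>muchnik_closure F. range (coeff f))"

lemma finite_muchnik_coeffs: "finite F \<Longrightarrow> finite (muchnik_coeffs F)"
  by (simp add: muchnik_coeffs_def finite_muchnik_closure range_coeff)

lemma lead_coeff_mem_muchnik_coeffs: "f \<in> muchnik_closure F \<Longrightarrow> lead_coeff f \<in> muchnik_coeffs F"
  by (auto simp: muchnik_coeffs_def)

lemma (in comm_ring_hom) degree_map_poly_lead_coeff:
  assumes "hom (lead_coeff f) \<noteq> 0"
  shows "degree (map_poly hom f) = degree f"
  using degree_map_poly[of hom f] assms by fastforce

lemma (in comm_ring_hom) map_poly_truncate_poly:
  assumes "hom (lead_coeff f) = 0"
  shows "map_poly hom (truncate_poly f) = map_poly hom f"
  by (rule poly_eqI) (use assms in \<open>auto simp: truncate_poly_def hom_minus\<close>)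

lemma map_poly_formal_deriv:
  fixes e :: "'c::comm_ring_1 \<Rightarrow> 'd::idom"
  assumes "comm_ring_hom e"
  shows "map_poly e (formal_deriv f) = pderiv (map_poly e f)"
proof -
  interpret comm_ring_hom e by fact
  show ?thesis
    by (rule poly_eqI) (simp add: coeff_pderiv coeff_formal_deriv hom_mult hom_of_nat del: of_nat_Suc)
qed

lemma (in comm_ring_hom) map_poly_even_pseudo_mod:
  assumes "p \<noteq> 0"
  obtains n q where "smult (hom (lead_coeff p) ^ (2 * n)) (map_poly hom f) =
      map_poly hom p * map_poly hom q + map_poly hom (even_pseudo_mod f p)"
proof -
  interpret map_poly_hom: map_poly_comm_ring_hom hom ..
  obtain n q where "smult (lead_coeff p ^ (2 * n)) f = p * q + even_pseudo_mod f p"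
    using even_pseudo_mod[OF assms] .
  from arg_cong[OF this, of "map_poly hom"] show thesis
    by (intro that[of n q]) (simp add: map_poly_hom_smult hom_power map_poly_hom.hom_add map_poly_hom.hom_mult)
qed

locale matching_specializations =
  e1: comm_ring_hom e1 + e2: comm_ring_hom e2
  for e1 :: "'c::comm_ring_1 \<Rightarrow> 'a::real_closed_field" and e2 :: "'c \<Rightarrow> 'b::real_closed_field" +
  fixes F :: "'c poly set"
  assumes finite_F: "finite F"
    and same_sign_coeffs: "\<And>c. c \<in> muchnik_coeffs F \<Longrightarrow> same_sign (e1 c) (e2 c)"
begin

definition specializations :: "('a poly \<times> 'b poly) set" where
  "specializations = insert (0, 0)
     ((\<lambda>f. (map_poly e1 f, map_poly e2 f)) ` {f \<in> muchnik_closure F. e1 (lead_coeff f) \<noteq> 0})"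

lemma lead_coeff_zero_iff:
  "f \<in> muchnik_closure F \<Longrightarrow> e1 (lead_coeff f) = 0 \<longleftrightarrow> e2 (lead_coeff f) = 0"
  by (intro same_sign_zero_iff same_sign_coeffs lead_coeff_mem_muchnik_coeffs)

lemma map_poly_mem_specializations:
  "f \<in> muchnik_closure F \<Longrightarrow> (map_poly e1 f, map_poly e2 f) \<in> specializations"
proof (induction "degree f" arbitrary: f rule: less_induct)
  case less
  note zero_iff = lead_coeff_zero_iff[OF less.prems]
  consider (nonzero) "e1 (lead_coeff f) \<noteq> 0" | (const) "e1 (lead_coeff f) = 0" "degree f = 0"
    | (truncate) "e1 (lead_coeff f) = 0" "degree f > 0" by blast
  then show ?case
  proof cases
    case nonzero
    then show ?thesis using less.prems by (auto simp: specializations_def)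
  next
    case const
    then have "map_poly e1 f = 0" "map_poly e2 f = 0"
      using zero_iff by (auto elim!: degree_eq_zeroE simp: e1.map_poly_pCons_hom e2.map_poly_pCons_hom)
    then show ?thesis by (simp add: specializations_def)
  next
    case truncate
    then have "(map_poly e1 (truncate_poly f), map_poly e2 (truncate_poly f)) \<in> specializations"
      using less degree_truncate_poly_less muchnik_closure.truncate by blast
    then show ?thesis using e1.map_poly_truncate_poly e2.map_poly_truncate_poly truncate(1) zero_iff by simp
  qed
qed

lemma specializations_cases:
  assumes "(f, g) \<in> specializations"
  obtains (zero) "f = 0" "g = 0"
  | (image) h where "h \<in> muchnik_closure F" "f = map_poly e1 h" "g = map_poly e2 h"
      "e1 (lead_coeff h) \<noteq> 0" "e2 (lead_coeff h) \<noteq> 0" "degree f = degree h" "degree g = degree h"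
  using assms lead_coeff_zero_iff e1.degree_map_poly_lead_coeff e2.degree_map_poly_lead_coeff
  unfolding specializations_def by blast

lemma specializations_common_remainder:
  assumes fg: "(f, g) \<in> specializations" and pq: "(p, q) \<in> specializations"
    and degree: "0 < degree p" "degree p \<le> degree f"
  shows "common_remainder specializations f g p q"
  using fg
proof (cases rule: specializations_cases)
  case zero
  then show ?thesis using degree by simp
next
  case f: (image h)
  show ?thesis using pq
  proof (cases rule: specializations_cases)
    case zero
    then show ?thesis using degree by simp
  next
    case p: (image m)
    let ?r = "even_pseudo_mod h m"
    have "m \<noteq> 0" "degree m > 0" using p degree by auto
    obtain n u where u: "smult (e1 (lead_coeff m) ^ (2 * n)) f = p * map_poly e1 u + map_poly e1 ?r"
      using e1.map_poly_even_pseudo_mod[OF \<open>m \<noteq> 0\<close>] f p by metis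
    obtain n' v where v: "smult (e2 (lead_coeff m) ^ (2 * n')) g = q * map_poly e2 v + map_poly e2 ?r"
      using e2.map_poly_even_pseudo_mod[OF \<open>m \<noteq> 0\<close>] f p by metis
    have "degree (map_poly e1 ?r) < degree p"
      using degree_map_poly_le[of e1 ?r] degree_even_pseudo_mod_less[OF \<open>degree m > 0\<close>, of h] p by simp
    moreover have "(map_poly e1 ?r, map_poly e2 ?r) \<in> specializations"
      using f p degree by (intro map_poly_mem_specializations muchnik_closure.remainder) auto
    moreover have "e1 (lead_coeff m) ^ (2 * n) > 0" "e2 (lead_coeff m) ^ (2 * n') > 0"
      using p by (simp_all add: power_mult)
    ultimately show ?thesis unfolding common_remainder_def using u v by blast
  qed
qed

lemma muchnik_family_specializations: "muchnik_family specializations"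
  unfolding muchnik_family_def
proof (intro allI impI conjI)
  fix f g assume fg: "(f, g) \<in> specializations"
  show "degree f = degree g" using fg by (cases rule: specializations_cases) simp_all
  show "same_sign (lead_coeff f) (lead_coeff g)"
    using fg
  proof (cases rule: specializations_cases)
    case (image h)
    then show ?thesis using same_sign_coeffs[OF lead_coeff_mem_muchnik_coeffs] by simp
  qed simp
  show "(pderiv f, pderiv g) \<in> specializations" if "degree f > 0"
    using fg
  proof (cases rule: specializations_cases)
    case (image h)
    then have "(map_poly e1 (formal_deriv h), map_poly e2 (formal_deriv h)) \<in> specializations"
      using that by (intro map_poly_mem_specializations muchnik_closure.deriv) auto
    then show ?thesis
      using image map_poly_formal_deriv e1.comm_ring_hom_axioms e2.comm_ring_hom_axioms by metis
  qed (use that in simp)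
  show "common_remainder specializations f g p q"
    if "(p, q) \<in> specializations" "0 < degree p" "degree p \<le> degree f" for p q
    by (rule specializations_common_remainder[OF fg that])
qed

theorem sign_transfer:
  "\<exists>x. \<forall>f\<in>F. same_sign (poly (map_poly e1 f) x) (poly (map_poly e2 f) y)"
proof -
  have "finite specializations" by (simp add: specializations_def finite_muchnik_closure finite_F)
  then obtain Z where Z: "sign_diagram specializations Z"
    using muchnik_family_sign_diagram muchnik_family_specializations by blast
  then have "subdivision Z" by (simp add: sign_diagram_def)
  then obtain x where "matched Z x y" using matched_exists by blast
  then have "\<forall>f\<in>F. same_sign (poly (map_poly e1 f) x) (poly (map_poly e2 f) y)"
    using Z map_poly_mem_specializations muchnik_closure.base unfolding sign_diagram_def by fast
  then show ?thesis ..
qed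

end

section \<open>Cones in rings and fields\<close>

lemma subset_chain_common_member:
  assumes "subset.chain A C" "x \<in> \<Union>C" "y \<in> \<Union>C"
  obtains S where "S \<in> C" "x \<in> S" "y \<in> S"
  using finite_subset_Union_chain[of "{x, y}" C A] assms by auto

locale additive_submonoid =
  fixes T :: "'a::comm_monoid_add set"
  assumes zero_mem: "0 \<in> T" and add_mem: "x \<in> T \<Longrightarrow> y \<in> T \<Longrightarrow> x + y \<in> T"
begin

lemma sum_mem: "(\<And>i. i \<in> A \<Longrightarrow> f i \<in> T) \<Longrightarrow> sum f A \<in> T"
  by (induction A rule: infinite_finite_induct) (simp_all add: zero_mem add_mem)

end

locale unital_subsemiring = additive_submonoid T for T :: "'a::comm_ring_1 set" +
  assumes one_mem: "1 \<in> T" and mult_mem: "x \<in> T \<Longrightarrow> y \<in> T \<Longrightarrow> x * y \<in> T"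
begin

lemma of_nat_mem: "of_nat n \<in> T"
  by (induction n) (simp_all add: zero_mem one_mem add_mem)

end

lemma unital_subsemiring_Union_chain:
  assumes "C \<noteq> {}" "subset.chain A C" and C: "\<And>T. T \<in> C \<Longrightarrow> unital_subsemiring T"
  shows "unital_subsemiring (\<Union>C)"
proof
  obtain T where "T \<in> C" using assms(1) by blast
  then interpret unital_subsemiring T by (rule C)
  show "0 \<in> \<Union>C" "1 \<in> \<Union>C" using \<open>T \<in> C\<close> zero_mem one_mem by blast+
next
  fix x y assume "x \<in> \<Union>C" "y \<in> \<Union>C"
  then obtain T where T: "T \<in> C" "x \<in> T" "y \<in> T" using subset_chain_common_member assms(2) by metis
  then interpret unital_subsemiring T using C by blast
  show "x + y \<in> \<Union>C" "x * y \<in> \<Union>C" using T add_mem mult_mem by blast+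
qed

definition cone_adjoin :: "'a::comm_ring_1 set \<Rightarrow> 'a \<Rightarrow> 'a set" where
  "cone_adjoin T a = {s + a * t | s t. s \<in> T \<and> t \<in> T}"

lemma cone_adjoinI: "s \<in> T \<Longrightarrow> t \<in> T \<Longrightarrow> s + a * t \<in> cone_adjoin T a"
  by (auto simp: cone_adjoin_def)

lemma cone_adjoinE:
  assumes "x \<in> cone_adjoin T a"
  obtains s t where "s \<in> T" "t \<in> T" "x = s + a * t"
  using assms by (auto simp: cone_adjoin_def)

context unital_subsemiring
begin

lemma subset_cone_adjoin: "T \<subseteq> cone_adjoin T a"
  using cone_adjoinI[OF _ zero_mem, of _ a] by auto

lemma mem_cone_adjoin: "a \<in> cone_adjoin T a"
  using cone_adjoinI[OF zero_mem one_mem, of a] by simp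

lemma cone_adjoin_subset: "S \<subseteq> T \<Longrightarrow> a \<in> T \<Longrightarrow> cone_adjoin S a \<subseteq> T"
  by (auto elim!: cone_adjoinE intro!: add_mem mult_mem)

lemma unital_subsemiring_cone_adjoin:
  assumes "a * a \<in> T"
  shows "unital_subsemiring (cone_adjoin T a)"
proof
  show "0 \<in> cone_adjoin T a" "1 \<in> cone_adjoin T a" using subset_cone_adjoin zero_mem one_mem by auto
  fix x y assume "x \<in> cone_adjoin T a" "y \<in> cone_adjoin T a"
  then obtain s t s' t' where
    xy: "s \<in> T" "t \<in> T" "x = s + a * t" "s' \<in> T" "t' \<in> T" "y = s' + a * t'" by (auto elim!: cone_adjoinE)
  have "(s + s') + a * (t + t') \<in> cone_adjoin T a"
    and "(s * s' + (a * a) * (t * t')) + a * (s * t' + t * s') \<in> cone_adjoin T a"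
    by (intro cone_adjoinI add_mem mult_mem assms xy)+
  then show "x + y \<in> cone_adjoin T a" "x * y \<in> cone_adjoin T a" by (simp_all add: xy algebra_simps)
qed

end

inductive_set weighted_squares :: "'a::comm_ring_1 set \<Rightarrow> 'a set \<Rightarrow> 'a set" for M K where
  zero: "0 \<in> weighted_squares M K"
| add: "t \<in> M \<Longrightarrow> x \<in> K \<Longrightarrow> s \<in> weighted_squares M K \<Longrightarrow> t * (x * x) + s \<in> weighted_squares M K"

lemma weighted_square_mem: "t \<in> M \<Longrightarrow> x \<in> K \<Longrightarrow> t * (x * x) \<in> weighted_squares M K"
  using weighted_squares.add[OF _ _ weighted_squares.zero] by fastforce

lemma weighted_squares_add:
  "x \<in> weighted_squares M K \<Longrightarrow> y \<in> weighted_squares M K \<Longrightarrow> x + y \<in> weighted_squares M K"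
  by (induction rule: weighted_squares.induct) (simp_all add: add.assoc weighted_squares.add)

lemma weighted_squares_subset:
  assumes "unital_subring K" "M \<subseteq> K"
  shows "weighted_squares M K \<subseteq> K"
proof
  interpret unital_subring K by fact
  show "x \<in> K" if "x \<in> weighted_squares M K" for x
    using that by induction (use assms(2) in \<open>auto intro: zero_mem add_mem mult_mem\<close>)
qed

lemma unital_subsemiring_weighted_squares:
  assumes "unital_subsemiring M" "unital_subring K"
  shows "unital_subsemiring (weighted_squares M K)"
proof
  interpret M: unital_subsemiring M by fact
  interpret K: unital_subring K by fact
  let ?S = "weighted_squares M K"
  show "0 \<in> ?S" by (rule weighted_squares.zero)
  show "1 \<in> ?S" using weighted_square_mem[OF M.one_mem K.one_mem] by simp
  show "x + y \<in> ?S" if "x \<in> ?S" "y \<in> ?S" for x y by (rule weighted_squares_add[OF that])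
  have square_mult: "t * (x * x) * y \<in> ?S" if "y \<in> ?S" "t \<in> M" "x \<in> K" for t x y
    using that
  proof induction
    case (add t' x' s)
    have "t * (x * x) * (t' * (x' * x') + s) = (t * t') * ((x * x') * (x * x')) + t * (x * x) * s"
      by (simp add: algebra_simps)
    with add show ?case by (simp add: weighted_squares.add M.mult_mem K.mult_mem)
  qed (simp add: weighted_squares.zero)
  show "x * y \<in> ?S" if "x \<in> ?S" "y \<in> ?S" for x y
    using that
    by induction (simp_all add: weighted_squares.zero distrib_right weighted_squares_add square_mult)
qed

locale subfield_set = unital_subring L for L :: "'a::field set" +
  assumes inverse_mem: "x \<in> L \<Longrightarrow> inverse x \<in> L"
begin

lemma division:
  assumes "coeffs_in L f" "coeffs_in L g" "g \<noteq> 0"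
  obtains q r where "coeffs_in L q" "coeffs_in L r" "f = g * q + r" "r = 0 \<or> degree r < degree g"
proof -
  obtain n q r where qr: "coeffs_in L q" "coeffs_in L r" "smult (lead_coeff g ^ n) f = g * q + r"
    "r = 0 \<or> degree r < degree g" using pseudo_division[OF assms] .
  define c where "c = inverse (lead_coeff g ^ n)"
  have "lead_coeff g \<in> L" "lead_coeff g \<noteq> 0" using assms(2,3) by (simp_all add: coeffs_in_def)
  then have c: "c \<in> L" "c \<noteq> 0" "c * lead_coeff g ^ n = 1" by (simp_all add: c_def inverse_mem power_mem)
  have "smult c (smult (lead_coeff g ^ n) f) = g * smult c q + smult c r"
    by (simp add: qr(3) smult_add_right)
  then have "f = g * smult c q + smult c r" by (simp add: c(3))
  then show thesis using that[of "smult c q" "smult c r"] qr(1,2,4) c by (simp add: coeffs_in_smult)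
qed

end

definition minimal_annihilator :: "'a::idom set \<Rightarrow> 'a \<Rightarrow> 'a poly \<Rightarrow> bool" where
  "minimal_annihilator L \<alpha> g \<longleftrightarrow> coeffs_in L g \<and> g \<noteq> 0 \<and> poly g \<alpha> = 0 \<and>
     (\<forall>h. coeffs_in L h \<longrightarrow> h \<noteq> 0 \<longrightarrow> poly h \<alpha> = 0 \<longrightarrow> degree g \<le> degree h)"

lemma minimal_annihilatorD:
  assumes "minimal_annihilator L \<alpha> g"
  shows "coeffs_in L g" "g \<noteq> 0" "poly g \<alpha> = 0" "degree g > 0"
    "coeffs_in L h \<Longrightarrow> h \<noteq> 0 \<Longrightarrow> poly h \<alpha> = 0 \<Longrightarrow> degree g \<le> degree h"
  using assms by (auto simp: minimal_annihilator_def intro!: gr0I elim!: degree_eq_zeroE)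

lemma minimal_annihilator_exists:
  assumes "coeffs_in L f" "f \<noteq> 0" "poly f \<alpha> = 0"
  obtains g where "minimal_annihilator L \<alpha> g"
  using that ex_has_least_nat[of "\<lambda>g. coeffs_in L g \<and> g \<noteq> 0 \<and> poly g \<alpha> = 0" f degree] assms
  unfolding minimal_annihilator_def by blast

lemma minimal_annihilator_pseudo_dvd:
  assumes "unital_subring L" and g: "minimal_annihilator L \<alpha> g"
    and h: "coeffs_in L h" "poly h \<alpha> = 0"
  obtains c k where "c \<in> L" "c \<noteq> 0" "coeffs_in L k" "smult c h = g * k"
proof -
  interpret unital_subring L by fact
  note g = minimal_annihilatorD[OF g]
  obtain n k r where k: "coeffs_in L k" "coeffs_in L r" "smult (lead_coeff g ^ n) h = g * k + r"
    "r = 0 \<or> degree r < degree g" using pseudo_division[OF h(1) g(1,2)] .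
  have "poly r \<alpha> = 0" using arg_cong[OF k(3), of "\<lambda>p. poly p \<alpha>"] h g(3) by simp
  then have "r = 0" using g(5)[OF k(2)] k(4) by force
  moreover have "lead_coeff g ^ n \<in> L" using g(1) by (simp add: coeffs_in_def power_mem)
  ultimately show thesis using that[of "lead_coeff g ^ n" k] k g(2) by simp
qed

context subfield_set
begin

lemma minimal_annihilator_dvd:
  assumes g: "minimal_annihilator L \<alpha> g" and h: "coeffs_in L h" "poly h \<alpha> = 0"
  obtains k where "coeffs_in L k" "h = g * k"
proof -
  obtain c k where k: "c \<in> L" "c \<noteq> 0" "coeffs_in L k" "smult c h = g * k"
    using minimal_annihilator_pseudo_dvd[OF unital_subring_axioms assms] .
  have "h = smult (inverse c) (smult c h)" using k(2) by simp
  also have "\<dots> = g * smult (inverse c) k" by (simp add: k(4))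
  finally show thesis by (rule that[OF coeffs_in_smult[OF inverse_mem[OF k(1)] k(3)]])
qed

lemma adjoin_reduced:
  assumes g: "minimal_annihilator L \<alpha> g" and x: "x \<in> adjoin L \<alpha>"
  obtains k where "coeffs_in L k" "x = poly k \<alpha>" "degree k < degree g"
proof -
  obtain h where h: "coeffs_in L h" "x = poly h \<alpha>" using x by (rule adjoinE)
  note g = minimal_annihilatorD[OF g]
  obtain q r where "coeffs_in L q" "coeffs_in L r" "h = g * q + r" "r = 0 \<or> degree r < degree g"
    using division[OF h(1) g(1,2)] .
  then show thesis using that[of r] h(2) g(3,4) by auto
qed

lemma adjoin_cofactor:
  assumes g: "minimal_annihilator L \<alpha> g"
  shows "coeffs_in L h \<Longrightarrow> h \<noteq> 0 \<Longrightarrow> degree h < degree g \<Longrightarrow> \<exists>k. coeffs_in L k \<and> poly h \<alpha> * poly k \<alpha> = 1"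
proof (induction "degree h" arbitrary: h rule: less_induct)
  case less
  note g = minimal_annihilatorD[OF g]
  show ?case
  proof (cases "degree h = 0")
    case True
    then obtain c where c: "h = [:c:]" by (rule degree_eq_zeroE)
    then show ?thesis using less.prems by (intro exI[of _ "[:inverse c:]"]) (simp add: coeffs_in_const inverse_mem)
  next
    case False
    obtain q r where qr: "coeffs_in L q" "coeffs_in L r" "g = h * q + r" "r = 0 \<or> degree r < degree h"
      using division[OF g(1) less.prems(1,2)] .
    have r\<alpha>: "poly r \<alpha> = - (poly h \<alpha> * poly q \<alpha>)" using qr(3) g(3) by (auto simp: add_eq_0_iff)
    have "r \<noteq> 0"
    proof
      assume "r = 0"
      then have gq: "g = h * q" using qr(3) by simp
      then have "degree q < degree g" using g(2) False by (auto simp: degree_mult_eq)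
      moreover have "poly h \<alpha> \<noteq> 0" using g(5)[OF less.prems(1,2)] less.prems(3) by auto
      ultimately show False using g(2,3) g(5)[OF qr(1)] gq by auto
    qed
    then obtain k where k: "coeffs_in L k" "poly r \<alpha> * poly k \<alpha> = 1"
      using less.hyps[OF _ qr(2)] qr(4) less.prems(3) by (metis less_trans)
    have "poly h \<alpha> * poly (- (q * k)) \<alpha> = 1" using k(2) r\<alpha> by (simp add: ac_simps)
    then show ?thesis using coeffs_in_uminus[OF coeffs_in_mult[OF qr(1) k(1)]] by blast
  qed
qed

lemma subfield_set_adjoin:
  assumes g: "minimal_annihilator L \<alpha> g"
  shows "subfield_set (adjoin L \<alpha>)"
proof (intro subfield_set.intro subfield_set_axioms.intro unital_subring_adjoin)
  fix x assume x: "x \<in> adjoin L \<alpha>"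
  obtain h where h: "coeffs_in L h" "x = poly h \<alpha>" "degree h < degree g"
    using adjoin_reduced[OF g x] .
  show "inverse x \<in> adjoin L \<alpha>"
  proof (cases "h = 0")
    case True
    then show ?thesis using x h(2) by simp
  next
    case False
    then obtain k where "coeffs_in L k" "x * poly k \<alpha> = 1" using adjoin_cofactor[OF g h(1)] h by blast
    then show ?thesis using adjoinI by (metis inverse_unique)
  qed
qed

end

section \<open>Real closures\<close>

(* A field cone is the set of nonnegative elements of an ordered subfield, except that the order need
   not be total; only squares of elements of the subfield are nonnegative. *)

locale field_cone = unital_subsemiring T for T :: "'a::field set" +
  assumes minus_one_not_mem: "-1 \<notin> T"
    and inverse_mem: "x \<in> T \<Longrightarrow> inverse x \<in> T"
    and diff_square_mem: "x \<in> T \<Longrightarrow> y \<in> T \<Longrightarrow> (x - y) * (x - y) \<in> T"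

definition cone_span :: "'a::comm_ring_1 set \<Rightarrow> 'a set" where
  "cone_span T = {a - b | a b. a \<in> T \<and> b \<in> T}"

lemma (in subfield_set) field_coneI:
  assumes "unital_subsemiring T" "T \<subseteq> L" and square: "\<And>x. x \<in> L \<Longrightarrow> x * x \<in> T" and "-1 \<notin> T"
  shows "field_cone T"
proof -
  interpret T: unital_subsemiring T by fact
  show ?thesis
  proof
    show "-1 \<notin> T" by fact
    show "(x - y) * (x - y) \<in> T" if "x \<in> T" "y \<in> T" for x y
      using that assms(2) by (intro square diff_mem) auto
    show "inverse x \<in> T" if "x \<in> T" for x
    proof -
      have "x * (inverse x * inverse x) \<in> T" using that assms(2) by (intro T.mult_mem square inverse_mem) auto
      then show ?thesis by (cases "x = 0") (simp_all add: mult.assoc[symmetric])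
    qed
  qed
qed

context field_cone
begin

lemma cone_spanI: "a \<in> T \<Longrightarrow> b \<in> T \<Longrightarrow> a - b \<in> cone_span T"
  by (auto simp: cone_span_def)

lemma mem_cone_span: "a \<in> T \<Longrightarrow> a \<in> cone_span T"
  using cone_spanI[OF _ zero_mem] by simp

lemma cone_span_square: "x \<in> cone_span T \<Longrightarrow> x * x \<in> T"
  by (auto simp: cone_span_def diff_square_mem)

lemma unital_subring_cone_span: "unital_subring (cone_span T)"
proof
  show "1 \<in> cone_span T" by (rule mem_cone_span[OF one_mem])
  fix x y assume "x \<in> cone_span T" "y \<in> cone_span T"
  then obtain a b c d where abcd: "a \<in> T" "b \<in> T" "c \<in> T" "d \<in> T" and xy: "x = a - b" "y = c - d"
    by (auto simp: cone_span_def)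
  have "x - y = (a + d) - (b + c)" "x * y = (a * c + b * d) - (a * d + b * c)"
    by (simp_all add: xy algebra_simps)
  then show "x - y \<in> cone_span T" "x * y \<in> cone_span T"
    using abcd by (auto intro!: cone_spanI add_mem mult_mem)
qed

sublocale span: unital_subring "cone_span T"
  by (rule unital_subring_cone_span)

sublocale span: subfield_set "cone_span T"
proof
  fix x assume x: "x \<in> cone_span T"
  have "inverse x = x * inverse (x * x)" by (cases "x = 0") auto
  then show "inverse x \<in> cone_span T"
    using span.mult_mem[OF x mem_cone_span[OF inverse_mem[OF cone_span_square[OF x]]]] by metis
qed

lemma antisym: "x \<in> T \<Longrightarrow> - x \<in> T \<Longrightarrow> x = 0"
  using mult_mem[of "- x" "inverse x"] inverse_mem[of x] minus_one_not_mem by (cases "x = 0") auto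

lemma one_plus_nonzero: "x \<in> T \<Longrightarrow> 1 + x \<noteq> 0"
  using minus_one_not_mem by (metis add_eq_0_iff)

end

lemma field_cone_Union_chain:
  assumes "C \<noteq> {}" "subset.chain A C" and C: "\<And>T. T \<in> C \<Longrightarrow> field_cone T"
  shows "field_cone (\<Union>C)"
proof (intro field_cone.intro field_cone_axioms.intro)
  show "unital_subsemiring (\<Union>C)"
    using assms by (intro unital_subsemiring_Union_chain[of C A]) (auto intro: field_cone.axioms)
  show "-1 \<notin> \<Union>C" using field_cone.minus_one_not_mem[OF C] by blast
  show "inverse x \<in> \<Union>C" if "x \<in> \<Union>C" for x using that field_cone.inverse_mem[OF C] by blast
  fix x y assume "x \<in> \<Union>C" "y \<in> \<Union>C"
  then obtain T where "T \<in> C" "x \<in> T" "y \<in> T" using subset_chain_common_member assms(2) by metis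
  then show "(x - y) * (x - y) \<in> \<Union>C" using field_cone.diff_square_mem[OF C] by blast
qed

locale maximal_cone = field_cone +
  assumes maximal: "field_cone S \<Longrightarrow> T \<subseteq> S \<Longrightarrow> S = T"

lemma maximal_cone_exists:
  assumes "field_cone P"
  obtains M where "maximal_cone M" "P \<subseteq> M"
proof -
  let ?A = "{T. field_cone T \<and> P \<subseteq> T}"
  have "\<exists>M\<in>?A. \<forall>S\<in>?A. M \<subseteq> S \<longrightarrow> S = M"
  proof (rule subset_Zorn_nonempty)
    show "?A \<noteq> {}" using assms by blast
    fix C assume C: "C \<noteq> {}" "subset.chain ?A C"
    then have "C \<subseteq> ?A" by (simp add: subset_chain_def)
    then show "\<Union>C \<in> ?A" using C field_cone_Union_chain[OF C] by blast
  qed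
  then obtain M where "M \<in> ?A" "\<forall>S\<in>?A. M \<subseteq> S \<longrightarrow> S = M" ..
  then show thesis using that[of M] by (auto intro!: maximal_cone.intro maximal_cone_axioms.intro)
qed

context maximal_cone
begin

lemma total:
  assumes x: "x \<in> cone_span T" "x \<notin> T"
  shows "- x \<in> T"
proof -
  let ?S = "cone_adjoin T (- x)"
  have x_square: "- x * - x \<in> T" using cone_span_square[OF x(1)] by simp
  have "field_cone ?S"
  proof (rule span.field_coneI)
    show "unital_subsemiring ?S" by (rule unital_subsemiring_cone_adjoin[OF x_square])
    show "y * y \<in> ?S" if "y \<in> cone_span T" for y
      using cone_span_square[OF that] subset_cone_adjoin by blast
    show "?S \<subseteq> cone_span T"
    proof
      fix y assume "y \<in> ?S"
      then obtain s t where st: "s \<in> T" "t \<in> T" and y: "y = s + - x * t" by (rule cone_adjoinE)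
      show "y \<in> cone_span T"
        unfolding y by (intro span.add_mem span.mult_mem span.uminus_mem mem_cone_span x(1) st)
    qed
    show "-1 \<notin> ?S"
    proof
      assume "-1 \<in> ?S"
      then obtain s t where st: "s \<in> T" "t \<in> T" "-1 = s + - x * t" by (rule cone_adjoinE)
      then have x_t: "x * t = 1 + s" by (simp add: algebra_simps)
      then have "t \<noteq> 0" using one_plus_nonzero[OF st(1)] by auto
      then have "x = (1 + s) * inverse t" using x_t by (simp add: field_simps)
      then show False using x(2) st by (auto intro: mult_mem add_mem one_mem inverse_mem)
    qed
  qed
  then have "?S = T" using maximal subset_cone_adjoin by blast
  then show ?thesis using mem_cone_adjoin by blast
qed

definition negative :: "'a \<Rightarrow> bool" where
  "negative x \<longleftrightarrow> - x \<in> T \<and> x \<noteq> 0"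

lemma negative_mult:
  assumes xy: "x \<in> cone_span T" "y \<in> cone_span T" and neg: "negative (x * y)"
  shows "negative x \<or> negative y"
proof (rule ccontr)
  assume "\<not> ?thesis"
  moreover have "x \<noteq> 0" "y \<noteq> 0" using neg by (auto simp: negative_def)
  ultimately have "x * y \<in> T" using total xy by (auto simp: negative_def intro: mult_mem)
  then show False using neg antisym[of "x * y"] by (simp add: negative_def)
qed

lemma degree_pos_of_sign_change:
  assumes "coeffs_in (cone_span T) f" "negative (poly f a * poly f b)"
  shows "degree f > 0"
proof (rule ccontr)
  assume "\<not> degree f > 0"
  then obtain c where c: "f = [:c:]" by (auto elim: degree_eq_zeroE)
  then have "c * c \<in> T" using assms(1) by (simp add: cone_span_square)
  then show False using assms(2) c antisym[of "c * c"] by (simp add: negative_def)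
qed

lemma weighted_squares_adjoin_representative:
  assumes f: "minimal_annihilator (cone_span T) \<alpha> f"
    and "x \<in> weighted_squares T (adjoin (cone_span T) \<alpha>)"
  shows "\<exists>F. coeffs_in (cone_span T) F \<and> poly F \<alpha> = x \<and> degree F \<le> 2 * (degree f - 1) \<and>
    (\<forall>y\<in>cone_span T. poly F y \<in> T)"
  using assms(2)
proof induction
  case zero
  show ?case by (rule exI[of _ 0]) (simp add: span.coeffs_in_0 zero_mem)
next
  case (add t x s)
  then obtain F where F: "coeffs_in (cone_span T) F" "poly F \<alpha> = s" "degree F \<le> 2 * (degree f - 1)"
    "\<And>y. y \<in> cone_span T \<Longrightarrow> poly F y \<in> T" by blast
  obtain k where k: "coeffs_in (cone_span T) k" "x = poly k \<alpha>" "degree k < degree f"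
    using span.adjoin_reduced[OF f add.hyps(2)] .
  define G where "G = [:t:] * (k * k) + F"
  have "degree ([:t:] * (k * k)) \<le> 2 * (degree f - 1)"
    using degree_mult_le[of "[:t:]" "k * k"] degree_mult_le[of k k] k(3) by simp
  then have "degree G \<le> 2 * (degree f - 1)" unfolding G_def using F(3) by (intro degree_add_le)
  moreover have "coeffs_in (cone_span T) G" unfolding G_def
    by (intro span.coeffs_in_add span.coeffs_in_mult span.coeffs_in_const mem_cone_span add.hyps k F)
  moreover have "poly G y \<in> T" if "y \<in> cone_span T" for y
    using mult_mem[OF add.hyps(1) cone_span_square[OF span.poly_mem[OF k(1) that]]] F(4)[OF that]
    by (simp add: G_def add_mem)
  moreover have "poly G \<alpha> = t * (x * x) + s" by (simp add: G_def F(2) k(2))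
  ultimately show ?case by blast
qed

(* A representation of -1 yields a multiple G = f q of f that is positive on the subfield, where the
   cofactor q changes sign along with f but has smaller degree. *)

lemma minus_one_not_mem_weighted_squares:
  assumes f: "minimal_annihilator (cone_span T) \<alpha> f"
    and ab: "a \<in> cone_span T" "b \<in> cone_span T" and neg: "negative (poly f a * poly f b)"
    and smaller: "\<And>q. degree q < degree f \<Longrightarrow> coeffs_in (cone_span T) q \<Longrightarrow>
      negative (poly q a * poly q b) \<Longrightarrow> \<exists>r\<in>cone_span T. poly q r = 0"
  shows "-1 \<notin> weighted_squares T (adjoin (cone_span T) \<alpha>)"
proof
  assume "-1 \<in> weighted_squares T (adjoin (cone_span T) \<alpha>)"
  then obtain F where F: "coeffs_in (cone_span T) F" "poly F \<alpha> = -1" "degree F \<le> 2 * (degree f - 1)"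
    "\<And>y. y \<in> cone_span T \<Longrightarrow> poly F y \<in> T"
    using weighted_squares_adjoin_representative[OF f] by blast
  have pos: "poly (1 + F) y \<in> T" "poly (1 + F) y \<noteq> 0" if "y \<in> cone_span T" for y
    using F(4)[OF that] one_plus_nonzero by (simp_all add: add_mem one_mem)
  have "coeffs_in (cone_span T) (1 + F)" "poly (1 + F) \<alpha> = 0"
    using F by (simp_all add: span.coeffs_in_add span.coeffs_in_1)
  then obtain q where q: "coeffs_in (cone_span T) q" "1 + F = f * q"
    by (rule span.minimal_annihilator_dvd[OF f])
  have "q \<noteq> 0" using pos(2)[OF ab(1)] q(2) by auto
  then have "degree f + degree q = degree (1 + F)"
    using q(2) minimal_annihilatorD(2)[OF f] by (simp add: degree_mult_eq)
  also have "\<dots> \<le> 2 * (degree f - 1)" using F(3) by (intro degree_add_le) auto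
  finally have degree_q: "degree q < degree f" using minimal_annihilatorD(4)[OF f] by linarith
  define u v where "u = poly f a * poly f b" and "v = poly q a * poly q b"
  have "u * v = poly (1 + F) a * poly (1 + F) b" by (simp only: q(2) u_def v_def poly_mult) (simp only: mult_ac)
  then have uv: "u * v \<in> T" "u * v \<noteq> 0" using pos[OF ab(1)] pos[OF ab(2)] by (simp_all add: mult_mem)
  have v: "v \<in> cone_span T" unfolding v_def by (intro span.mult_mem span.poly_mem q ab)
  have "v \<notin> T"
  proof
    assume "v \<in> T"
    then have "- u * v \<in> T" using neg by (intro mult_mem) (simp_all add: negative_def u_def)
    then show False using uv antisym[of "u * v"] by simp
  qed
  then have "negative v" using total[OF v] uv(2) by (auto simp: negative_def)
  then obtain r where "r \<in> cone_span T" "poly q r = 0"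
    using smaller[OF degree_q q(1)] by (auto simp: v_def)
  then show False using pos(2)[of r] q(2) by simp
qed

lemma mem_cone_span_if_adjoin_squares:
  assumes "\<And>x. x \<in> adjoin (cone_span T) \<alpha> \<Longrightarrow> x * x \<in> T"
  shows "\<alpha> \<in> cone_span T"
proof -
  interpret adjoin: unital_subring "adjoin (cone_span T) \<alpha>" by (rule span.unital_subring_adjoin)
  have "(\<alpha> + 1) * (\<alpha> + 1) - (\<alpha> - 1) * (\<alpha> - 1) \<in> cone_span T"
    by (intro cone_spanI assms adjoin.add_mem adjoin.diff_mem span.mem_adjoin adjoin.one_mem)
  also have "(\<alpha> + 1) * (\<alpha> + 1) - (\<alpha> - 1) * (\<alpha> - 1) = of_nat 4 * \<alpha>" by (simp add: algebra_simps)
  finally have "inverse (of_nat 4) * (of_nat 4 * \<alpha>) \<in> cone_span T"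
    by (rule span.mult_mem[OF span.inverse_mem[OF span.of_nat_mem]])
  moreover have "of_nat 4 \<noteq> (0::'a)" using one_plus_nonzero[OF of_nat_mem[of 3]] by simp
  ultimately show ?thesis by (simp add: mult.assoc[symmetric] del: of_nat_numeral)
qed

end

(* Artin and Schreier: a polynomial of minimal degree that changes sign without having a root would
   generate an extension to which the order extends. *)

locale maximal_cone_alg_closed = maximal_cone T for T :: "'a::alg_closed_field set"
begin

lemma minimal_annihilator_mem_cone_span:
  assumes f: "minimal_annihilator (cone_span T) \<alpha> f"
    and "-1 \<notin> weighted_squares T (adjoin (cone_span T) \<alpha>)"
  shows "\<alpha> \<in> cone_span T"
proof -
  let ?K = "adjoin (cone_span T) \<alpha>"
  interpret K: subfield_set ?K by (rule span.subfield_set_adjoin[OF f])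
  have T_K: "T \<subseteq> ?K" using mem_cone_span span.subset_adjoin by blast
  have square: "x * x \<in> weighted_squares T ?K" if "x \<in> ?K" for x
    using weighted_square_mem[OF one_mem that] by simp
  have "field_cone (weighted_squares T ?K)"
    using unital_subsemiring_weighted_squares[OF unital_subsemiring_axioms K.unital_subring_axioms]
      weighted_squares_subset[OF K.unital_subring_axioms T_K] square assms(2)
    by (rule K.field_coneI)
  moreover have "T \<subseteq> weighted_squares T ?K" using weighted_square_mem[OF _ K.one_mem] by fastforce
  ultimately have "weighted_squares T ?K = T" by (rule maximal)
  then show ?thesis using square by (intro mem_cone_span_if_adjoin_squares) simp
qed

theorem sign_change_root:
  "coeffs_in (cone_span T) f \<Longrightarrow> a \<in> cone_span T \<Longrightarrow> b \<in> cone_span T \<Longrightarrow> negative (poly f a * poly f b) \<Longrightarrow>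
    \<exists>r\<in>cone_span T. poly f r = 0"
proof (induction "degree f" arbitrary: f rule: less_induct)
  case less
  note f = less.prems(1) and ab = less.prems(2,3) and neg = less.prems(4)
  have "f \<noteq> 0" "degree f > 0" using degree_pos_of_sign_change[OF f neg] by auto
  obtain \<alpha> where \<alpha>: "poly f \<alpha> = 0" using alg_closed_imp_poly_has_root[OF \<open>degree f > 0\<close>] by blast
  obtain g where g: "minimal_annihilator (cone_span T) \<alpha> g"
    using minimal_annihilator_exists[OF f \<open>f \<noteq> 0\<close> \<alpha>] .
  note g' = minimal_annihilatorD[OF g]
  show ?case
  proof (cases "degree g = degree f")
    case True
    then have f_minimal: "minimal_annihilator (cone_span T) \<alpha> f"
      using f \<open>f \<noteq> 0\<close> \<alpha> g'(5) by (auto simp: minimal_annihilator_def)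
    have "-1 \<notin> weighted_squares T (adjoin (cone_span T) \<alpha>)"
      using less.hyps ab by (intro minus_one_not_mem_weighted_squares[OF f_minimal ab neg]) blast
    then show ?thesis using minimal_annihilator_mem_cone_span[OF f_minimal] \<alpha> by blast
  next
    case False
    then have degree_g: "degree g < degree f" using g'(5)[OF f \<open>f \<noteq> 0\<close> \<alpha>] by simp
    obtain q where q: "coeffs_in (cone_span T) q" "f = g * q"
      by (rule span.minimal_annihilator_dvd[OF g f \<alpha>])
    then have degree_q: "degree q < degree f" using \<open>f \<noteq> 0\<close> g'(4) by (auto simp: degree_mult_eq)
    have "poly f a * poly f b = (poly g a * poly g b) * (poly q a * poly q b)" by (simp add: q(2) ac_simps)
    then have "negative (poly g a * poly g b) \<or> negative (poly q a * poly q b)"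
      using neg by (intro negative_mult span.mult_mem span.poly_mem ab g' q) simp
    then have "\<exists>r\<in>cone_span T. poly g r = 0 \<or> poly q r = 0"
      using less.hyps[OF degree_g g'(1) ab] less.hyps[OF degree_q q(1) ab] by blast
    then show ?thesis using q(2) by auto
  qed
qed

end

definition base_cone :: "'k::linordered_field alg_closure set" where
  "base_cone = to_ac ` {x. x \<ge> 0}"

lemma field_cone_base_cone: "field_cone (base_cone :: 'k::linordered_field alg_closure set)"
proof -
  let ?L = "range (to_ac :: 'k \<Rightarrow> 'k alg_closure)"
  have mem: "to_ac x \<in> base_cone" if "x \<ge> 0" for x :: 'k using that by (simp add: base_cone_def)
  have "subfield_set ?L"
  proof
    show "1 \<in> ?L" using rangeI[of to_ac "1::'k"] by simp
    fix x y assume "x \<in> ?L" "y \<in> ?L"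
    then obtain x' y' :: 'k where "x = to_ac x'" "y = to_ac y'" by blast
    then show "x - y \<in> ?L" "x * y \<in> ?L" "inverse x \<in> ?L"
      by (auto simp flip: to_ac_diff to_ac_mult to_ac_inverse)
  qed
  then show ?thesis
  proof (rule subfield_set.field_coneI)
    show "unital_subsemiring (base_cone :: 'k alg_closure set)"
    proof
      show "0 \<in> (base_cone :: 'k alg_closure set)" "1 \<in> (base_cone :: 'k alg_closure set)"
        using mem[of 0] mem[of 1] by simp_all
      fix x y :: "'k alg_closure" assume "x \<in> base_cone" "y \<in> base_cone"
      then show "x + y \<in> base_cone" "x * y \<in> base_cone"
        by (auto simp: base_cone_def simp flip: to_ac_add to_ac_mult)
    qed
    show "base_cone \<subseteq> ?L" by (auto simp: base_cone_def)
    show "x * x \<in> base_cone" if "x \<in> ?L" for x using that mem by (auto simp flip: to_ac_mult)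
    show "-1 \<notin> (base_cone :: 'k alg_closure set)"
    proof
      assume "-1 \<in> (base_cone :: 'k alg_closure set)"
      then obtain x :: 'k where "x \<ge> 0" "to_ac x = to_ac (-1)" by (auto simp: base_cone_def)
      then have "0 \<le> (-1::'k)" by (simp only: to_ac_eq_iff)
      then show False by simp
    qed
  qed
qed

definition rc_cone :: "'k::linordered_field alg_closure set" where
  "rc_cone = (SOME M. maximal_cone M \<and> base_cone \<subseteq> M)"

lemma maximal_cone_rc_cone: "maximal_cone (rc_cone :: 'k::linordered_field alg_closure set)"
  and base_cone_subset_rc_cone: "base_cone \<subseteq> (rc_cone :: 'k alg_closure set)"
proof -
  have "\<exists>M :: 'k alg_closure set. maximal_cone M \<and> base_cone \<subseteq> M"
    using maximal_cone_exists[OF field_cone_base_cone] by metis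
  from someI_ex[OF this]
  show "maximal_cone (rc_cone :: 'k alg_closure set)" "base_cone \<subseteq> (rc_cone :: 'k alg_closure set)"
    by (simp_all add: rc_cone_def)
qed

interpretation rc_cone: maximal_cone_alg_closed "rc_cone :: 'k::linordered_field alg_closure set"
  by (intro maximal_cone_alg_closed.intro maximal_cone_rc_cone)

typedef (overloaded) 'k::linordered_field real_closure = "cone_span (rc_cone :: 'k alg_closure set)"
  using rc_cone.span.zero_mem by blast

setup_lifting type_definition_real_closure

instantiation real_closure :: (linordered_field) field
begin

lift_definition zero_real_closure :: "'a real_closure" is 0
  by (rule rc_cone.span.zero_mem)

lift_definition one_real_closure :: "'a real_closure" is 1
  by (rule rc_cone.span.one_mem)

lift_definition plus_real_closure :: "'a real_closure \<Rightarrow> 'a real_closure \<Rightarrow> 'a real_closure" is "(+)"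
  by (rule rc_cone.span.add_mem)

lift_definition minus_real_closure :: "'a real_closure \<Rightarrow> 'a real_closure \<Rightarrow> 'a real_closure" is "(-)"
  by (rule rc_cone.span.diff_mem)

lift_definition times_real_closure :: "'a real_closure \<Rightarrow> 'a real_closure \<Rightarrow> 'a real_closure" is "(*)"
  by (rule rc_cone.span.mult_mem)

lift_definition uminus_real_closure :: "'a real_closure \<Rightarrow> 'a real_closure" is "uminus"
  by (rule rc_cone.span.uminus_mem)

lift_definition inverse_real_closure :: "'a real_closure \<Rightarrow> 'a real_closure" is "inverse"
  by (rule rc_cone.span.inverse_mem)

definition divide_real_closure :: "'a real_closure \<Rightarrow> 'a real_closure \<Rightarrow> 'a real_closure" where
  "divide_real_closure x y = x * inverse y"

instance
  by standard (transfer; simp add: algebra_simps divide_real_closure_def; fail | simp add: divide_real_closure_def)+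

end

locale positive_cone = unital_subsemiring P for P :: "'a::idom set" +
  assumes total: "x \<in> P \<or> - x \<in> P"
    and antisym: "x \<in> P \<Longrightarrow> - x \<in> P \<Longrightarrow> x = 0"
begin

lemma diff_mem_trans: "y - x \<in> P \<Longrightarrow> z - y \<in> P \<Longrightarrow> z - x \<in> P"
  using add_mem[of "z - y" "y - x"] by simp

lemma diff_mem_antisym: "y - x \<in> P \<Longrightarrow> x - y \<in> P \<Longrightarrow> x = y"
  using antisym[of "y - x"] by simp

lemma diff_mem_linear: "y - x \<in> P \<or> x - y \<in> P"
  using total[of "y - x"] by simp

lemma mult_diff_mem_strict:
  assumes "y - x \<in> P" "x - y \<notin> P" "z \<in> P" "- z \<notin> P"
  shows "z * y - z * x \<in> P" "z * x - z * y \<notin> P"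
proof -
  show mem: "z * y - z * x \<in> P" using mult_mem[OF assms(3,1)] by (simp add: algebra_simps)
  have "z \<noteq> 0" "x \<noteq> y" using assms(1,2,4) zero_mem by auto
  then have "z * x \<noteq> z * y" by simp
  then show "z * x - z * y \<notin> P" using mem diff_mem_antisym by blast
qed

end

instantiation real_closure :: (linordered_field) linordered_field
begin

lift_definition less_eq_real_closure :: "'a real_closure \<Rightarrow> 'a real_closure \<Rightarrow> bool"
  is "\<lambda>x y. y - x \<in> rc_cone" .

definition less_real_closure :: "'a real_closure \<Rightarrow> 'a real_closure \<Rightarrow> bool" where
  "less_real_closure x y \<longleftrightarrow> x \<le> y \<and> \<not> y \<le> x"

definition abs_real_closure :: "'a real_closure \<Rightarrow> 'a real_closure" where
  "abs_real_closure x = (if x < 0 then - x else x)"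

definition sgn_real_closure :: "'a real_closure \<Rightarrow> 'a real_closure" where
  "sgn_real_closure x = (if x = 0 then 0 else if 0 < x then 1 else - 1)"

instance
proof
  define P where "P = {x :: 'a real_closure. 0 \<le> x}"
  have mem_P: "x \<in> P \<longleftrightarrow> Rep_real_closure x \<in> rc_cone" for x
    unfolding P_def mem_Collect_eq by transfer simp
  interpret positive_cone P
  proof
    show "0 \<in> P" "1 \<in> P"
      by (simp_all add: mem_P zero_real_closure.rep_eq one_real_closure.rep_eq rc_cone.zero_mem rc_cone.one_mem)
    fix x y assume "x \<in> P" "y \<in> P"
    then show "x + y \<in> P" "x * y \<in> P"
      by (simp_all add: mem_P plus_real_closure.rep_eq times_real_closure.rep_eq rc_cone.add_mem rc_cone.mult_mem)
  next
    fix x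
    show "x \<in> P \<or> - x \<in> P"
      using rc_cone.total[OF Rep_real_closure] by (auto simp: mem_P uminus_real_closure.rep_eq)
    assume "x \<in> P" "- x \<in> P"
    then have "Rep_real_closure x = Rep_real_closure 0"
      using rc_cone.antisym by (simp add: mem_P uminus_real_closure.rep_eq zero_real_closure.rep_eq)
    then show "x = 0" by (simp only: Rep_real_closure_inject)
  qed
  have le_iff: "x \<le> y \<longleftrightarrow> y - x \<in> P" for x y
    by (simp add: mem_P less_eq_real_closure.rep_eq minus_real_closure.rep_eq)
  fix x y z :: "'a real_closure"
  show "x < y \<longleftrightarrow> x \<le> y \<and> \<not> y \<le> x" by (rule less_real_closure_def)
  show "x \<le> x" unfolding le_iff by (simp only: diff_self zero_mem)
  show "x \<le> y \<Longrightarrow> y \<le> z \<Longrightarrow> x \<le> z" unfolding le_iff by (rule diff_mem_trans)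
  show "x \<le> y \<Longrightarrow> y \<le> x \<Longrightarrow> x = y" unfolding le_iff by (rule diff_mem_antisym)
  show "x \<le> y \<or> y \<le> x" unfolding le_iff by (rule diff_mem_linear)
  show "x \<le> y \<Longrightarrow> z + x \<le> z + y" unfolding le_iff by simp
  show "x < y \<Longrightarrow> 0 < z \<Longrightarrow> z * x < z * y"
    unfolding less_real_closure_def le_iff using mult_diff_mem_strict[of y x z] by auto
  show "\<bar>x\<bar> = (if x < 0 then - x else x)" by (rule abs_real_closure_def)
  show "sgn x = (if x = 0 then 0 else if 0 < x then 1 else - 1)" by (rule sgn_real_closure_def)
qed

end

interpretation Rep_real_closure: field_hom "Rep_real_closure :: 'k::linordered_field real_closure \<Rightarrow> 'k alg_closure"
  by unfold_locales
    (simp_all add: zero_real_closure.rep_eq one_real_closure.rep_eq plus_real_closure.rep_eq times_real_closure.rep_eq)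

lemma real_closure_sign_change_root:
  fixes f :: "'a::linordered_field real_closure poly"
  assumes "poly f a * poly f b < 0"
  shows "\<exists>x. poly f x = 0"
proof -
  let ?F = "map_poly Rep_real_closure f"
  have "coeffs_in (cone_span rc_cone) ?F" by (simp add: coeffs_in_def Rep_real_closure)
  moreover have "rc_cone.negative (Rep_real_closure (poly f a * poly f b))"
    using assms less_imp_le[OF assms] unfolding rc_cone.negative_def less_eq_real_closure.rep_eq by auto
  ultimately obtain r where r: "r \<in> cone_span rc_cone" "poly ?F r = 0"
    using rc_cone.sign_change_root[OF _ Rep_real_closure Rep_real_closure, of ?F a b]
    by (auto simp: Rep_real_closure.hom_mult)
  then obtain x where "r = Rep_real_closure x" by (metis Rep_real_closure_cases)
  with r show ?thesis by auto
qed

lemma sign_change_root_between: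
  fixes f :: "'a::linordered_field poly"
  assumes root: "\<And>(f::'a poly) a b. poly f a * poly f b < 0 \<Longrightarrow> \<exists>x. poly f x = 0"
  shows "a < b \<Longrightarrow> poly f a * poly f b < 0 \<Longrightarrow> \<exists>x>a. x < b \<and> poly f x = 0"
proof (induction "degree f" arbitrary: f rule: less_induct)
  case less
  obtain r where r: "poly f r = 0" using root[OF less.prems(2)] by blast
  show ?case
  proof (cases "a < r \<and> r < b")
    case True
    with r show ?thesis by blast
  next
    case False
    obtain q where q: "f = [:-r, 1:] * q" using r by (auto simp: poly_eq_0_iff_dvd)
    have "f \<noteq> 0" using less.prems(2) by auto
    then have degree_q: "degree q < degree f" using q by (auto simp: degree_mult_eq simp del: mult_pCons_left)
    have "r \<noteq> a" "r \<noteq> b" using less.prems(2) r by auto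
    then have "(a - r) * (b - r) > 0" using False less.prems(1) by (auto simp: zero_less_mult_iff)
    moreover have "((a - r) * (b - r)) * (poly q a * poly q b) < 0"
      using less.prems(2) q by (simp add: algebra_simps)
    ultimately have "poly q a * poly q b < 0" by (metis mult_less_0_iff less_asym)
    from less.hyps[OF degree_q less.prems(1) this] show ?thesis using q by auto
  qed
qed

instance real_closure :: (linordered_field) real_closed_field
  by standard
    (unfold sum_powers_conv_poly, rule sign_change_root_between[OF real_closure_sign_change_root],
      auto simp: mult_neg_pos)

lift_definition to_rc :: "'a::linordered_field \<Rightarrow> 'a real_closure" is to_ac
proof -
  fix x :: 'a
  have nonneg: "to_ac y \<in> cone_span rc_cone" if "y \<ge> 0" for y :: 'a
    using that base_cone_subset_rc_cone by (intro rc_cone.mem_cone_span) (auto simp: base_cone_def)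
  show "to_ac x \<in> cone_span rc_cone"
    using nonneg[of x] rc_cone.span.uminus_mem[OF nonneg[of "- x"]] by (cases "x \<ge> 0") auto
qed

interpretation to_rc: field_hom to_rc
  by unfold_locales (transfer; simp)+

lemma to_rc_nonneg: "0 \<le> x \<Longrightarrow> 0 \<le> to_rc x"
  by transfer (use base_cone_subset_rc_cone in \<open>auto simp: base_cone_def\<close>)

section \<open>Prime cones\<close>

definition supp :: "'a::comm_ring_1 set \<Rightarrow> 'a set" where
  "supp P = {a. a \<in> P \<and> - a \<in> P}"

locale ring_preordering = unital_subsemiring T for T :: "'a::comm_ring_1 set" +
  assumes square_mem: "a * a \<in> T"

locale prime_cone = ring_preordering P for P :: "'a::comm_ring_1 set" +
  assumes total: "a \<in> P \<or> - a \<in> P" and minus_one_not_mem: "-1 \<notin> P"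
    and prime: "a * b \<in> supp P \<Longrightarrow> a \<in> supp P \<or> b \<in> supp P"
begin

lemma supp_zero: "0 \<in> supp P"
  by (simp add: supp_def zero_mem)

lemma supp_add: "a \<in> supp P \<Longrightarrow> b \<in> supp P \<Longrightarrow> a + b \<in> supp P"
  using add_mem[of a b] add_mem[of "-a" "-b"] by (simp add: supp_def)

lemma supp_uminus: "a \<in> supp P \<Longrightarrow> - a \<in> supp P"
  by (simp add: supp_def)

lemma supp_sum: "(\<And>i. i \<in> A \<Longrightarrow> f i \<in> supp P) \<Longrightarrow> sum f A \<in> supp P"
  by (induction A rule: infinite_finite_induct) (simp_all add: supp_zero supp_add)

lemma supp_mult_right: "a \<in> supp P \<Longrightarrow> a * b \<in> supp P"
  using total[of b] mult_mem[of a b] mult_mem[of "-a" b] mult_mem[of a "-b"] mult_mem[of "-a" "-b"]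
  by (auto simp: supp_def)

lemma supp_mult_left: "a \<in> supp P \<Longrightarrow> b * a \<in> supp P"
  using supp_mult_right[of a b] by (simp add: mult.commute)

end

lemma (in ring_preordering) ring_preordering_cone_adjoin: "ring_preordering (cone_adjoin T a)"
  using unital_subsemiring_cone_adjoin[OF square_mem] subset_cone_adjoin square_mem
  by (auto intro!: ring_preordering.intro ring_preordering_axioms.intro)

locale maximal_avoiding_preordering = ring_preordering P for P :: "'a::comm_ring_1 set" +
  fixes D :: "'a set"
  assumes one_mem_D: "1 \<in> D" and mult_mem_D: "d \<in> D \<Longrightarrow> e \<in> D \<Longrightarrow> d * e \<in> D"
    and avoids: "d \<in> D \<Longrightarrow> - (d * d) \<notin> P"
    and maximal: "ring_preordering S \<Longrightarrow> P \<subseteq> S \<Longrightarrow> (\<And>d. d \<in> D \<Longrightarrow> - (d * d) \<notin> S) \<Longrightarrow> S = P"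
begin

lemma minus_square_if_not_mem:
  assumes "a \<notin> P"
  obtains d s t where "d \<in> D" "s \<in> P" "t \<in> P" "- (d * d) = s + a * t"
proof -
  have "cone_adjoin P a \<noteq> P" using mem_cone_adjoin assms by blast
  then have "\<exists>d\<in>D. - (d * d) \<in> cone_adjoin P a"
    using maximal[OF ring_preordering_cone_adjoin subset_cone_adjoin] by blast
  then show thesis using that by (blast elim: cone_adjoinE)
qed

lemma total: "a \<in> P \<or> - a \<in> P"
proof (rule ccontr)
  assume "\<not> ?thesis"
  then have "a \<notin> P" "- a \<notin> P" by auto
  obtain d s t where d: "d \<in> D" "s \<in> P" "t \<in> P" and neg_d: "- (d * d) = s + a * t"
    using minus_square_if_not_mem[OF \<open>a \<notin> P\<close>] .
  obtain e s' t' where e: "e \<in> D" "s' \<in> P" "t' \<in> P" and neg_e: "- (e * e) = s' + - a * t'"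
    using minus_square_if_not_mem[OF \<open>- a \<notin> P\<close>] .
  have at: "a * t = - (d * d) - s" and at': "a * t' = e * e + s'"
    using neg_d neg_e by (simp_all add: algebra_simps eq_neg_iff_add_eq_0)
  have product: "(a * a) * (t * t') = (- (d * d) - s) * (e * e + s')"
    unfolding at[symmetric] at'[symmetric] by (simp add: algebra_simps)
  have "- ((d * e) * (d * e)) = d * d * s' + s * (e * e) + s * s' + (a * a) * (t * t')"
    unfolding product by (simp add: algebra_simps)
  also have "\<dots> \<in> P" by (intro add_mem mult_mem square_mem d e)
  finally show False using avoids[OF mult_mem_D[OF d(1) e(1)]] by simp
qed

lemma uminus_mem_if_mult_mem:
  assumes ab: "a * b \<in> P" and "a \<notin> P"
  shows "- b \<in> P"
proof (rule ccontr)
  assume "- b \<notin> P"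
  then have "b \<in> P" using total by blast
  obtain d s t where d: "d \<in> D" "s \<in> P" "t \<in> P" and neg_d: "- (d * d) = s + a * t"
    using minus_square_if_not_mem[OF \<open>a \<notin> P\<close>] .
  obtain e s' t' where e: "e \<in> D" "s' \<in> P" "t' \<in> P" and neg_e: "- (e * e) = s' + - b * t'"
    using minus_square_if_not_mem[OF \<open>- b \<notin> P\<close>] .
  have "- (d * d) * b = b * s + (a * b) * t" unfolding neg_d by (simp add: algebra_simps)
  also have "\<dots> \<in> P" by (intro add_mem mult_mem ab \<open>b \<in> P\<close> d)
  finally have db: "- (d * d) * b \<in> P" .
  have "- ((d * e) * (d * e)) = (d * d) * - (e * e)" by (simp add: algebra_simps)
  also have "\<dots> = (d * d) * s' + (- (d * d) * b) * t'" unfolding neg_e by (simp add: algebra_simps)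
  also have "\<dots> \<in> P" by (intro add_mem mult_mem square_mem db e)
  finally show False using avoids[OF mult_mem_D[OF d(1) e(1)]] by simp
qed

lemma prime_cone: "prime_cone P"
proof
  show "a \<in> P \<or> - a \<in> P" for a by (rule total)
  show "-1 \<notin> P" using avoids[OF one_mem_D] by simp
  fix a b assume ab: "a * b \<in> supp P"
  have b_supp: "b \<in> supp P" if "c * b \<in> supp P" "c \<notin> P" for c
    using uminus_mem_if_mult_mem[of c b] uminus_mem_if_mult_mem[of c "-b"] that by (auto simp: supp_def)
  show "a \<in> supp P \<or> b \<in> supp P"
    using b_supp[of a] b_supp[of "- a"] ab by (auto simp: supp_def)
qed

lemma disjoint_supp: "D \<inter> supp P = {}"
proof -
  have "- (d * d) \<in> P" if "d \<in> supp P" for d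
    using mult_mem[of d "- d"] that by (simp add: supp_def)
  then show ?thesis using avoids by blast
qed

end

lemma ring_preordering_Union_chain:
  assumes "C \<noteq> {}" "subset.chain A C" and C: "\<And>T. T \<in> C \<Longrightarrow> ring_preordering T"
  shows "ring_preordering (\<Union>C)"
proof (intro ring_preordering.intro ring_preordering_axioms.intro)
  show "unital_subsemiring (\<Union>C)"
    using assms by (intro unital_subsemiring_Union_chain[of C A]) (auto intro: ring_preordering.axioms)
  show "a * a \<in> \<Union>C" for a using assms(1) ring_preordering.square_mem[OF C] by blast
qed

theorem prime_cone_exists:
  fixes T D :: "'a::comm_ring_1 set"
  assumes "ring_preordering T" and D: "1 \<in> D" "\<And>d e. d \<in> D \<Longrightarrow> e \<in> D \<Longrightarrow> d * e \<in> D"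
    and "\<And>d. d \<in> D \<Longrightarrow> - (d * d) \<notin> T"
  obtains P where "prime_cone P" "T \<subseteq> P" "D \<inter> supp P = {}"
proof -
  let ?A = "{P. ring_preordering P \<and> T \<subseteq> P \<and> (\<forall>d\<in>D. - (d * d) \<notin> P)}"
  have "\<exists>P\<in>?A. \<forall>S\<in>?A. P \<subseteq> S \<longrightarrow> S = P"
  proof (rule subset_Zorn_nonempty)
    show "?A \<noteq> {}" using assms by blast
    fix C assume C: "C \<noteq> {}" "subset.chain ?A C"
    then have "C \<subseteq> ?A" by (simp add: subset_chain_def)
    then show "\<Union>C \<in> ?A" using C ring_preordering_Union_chain[OF C] by blast
  qed
  then obtain P where P: "P \<in> ?A" "\<forall>S\<in>?A. P \<subseteq> S \<longrightarrow> S = P" ..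
  have "maximal_avoiding_preordering P D"
  proof (intro maximal_avoiding_preordering.intro maximal_avoiding_preordering_axioms.intro)
    show "ring_preordering P" "\<And>d. d \<in> D \<Longrightarrow> - (d * d) \<notin> P" using P(1) by simp_all
    show "S = P" if "ring_preordering S" "P \<subseteq> S" "\<And>d. d \<in> D \<Longrightarrow> - (d * d) \<notin> S" for S
    proof -
      have "S \<in> ?A" using that P(1) by auto
      then show ?thesis using P(2) that(2) by blast
    qed
  qed (use D in auto)
  then show thesis
    using that[of P] P(1) maximal_avoiding_preordering.prime_cone maximal_avoiding_preordering.disjoint_supp by blast
qed

section \<open>Extension of derivations\<close>

definition transcendental_over :: "'a::comm_ring_1 set \<Rightarrow> 'a \<Rightarrow> bool" where
  "transcendental_over L \<alpha> \<longleftrightarrow> (\<forall>g. coeffs_in L g \<longrightarrow> poly g \<alpha> = 0 \<longrightarrow> g = 0)"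

lemma (in field_hom) transcendental_over_range:
  assumes "\<And>\<pi>. \<pi> \<noteq> 0 \<Longrightarrow> poly (map_poly hom \<pi>) t \<noteq> 0"
  shows "transcendental_over (range hom) t"
  unfolding transcendental_over_def
proof (intro allI impI)
  fix g assume g: "coeffs_in (range hom) g" "poly g t = 0"
  let ?inv = "inv_into UNIV hom"
  have "?inv 0 = 0" using inv_into_f_f[OF inj_f, of 0] by simp
  then have "map_poly hom (map_poly ?inv g) = g"
    using g(1) by (intro poly_eqI) (simp add: coeff_map_poly coeffs_in_def f_inv_into_f)
  then show "g = 0" using assms[of "map_poly ?inv g"] g(2) by (metis map_poly_0)
qed

locale partial_derivation = unital_subring L for L :: "'k::field_char_0 set" +
  fixes D :: "'k \<Rightarrow> 'k"
  assumes D_diff: "x \<in> L \<Longrightarrow> y \<in> L \<Longrightarrow> D (x - y) = D x - D y"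
    and D_mult: "x \<in> L \<Longrightarrow> y \<in> L \<Longrightarrow> D (x * y) = x * D y + y * D x"
begin

lemma D_0: "D 0 = 0"
  using D_diff[OF zero_mem zero_mem] by simp

lemma D_1: "D 1 = 0"
  using D_mult[OF one_mem one_mem] by simp

lemma D_uminus: "x \<in> L \<Longrightarrow> D (- x) = - D x"
  using D_diff[OF zero_mem, of x] D_0 by simp

lemma D_add: "x \<in> L \<Longrightarrow> y \<in> L \<Longrightarrow> D (x + y) = D x + D y"
  using D_diff[OF _ uminus_mem, of x y] D_uminus[of y] by simp

lemma D_sum: "(\<And>i. i \<in> A \<Longrightarrow> f i \<in> L) \<Longrightarrow> D (sum f A) = (\<Sum>i\<in>A. D (f i))"
  by (induction A rule: infinite_finite_induct) (simp_all add: D_0 D_add sum_mem)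

lemma map_poly_D_diff:
  "coeffs_in L g \<Longrightarrow> coeffs_in L h \<Longrightarrow> map_poly D (g - h) = map_poly D g - map_poly D h"
  by (rule poly_eqI) (simp add: coeff_map_poly D_0 D_diff coeffs_in_def)

lemma map_poly_D_mult:
  assumes "coeffs_in L g" "coeffs_in L h"
  shows "map_poly D (g * h) = g * map_poly D h + h * map_poly D g"
proof (rule poly_eqI)
  fix n
  have mem: "coeff g i \<in> L" "coeff h i \<in> L" for i using assms by (simp_all add: coeffs_in_def)
  have "coeff (map_poly D (g * h)) n = (\<Sum>i\<le>n. D (coeff g i * coeff h (n - i)))"
    by (simp add: coeff_map_poly D_0 coeff_mult D_sum mult_mem mem)
  also have "\<dots> = (\<Sum>i\<le>n. coeff g i * D (coeff h (n - i)) + D (coeff g i) * coeff h (n - i))"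
    by (simp add: D_mult mem mult.commute)
  also have "\<dots> = coeff (g * map_poly D h + map_poly D g * h) n"
    by (simp add: coeff_mult coeff_map_poly D_0 sum.distrib)
  finally show "coeff (map_poly D (g * h)) n = coeff (g * map_poly D h + h * map_poly D g) n"
    by (simp add: mult.commute)
qed

(* The value that an extension of D with D \<alpha> = u must take at g(\<alpha>). *)

definition chain_rule :: "'k \<Rightarrow> 'k \<Rightarrow> 'k poly \<Rightarrow> 'k" where
  "chain_rule \<alpha> u g = poly (map_poly D g) \<alpha> + poly (pderiv g) \<alpha> * u"

lemma chain_rule_const: "chain_rule \<alpha> u [:x:] = D x"
  by (simp add: chain_rule_def Polynomial.map_poly_pCons D_0)

lemma chain_rule_X: "chain_rule \<alpha> u [:0, 1:] = u"
proof -
  have "map_poly D [:0, 1:] = 0"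
    by (rule poly_eqI) (simp add: coeff_map_poly coeff_pCons D_0 D_1 split: nat.split)
  then show ?thesis by (simp add: chain_rule_def pderiv_pCons)
qed

lemma chain_rule_diff:
  "coeffs_in L g \<Longrightarrow> coeffs_in L h \<Longrightarrow> chain_rule \<alpha> u (g - h) = chain_rule \<alpha> u g - chain_rule \<alpha> u h"
  by (simp add: chain_rule_def map_poly_D_diff pderiv_diff algebra_simps)

lemma chain_rule_mult:
  "coeffs_in L g \<Longrightarrow> coeffs_in L h \<Longrightarrow>
    chain_rule \<alpha> u (g * h) = poly g \<alpha> * chain_rule \<alpha> u h + poly h \<alpha> * chain_rule \<alpha> u g"
  by (simp add: chain_rule_def map_poly_D_mult pderiv_mult algebra_simps)

lemma chain_rule_algebraic:
  assumes "\<not> transcendental_over L \<alpha>"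
  shows "\<exists>u. \<forall>h. coeffs_in L h \<longrightarrow> poly h \<alpha> = 0 \<longrightarrow> chain_rule \<alpha> u h = 0"
proof -
  obtain g where g: "minimal_annihilator L \<alpha> g"
    using assms minimal_annihilator_exists unfolding transcendental_over_def by metis
  note g' = minimal_annihilatorD[OF g]
  have "pderiv g \<noteq> 0" "degree (pderiv g) < degree g" using g'(4) by (simp_all add: pderiv_eq_0_iff degree_pderiv)
  then have "poly (pderiv g) \<alpha> \<noteq> 0"
    using g'(5) coeffs_in_pderiv[OF unital_subring_axioms g'(1)] by fastforce
  define u where "u = - poly (map_poly D g) \<alpha> / poly (pderiv g) \<alpha>"
  have u_g: "chain_rule \<alpha> u g = 0" using \<open>poly (pderiv g) \<alpha> \<noteq> 0\<close> by (simp add: chain_rule_def u_def)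
  show ?thesis
  proof (intro exI[of _ u] allI impI)
    fix h assume h: "coeffs_in L h" "poly h \<alpha> = 0"
    obtain c k where k: "c \<in> L" "c \<noteq> 0" "coeffs_in L k" "smult c h = g * k"
      by (rule minimal_annihilator_pseudo_dvd[OF unital_subring_axioms g h])
    have "c * chain_rule \<alpha> u h = chain_rule \<alpha> u ([:c:] * h)"
      using chain_rule_mult[OF coeffs_in_const[OF k(1)] h(1)] h(2) by simp
    also have "\<dots> = chain_rule \<alpha> u (g * k)" using k(4) by simp
    also have "\<dots> = 0" using chain_rule_mult[OF g'(1) k(3)] u_g g'(3) by simp
    finally show "chain_rule \<alpha> u h = 0" using k(2) by simp
  qed
qed

lemma extend_to_adjoin_with_value:
  assumes u: "\<forall>h. coeffs_in L h \<longrightarrow> poly h \<alpha> = 0 \<longrightarrow> chain_rule \<alpha> u h = 0"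
  shows "\<exists>D'. partial_derivation (adjoin L \<alpha>) D' \<and> (\<forall>x\<in>L. D' x = D x) \<and> D' \<alpha> = u"
proof -
  define D' where "D' x = chain_rule \<alpha> u (SOME g. coeffs_in L g \<and> poly g \<alpha> = x)" for x
  have D': "D' (poly g \<alpha>) = chain_rule \<alpha> u g" if g: "coeffs_in L g" for g
  proof -
    define h where "h = (SOME h. coeffs_in L h \<and> poly h \<alpha> = poly g \<alpha>)"
    have h: "coeffs_in L h \<and> poly h \<alpha> = poly g \<alpha>" unfolding h_def by (rule someI[of _ g]) (simp add: g)
    then have "chain_rule \<alpha> u (h - g) = 0" using u coeffs_in_diff[OF _ g] by simp
    then show ?thesis using chain_rule_diff[OF _ g] h by (simp add: D'_def h_def)
  qed
  show ?thesis
  proof (intro exI[of _ D'] conjI ballI)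
    show "partial_derivation (adjoin L \<alpha>) D'"
    proof (intro partial_derivation.intro partial_derivation_axioms.intro unital_subring_adjoin)
      fix x y assume "x \<in> adjoin L \<alpha>" "y \<in> adjoin L \<alpha>"
      then obtain g h where gh: "coeffs_in L g" "x = poly g \<alpha>" "coeffs_in L h" "y = poly h \<alpha>" by (auto elim!: adjoinE)
      show "D' (x - y) = D' x - D' y"
        using D'[OF coeffs_in_diff[OF gh(1,3)]] gh by (simp add: D' chain_rule_diff)
      show "D' (x * y) = x * D' y + y * D' x"
        using D'[OF coeffs_in_mult[OF gh(1,3)]] gh by (simp add: D' chain_rule_mult)
    qed
    show "D' x = D x" if "x \<in> L" for x using D'[OF coeffs_in_const[OF that]] by (simp add: chain_rule_const)
    show "D' \<alpha> = u" using D'[of "[:0, 1:]"] unfolding chain_rule_X by (simp add: zero_mem one_mem coeffs_in_0)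
  qed
qed

lemma extend_to_adjoin_transcendental:
  assumes "transcendental_over L \<alpha>"
  shows "\<exists>D'. partial_derivation (adjoin L \<alpha>) D' \<and> (\<forall>x\<in>L. D' x = D x) \<and> D' \<alpha> = 1"
  using assms by (intro extend_to_adjoin_with_value) (auto simp: transcendental_over_def chain_rule_def)

lemma extend_to_adjoin: "\<exists>D'. partial_derivation (adjoin L \<alpha>) D' \<and> (\<forall>x\<in>L. D' x = D x)"
  using extend_to_adjoin_transcendental extend_to_adjoin_with_value chain_rule_algebraic by metis

end

lemma partial_derivation_extend_finite:
  assumes "finite V" "partial_derivation L D"
  shows "\<exists>L' D'. partial_derivation L' D' \<and> L \<union> V \<subseteq> L' \<and> (\<forall>x\<in>L. D' x = D x)"
  using assms(1)
proof induction
  case empty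
  show ?case using assms(2) by auto
next
  case (insert \<alpha> V)
  then obtain L' D' where L': "partial_derivation L' D'" "L \<union> V \<subseteq> L'" "\<forall>x\<in>L. D' x = D x" by blast
  interpret L': partial_derivation L' D' by fact
  obtain D'' where D'': "partial_derivation (adjoin L' \<alpha>) D''" "\<forall>x\<in>L'. D'' x = D' x"
    using L'.extend_to_adjoin by blast
  have "L \<union> insert \<alpha> V \<subseteq> adjoin L' \<alpha>" using L'(2) L'.subset_adjoin L'.mem_adjoin by blast
  moreover have "\<forall>x\<in>L. D'' x = D x" using D''(2) L'(2,3) by auto
  ultimately show ?case using D''(1) by blast
qed

theorem derivation_with_unit_value:
  fixes e :: "'a::field \<Rightarrow> 'b::field_char_0"
  assumes "field_hom e" "transcendental_over (range e) t" "finite V"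
  obtains L D where "partial_derivation L D" "range e \<subseteq> L" "V \<subseteq> L" "t \<in> L" "\<And>c. D (e c) = 0" "D t = 1"
proof -
  interpret field_hom e by fact
  interpret trivial: partial_derivation "range e" "\<lambda>_. 0"
  proof
    show "1 \<in> range e" using rangeI[of e 1] by simp
    fix x y assume "x \<in> range e" "y \<in> range e"
    then show "x - y \<in> range e" "x * y \<in> range e" by (auto simp flip: hom_minus hom_mult)
  qed simp_all
  obtain D where D: "partial_derivation (adjoin (range e) t) D" "\<forall>x\<in>range e. D x = 0" "D t = 1"
    using trivial.extend_to_adjoin_transcendental[OF assms(2)] by blast
  obtain L D' where L: "partial_derivation L D'" "adjoin (range e) t \<union> V \<subseteq> L"
    "\<forall>x\<in>adjoin (range e) t. D' x = D x"
    using partial_derivation_extend_finite[OF assms(3) D(1)] by blast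
  show thesis
  proof (rule that[OF L(1)])
    show "range e \<subseteq> L" "V \<subseteq> L" "t \<in> L"
      using L(2) trivial.subset_adjoin[of t] trivial.mem_adjoin[of t] by auto
    show "D' (e c) = 0" for c using L(3) D(2) trivial.subset_adjoin[of t] by (simp add: subset_iff)
    show "D' t = 1" using L(3) D(3) trivial.mem_adjoin[of t] by simp
  qed
qed

section \<open>Nonnegative univariate polynomials\<close>

lemma nonneg_poly_attains_min:
  fixes p :: "real poly"
  assumes nonneg: "\<And>t. poly p t \<ge> 0"
  shows "\<exists>r. \<forall>t. poly p r \<le> poly p t"
proof (cases "degree p = 0")
  case True
  then show ?thesis by (auto elim!: degree_eq_zeroE)
next
  case False
  then have "filterlim (\<lambda>t. norm (poly p t)) at_top at_infinity"
    by (intro filterlim_at_infinity_imp_norm_at_top filterlim_poly_at_infinity) simp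
  then have "\<forall>\<^sub>F t in at_infinity. poly p 0 \<le> norm (poly p t)" by (simp add: filterlim_at_top)
  then obtain R where R: "\<And>t. R \<le> \<bar>t\<bar> \<Longrightarrow> poly p 0 \<le> poly p t"
    using nonneg by (auto simp: eventually_at_infinity)
  obtain r where r: "\<forall>t\<in>{-\<bar>R\<bar>..\<bar>R\<bar>}. poly p r \<le> poly p t"
    using continuous_attains_inf[of "{-\<bar>R\<bar>..\<bar>R\<bar>}" "poly p"] by (force intro!: continuous_intros)
  have "poly p r \<le> poly p t" for t
  proof (cases "t \<in> {-\<bar>R\<bar>..\<bar>R\<bar>}")
    case False
    then have "R \<le> \<bar>t\<bar>" by auto
    moreover have "poly p r \<le> poly p 0" using r by simp
    ultimately show ?thesis using R order_trans by blast
  qed (use r in blast)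
  then show ?thesis by blast
qed

lemma nonneg_poly_root_square_factor:
  fixes p :: "real poly"
  assumes nonneg: "\<And>t. poly p t \<ge> 0" and root: "poly p r = 0"
  shows "\<exists>q. p = [:-r, 1:] * [:-r, 1:] * q \<and> (\<forall>t. poly q t \<ge> 0)"
proof -
  obtain p' where p': "p = [:-r, 1:] * p'" using root by (auto simp: poly_eq_0_iff_dvd)
  have "poly (pderiv p) r = 0"
    using DERIV_local_min[of "poly p" "poly (pderiv p) r" r 1] by (simp add: root nonneg)
  then have "poly p' r = 0" unfolding p' pderiv_mult by (simp add: pderiv_pCons)
  then obtain q where q: "p' = [:-r, 1:] * q" by (auto simp: poly_eq_0_iff_dvd)
  have p: "p = [:-r, 1:] * [:-r, 1:] * q" using p' q by (simp only: mult.assoc)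
  have q_off_root: "poly q t \<ge> 0" if "t \<noteq> r" for t
  proof -
    have "(t - r)\<^sup>2 * poly q t \<ge> 0" using nonneg[of t] p by (simp add: power2_eq_square algebra_simps)
    then show ?thesis using that by (simp add: zero_le_mult_iff)
  qed
  have "poly q r \<ge> 0"
  proof (rule tendsto_lowerbound)
    show "(poly q \<longlongrightarrow> poly q r) (at r)" by (intro isContD poly_isCont)
    show "\<forall>\<^sub>F t in at r. 0 \<le> poly q t" using q_off_root by (auto simp: eventually_at_filter)
  qed simp
  then have "poly q t \<ge> 0" for t using q_off_root by (cases "t = r") auto
  with p show ?thesis by blast
qed

theorem nonneg_poly_sum_squares:
  fixes p :: "real poly"
  assumes "\<And>t. poly p t \<ge> 0"
  shows "\<exists>qs. p = (\<Sum>q\<leftarrow>qs. q * q) \<and> (\<forall>q\<in>set qs. 2 * degree q \<le> degree p)"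
  using assms
proof (induction "degree p" arbitrary: p rule: less_induct)
  case less
  obtain r where r: "\<And>t. poly p r \<le> poly p t" using nonneg_poly_attains_min[OF less.prems] by blast
  define c where "c = poly p r"
  have "c \<ge> 0" using less.prems by (simp add: c_def)
  then have c_square: "[:c:] = [:sqrt c:] * [:sqrt c:]" by simp
  show ?case
  proof (cases "degree p = 0")
    case True
    then have "p = [:c:]" by (auto elim!: degree_eq_zeroE simp: c_def)
    then show ?thesis using c_square by (intro exI[of _ "[[:sqrt c:]]"]) simp
  next
    case False
    let ?l = "[:-r, 1:]"
    have "poly (p - [:c:]) t \<ge> 0" "poly (p - [:c:]) r = 0" for t using r by (simp_all add: c_def)
    then obtain q where q: "p - [:c:] = ?l * ?l * q" "\<And>t. poly q t \<ge> 0"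
      using nonneg_poly_root_square_factor by blast
    have "degree (p - [:c:]) = degree p"
      using False by (simp add: degree_add_eq_left diff_conv_add_uminus del: add_uminus_conv_diff)
    then have degree_p: "degree p = degree (?l * ?l * q)" using q(1) by simp
    then have "q \<noteq> 0" using False by auto
    then have degree_q: "degree p = 2 + degree q" unfolding degree_p by (subst degree_mult_eq; simp)+
    then obtain qs where qs: "q = (\<Sum>s\<leftarrow>qs. s * s)" "\<forall>s\<in>set qs. 2 * degree s \<le> degree q"
      using less.hyps[of q] q(2) by auto
    have "p = [:c:] + ?l * ?l * q" using q(1) by (simp add: algebra_simps)
    also have "?l * ?l * q = (\<Sum>s\<leftarrow>map ((*) ?l) qs. s * s)"
      unfolding qs(1) sum_list_const_mult[symmetric]
      by (simp add: o_def mult_ac del: mult_pCons_left mult_pCons_right)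
    finally have "p = (\<Sum>s\<leftarrow>[:sqrt c:] # map ((*) ?l) qs. s * s)" by (simp add: c_square)
    moreover have "2 * degree (?l * s) \<le> degree p" if "s \<in> set qs" for s
      using degree_mult_le[of ?l s] qs(2) that degree_q by fastforce
    ultimately show ?thesis by (intro exI[of _ "[:sqrt c:] # map ((*) ?l) qs"]) auto
  qed
qed

section \<open>Elements algebraic over the reals\<close>

lemma field_hom_real_nonneg:
  fixes e :: "real \<Rightarrow> 'k::linordered_field"
  assumes "field_hom e" "c \<ge> 0"
  shows "e c \<ge> 0"
proof -
  interpret field_hom e by fact
  have "e c = e (sqrt c) * e (sqrt c)" using assms(2) by (simp flip: hom_mult)
  then show ?thesis by simp
qed

lemma field_hom_real_pos:
  fixes e :: "real \<Rightarrow> 'k::linordered_field"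
  assumes "field_hom e" "c > 0"
  shows "e c > 0"
proof -
  interpret field_hom e by fact
  show ?thesis using field_hom_real_nonneg[OF assms(1), of c] assms(2) by (simp add: less_le)
qed

lemma field_hom_real_same_sign:
  fixes e :: "real \<Rightarrow> 'k::linordered_field"
  assumes "field_hom e"
  shows "same_sign c (e c)"
proof -
  interpret field_hom e by fact
  consider "c > 0" | "c = 0" | "- c > 0" by linarith
  then show ?thesis
  proof cases
    case 3
    then show ?thesis using field_hom_real_pos[OF assms, of "- c"] by (simp add: same_sign_def hom_uminus)
  qed (use field_hom_real_pos[OF assms, of c] in \<open>simp_all add: same_sign_def\<close>)
qed

lemma poly_rootfree_same_sign:
  fixes p :: "real poly"
  assumes "\<And>s. poly p s \<noteq> 0"
  shows "(\<forall>s. poly p s > 0) \<or> (\<forall>s. poly p s < 0)"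
proof (rule ccontr)
  assume "\<not> ?thesis"
  then obtain a b where ab: "poly p a < 0" "poly p b > 0" using assms by (metis linorder_neqE)
  then have "a \<noteq> b" by auto
  then show False
    using poly_IVT_pos[of a b p] poly_IVT_neg[of b a p] ab assms by (cases a b rule: linorder_cases) auto
qed

lemma poly_map_poly_pos:
  fixes e :: "real \<Rightarrow> 'k::linordered_field" and p :: "real poly"
  assumes "field_hom e" and pos: "\<And>s. poly p s > 0"
  shows "poly (map_poly e p) t > 0"
proof -
  interpret field_hom e by fact
  interpret map_poly_hom: map_poly_comm_ring_hom e ..
  obtain r where r: "\<And>s. poly p r \<le> poly p s" using nonneg_poly_attains_min pos less_imp_le by metis
  then have "poly (p - [:poly p r:]) s \<ge> 0" for s by simp
  then obtain qs where qs: "p - [:poly p r:] = (\<Sum>q\<leftarrow>qs. q * q)" using nonneg_poly_sum_squares by blast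
  have "poly (map_poly e (\<Sum>q\<leftarrow>qs. q * q)) t \<ge> 0"
    by (induction qs) (simp_all add: map_poly_hom.hom_add map_poly_hom.hom_mult)
  moreover have "map_poly e (p - [:poly p r:]) = map_poly e p - [:e (poly p r):]"
    by (simp add: map_poly_hom.hom_minus map_poly_pCons_hom)
  ultimately have "poly (map_poly e p) t \<ge> e (poly p r)" by (simp flip: qs)
  then show ?thesis using field_hom_real_pos[OF assms(1) pos, of r] by simp
qed

theorem algebraic_over_reals_is_real:
  fixes e :: "real \<Rightarrow> 'k::linordered_field"
  assumes "field_hom e"
  shows "\<pi> \<noteq> 0 \<Longrightarrow> poly (map_poly e \<pi>) t = 0 \<Longrightarrow> \<exists>v. t = e v"
proof (induction "degree \<pi>" arbitrary: \<pi> rule: less_induct)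
  case less
  interpret field_hom e by fact
  interpret map_poly_hom: map_poly_comm_ring_hom e ..
  have "\<exists>v. poly \<pi> v = 0"
  proof (rule ccontr)
    assume "\<nexists>v. poly \<pi> v = 0"
    then have "(\<forall>s. poly \<pi> s > 0) \<or> (\<forall>s. poly (- \<pi>) s > 0)" using poly_rootfree_same_sign[of \<pi>] by auto
    then show False
      using poly_map_poly_pos[OF assms, of \<pi> t] poly_map_poly_pos[OF assms, of "- \<pi>" t] less.prems(2)
      by (auto simp: map_poly_hom.hom_uminus)
  qed
  then obtain v \<pi>' where \<pi>': "\<pi> = [:-v, 1:] * \<pi>'" by (auto simp: poly_eq_0_iff_dvd)
  have "\<pi>' \<noteq> 0" using \<pi>' less.prems(1) by auto
  then have degree: "degree \<pi>' < degree \<pi>" unfolding \<pi>' by (subst degree_mult_eq) simp_all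
  have "poly (map_poly e \<pi>) t = (t - e v) * poly (map_poly e \<pi>') t"
    unfolding \<pi>' map_poly_hom.hom_mult by (simp add: map_poly_pCons_hom hom_uminus algebra_simps)
  then have "t = e v \<or> poly (map_poly e \<pi>') t = 0" using less.prems(2) by auto
  then show ?case using less.hyps[OF degree \<open>\<pi>' \<noteq> 0\<close>] by blast
qed

section \<open>Multivariate polynomials\<close>

abbreviation (input) lookup where "lookup \<equiv> Poly_Mapping.lookup"
abbreviation (input) keys where "keys \<equiv> Poly_Mapping.keys"
abbreviation (input) single where "single \<equiv> Poly_Mapping.single"

definition mvar :: "'v::finite \<Rightarrow> 'v mpoly" where
  "mvar v = single (single v 1) 1"

definition mpoly_eval :: "(real \<Rightarrow> 'k::comm_ring_1) \<Rightarrow> ('v::finite \<Rightarrow> 'k) \<Rightarrow> 'v mpoly \<Rightarrow> 'k" where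
  "mpoly_eval e x p = (\<Sum>a\<in>keys p. e (lookup p a) * (\<Prod>v\<in>UNIV. x v ^ lookup a v))"

interpretation mconst: comm_ring_hom mconst
  by unfold_locales (simp_all add: mconst_def single_add mult_single)

lemma mpoly_additive_induct [case_names single add]:
  fixes p :: "'v::finite mpoly"
  assumes "\<And>a c. P (single a c)" "\<And>p q. P p \<Longrightarrow> P q \<Longrightarrow> P (p + q)"
  shows "P p"
proof (induction p rule: update_induct)
  case const
  show ?case using assms(1)[of 0 0] by simp
next
  case (update p a c)
  have "Poly_Mapping.update a c p = p + single a c"
    using update(1) by (intro poly_mapping_eqI) (auto simp: lookup_update lookup_add lookup_single in_keys_iff)
  then show ?case using assms update by simp
qed

lemma mvar_power: "mvar v ^ n = single (single v n) 1"
  by (induction n) (simp_all add: mvar_def mult_single flip: single_add)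

lemma single_conv_mvar:
  fixes a :: "'v::finite \<Rightarrow>\<^sub>0 nat"
  shows "single a c = mconst c * (\<Prod>v\<in>UNIV. mvar v ^ lookup a v)"
proof -
  have "(\<Prod>v\<in>S. single (g v) (1::real)) = single (\<Sum>v\<in>S. g v) 1" if "finite S" for S and g :: "'v \<Rightarrow> 'v \<Rightarrow>\<^sub>0 nat"
    using that by (induction S rule: finite_induct) (simp_all add: mult_single)
  moreover have "(\<Sum>v\<in>UNIV. single v (lookup a v)) = a"
    by (rule poly_mapping_eqI) (simp add: lookup_sum lookup_single when_def)
  ultimately show ?thesis by (simp add: mvar_power mconst_def mult_single)
qed

lemma mpoly_induct [case_names const var add mult]:
  fixes p :: "'v::finite mpoly"
  assumes const: "\<And>c. P (mconst c)" and var: "\<And>v. P (mvar v)"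
    and add: "\<And>p q. P p \<Longrightarrow> P q \<Longrightarrow> P (p + q)" and mult: "\<And>p q. P p \<Longrightarrow> P q \<Longrightarrow> P (p * q)"
  shows "P p"
proof (rule mpoly_additive_induct)
  fix a c
  have one: "P 1" using const[of 1] by simp
  have "P (mvar v ^ n)" for v n by (induction n) (simp_all add: one var mult)
  then have "P (\<Prod>v\<in>S. mvar v ^ lookup a v)" for S
    by (induction S rule: infinite_finite_induct) (simp_all add: one mult)
  then show "P (single a c)" unfolding single_conv_mvar using const mult by blast
qed (rule add)

lemma mpoly_eval_single:
  "e 0 = 0 \<Longrightarrow> mpoly_eval e x (single a c) = e c * (\<Prod>v\<in>UNIV. x v ^ lookup a v)"
  by (simp add: mpoly_eval_def)

lemma comm_ring_hom_mpoly_eval: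
  fixes e :: "real \<Rightarrow> 'k::comm_ring_1"
  assumes "comm_ring_hom e"
  shows "comm_ring_hom (mpoly_eval e x)"
proof -
  interpret comm_ring_hom e by fact
  note eval_single = mpoly_eval_single[of e, OF hom_zero]
  have eval_add: "mpoly_eval e x (p + q) = mpoly_eval e x p + mpoly_eval e x q" for p q
    unfolding mpoly_eval_def by (rule setsum_keys_plus_distrib) (simp_all add: hom_add distrib_right)
  have eval_mult: "mpoly_eval e x (p * q) = mpoly_eval e x p * mpoly_eval e x q" for p q
  proof (induction p rule: mpoly_additive_induct)
    case (single a c)
    show ?case
    proof (induction q rule: mpoly_additive_induct)
      case (single b d)
      show ?case by (simp add: mult_single eval_single hom_mult lookup_add power_add prod.distrib ac_simps)
    qed (simp add: distrib_left eval_add)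
  qed (simp add: distrib_right eval_add)
  have "mpoly_eval e x 0 = 0" by (simp add: mpoly_eval_def)
  moreover have "mpoly_eval e x 1 = 1" using eval_single[of x 0 1] by simp
  ultimately show ?thesis by unfold_locales (simp_all add: eval_add eval_mult)
qed

lemma mpoly_eval_mconst: "e 0 = 0 \<Longrightarrow> mpoly_eval e x (mconst c) = e c"
  by (simp add: mconst_def mpoly_eval_single)

lemma mpoly_eval_mvar:
  assumes "e 0 = 0" "e 1 = 1"
  shows "mpoly_eval e x (mvar v) = x v"
proof -
  have "(\<Prod>w\<in>UNIV. x w ^ lookup (single v 1) w) = (\<Prod>w\<in>UNIV. if w = v then x v else 1)"
    by (intro prod.cong) (auto simp: lookup_single when_def)
  then show ?thesis by (simp add: mvar_def mpoly_eval_single assms)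
qed

lemma comm_ring_hom_compose: "comm_ring_hom f \<Longrightarrow> comm_ring_hom g \<Longrightarrow> comm_ring_hom (\<lambda>x. g (f x))"
  unfolding comm_ring_hom_def ring_hom_def semiring_hom_def comm_monoid_add_hom_def monoid_add_hom_def
    monoid_mult_hom_def semigroup_add_hom_def semigroup_mult_hom_def plus_hom_def times_hom_def
    zero_hom_def one_hom_def by simp

lemma comm_ring_hom_eq_mpoly_eval:
  fixes e :: "'v::finite mpoly \<Rightarrow> 'k::comm_ring_1"
  assumes "comm_ring_hom e"
  shows "e p = mpoly_eval (\<lambda>c. e (mconst c)) (\<lambda>v. e (mvar v)) p"
proof -
  interpret e: comm_ring_hom e by fact
  interpret scalar: comm_ring_hom "\<lambda>c. e (mconst c)"
    by (rule comm_ring_hom_compose[OF mconst.comm_ring_hom_axioms assms])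
  interpret eval: comm_ring_hom "mpoly_eval (\<lambda>c. e (mconst c)) (\<lambda>v. e (mvar v))"
    by (rule comm_ring_hom_mpoly_eval) (rule scalar.comm_ring_hom_axioms)
  show ?thesis
    by (induction p rule: mpoly_induct)
      (simp_all add: mpoly_eval_mconst mpoly_eval_mvar e.hom_add eval.hom_add e.hom_mult eval.hom_mult)
qed

lemma comm_ring_hom_id: "comm_ring_hom (\<lambda>x. x)"
  by unfold_locales simp_all

lemma meval_conv_mpoly_eval: "meval p x = mpoly_eval (\<lambda>x. x) (\<lambda>v. x $ v) p"
  by (simp add: meval_def mpoly_eval_def)

interpretation meval: comm_ring_hom "\<lambda>p. meval p x" for x
  unfolding meval_conv_mpoly_eval by (rule comm_ring_hom_mpoly_eval[OF comm_ring_hom_id])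

lemmas meval_simps = meval.hom_add meval.hom_mult meval.hom_uminus meval.hom_minus meval.hom_power meval.hom_sum

lemma meval_mconst [simp]: "meval (mconst c) x = c"
  by (simp add: meval_conv_mpoly_eval mpoly_eval_mconst)

lemma meval_mvar [simp]: "meval (mvar v) x = x $ v"
  by (simp add: meval_conv_mpoly_eval mpoly_eval_mvar)

lemma mpderiv_add: "mpderiv v (p + q) = mpderiv v p + mpderiv v q"
  unfolding mpderiv_def by (rule setsum_keys_plus_distrib) (simp_all add: distrib_right single_add)

lemma mpderiv_single: "mpderiv v (single a c) = single (a - single v 1) (c * real (lookup a v))"
  by (simp add: mpderiv_def)

lemma mpderiv_mult: "mpderiv v (p * q) = p * mpderiv v q + q * mpderiv v p"
proof (induction p rule: mpoly_additive_induct)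
  case (single a c)
  show ?case
  proof (induction q rule: mpoly_additive_induct)
    case (single b d)
    have shift: "single (a + (b - single v 1)) (c * (d * real (lookup b v))) =
        single (a + b - single v 1) (c * (d * real (lookup b v)))" for a b and c d :: real
    proof (cases "lookup b v = 0")
      case False
      have "a + (b - single v 1) = a + b - single v 1"
        by (rule poly_mapping_eqI) (use False in \<open>auto simp: lookup_add lookup_minus lookup_single when_def\<close>)
      then show ?thesis by simp
    qed simp
    show ?case
      using shift[of a b c d] shift[of b a d c]
      by (simp add: mpderiv_single mult_single lookup_add add.commute[of b a] single_add[symmetric] algebra_simps)
  qed (simp add: distrib_left distrib_right mpderiv_add algebra_simps)
qed (simp add: distrib_left distrib_right mpderiv_add algebra_simps)

lemma mpderiv_mconst: "mpderiv v (mconst c) = 0"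
  by (simp add: mconst_def mpderiv_single)

lemma mpderiv_mvar: "mpderiv v (mvar w) = (if v = w then 1 else 0)"
  by (auto simp: mvar_def mpderiv_single lookup_single)

definition mgrad :: "'v::finite mpoly \<Rightarrow> real^'v \<Rightarrow> real^'v" where
  "mgrad p x = (\<chi> v. meval (mpderiv v p) x)"

lemma mgrad_mconst: "mgrad (mconst c) x = 0"
  by (simp add: mgrad_def mpderiv_mconst vec_eq_iff)

lemma mgrad_mvar: "mgrad (mvar v) x = axis v 1"
  by (simp add: mgrad_def mpderiv_mvar vec_eq_iff axis_def)

lemma mgrad_add: "mgrad (p + q) x = mgrad p x + mgrad q x"
  by (simp add: mgrad_def mpderiv_add meval_simps vec_eq_iff)

lemma mgrad_mult: "mgrad (p * q) x = meval p x *\<^sub>R mgrad q x + meval q x *\<^sub>R mgrad p x"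
  by (simp add: mgrad_def mpderiv_mult meval_simps vec_eq_iff)

lemma meval_has_derivative [derivative_intros]:
  "(meval p has_derivative (\<lambda>h. mgrad p x \<bullet> h)) (at x)"
proof (induction p rule: mpoly_induct)
  case (var v)
  show ?case
    by (simp add: mgrad_mvar inner_axis' bounded_linear_imp_has_derivative bounded_linear_vec_nth)
next
  case (add p q)
  from has_derivative_add[OF add] show ?case by (simp add: meval_simps mgrad_add inner_add_left)
next
  case (mult p q)
  have "(\<lambda>h. mgrad (p * q) x \<bullet> h) = (\<lambda>h. meval p x * (mgrad q x \<bullet> h) + (mgrad p x \<bullet> h) * meval q x)"
    by (simp add: fun_eq_iff mgrad_mult inner_add_left)
  with has_derivative_mult[OF mult] show ?case by (simp add: meval_simps)
qed (simp add: mgrad_mconst)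

lemma continuous_on_meval [continuous_intros]: "continuous_on S (meval p)"
  using has_derivative_continuous[OF meval_has_derivative[of p]]
  by (auto intro: continuous_at_imp_continuous_on)

lemma continuous_on_mgrad [continuous_intros]: "continuous_on S (mgrad p)"
  unfolding mgrad_def by (intro continuous_on_vec_lambda continuous_on_meval)

lemma mdeg_le_iff: "mdeg p \<le> d \<longleftrightarrow> (\<forall>a\<in>keys p. mdeg_mono a \<le> d)"
  by (simp add: mdeg_def)

lemma mdeg_mono_le_mdeg: "a \<in> keys p \<Longrightarrow> mdeg_mono a \<le> mdeg p"
  using mdeg_le_iff by blast

lemma mdeg_add: "mdeg (p + q) \<le> max (mdeg p) (mdeg q)"
  unfolding mdeg_le_iff using keys_add[of p q] mdeg_mono_le_mdeg[of _ p] mdeg_mono_le_mdeg[of _ q]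
  by (fastforce simp: le_max_iff_disj)

lemma mdeg_mult: "mdeg (p * q) \<le> mdeg p + mdeg q"
  unfolding mdeg_le_iff
proof
  fix k assume "k \<in> keys (p * q)"
  then obtain a b where "a \<in> keys p" "b \<in> keys q" "k = a + b" using keys_mult[of p q] by blast
  moreover have "mdeg_mono (a + b) = mdeg_mono a + mdeg_mono b"
    by (simp add: mdeg_mono_def lookup_add sum.distrib)
  ultimately show "mdeg_mono k \<le> mdeg p + mdeg q" by (simp add: add_mono mdeg_mono_le_mdeg)
qed

lemma mdeg_mconst [simp]: "mdeg (mconst c) = 0"
  using mdeg_le_iff[of "mconst c" 0] by (auto simp: mconst_def mdeg_mono_def split: if_splits)

lemma mdeg_0 [simp]: "mdeg 0 = 0" and mdeg_1 [simp]: "mdeg 1 = 0"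
  using mdeg_mconst[of 0] mdeg_mconst[of 1] by simp_all

lemma mdeg_poly_map_poly_mconst: "mdeg (poly (map_poly mconst q) g) \<le> degree q * mdeg g"
proof (induction q)
  case (pCons a q)
  have eval: "poly (map_poly mconst (pCons a q)) g = mconst a + g * poly (map_poly mconst q) g"
    by (simp add: mconst.map_poly_pCons_hom)
  have "mdeg (poly (map_poly mconst (pCons a q)) g) \<le> mdeg (g * poly (map_poly mconst q) g)"
    unfolding eval using mdeg_add[of "mconst a" "g * poly (map_poly mconst q) g"] by simp
  also have "\<dots> \<le> degree (pCons a q) * mdeg g"
    using mdeg_mult[of g "poly (map_poly mconst q) g"] pCons.IH by (cases "q = 0") auto
  finally show ?case .
qed simp

section \<open>The residue field of a prime cone\<close>

definition directional_deriv :: "('v::finite \<Rightarrow> 'v mpoly) \<Rightarrow> 'v mpoly \<Rightarrow> 'v mpoly" where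
  "directional_deriv w g = (\<Sum>v\<in>UNIV. mpderiv v g * w v)"

definition has_real_points :: "'v::finite mpoly set \<Rightarrow> bool" where
  "has_real_points P \<longleftrightarrow> (\<forall>F\<subseteq>P. finite F \<longrightarrow> (\<exists>x. \<forall>f\<in>F. meval f x \<ge> 0))"

definition has_tangents :: "'v::finite mpoly set \<Rightarrow> bool" where
  "has_tangents P \<longleftrightarrow> (\<forall>f. (\<exists>v. f - mconst v \<in> supp P) \<or>
     (\<exists>w. directional_deriv w ` supp P \<subseteq> supp P \<and> directional_deriv w f \<notin> supp P))"

(* Types cannot depend on a prime cone, so the residue field of an arbitrary cone is not available
   as a type. Instead we fix one cone that violates the two properties to be proved, if there is
   any, and show that its residue field leads to a contradiction. *)

definition exceptional_cone :: "'v::finite mpoly set" where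
  "exceptional_cone = (SOME P. prime_cone P \<and>
     (has_real_points P \<and> has_tangents P \<longrightarrow> (\<forall>Q. prime_cone Q \<longrightarrow> has_real_points Q \<and> has_tangents (Q :: 'v mpoly set))))"

lemma prime_cone_eval: "prime_cone {p. meval p x \<ge> 0}"
proof -
  have "supp {p. meval p x \<ge> 0} = {p. meval p x = 0}" by (auto simp: supp_def meval_simps)
  then show ?thesis by unfold_locales (auto simp: meval_simps)
qed

lemma exceptional_cone:
  "prime_cone (exceptional_cone :: 'v::finite mpoly set) \<and>
    (has_real_points (exceptional_cone :: 'v mpoly set) \<and> has_tangents (exceptional_cone :: 'v mpoly set) \<longrightarrow>
      (\<forall>Q :: 'v mpoly set. prime_cone Q \<longrightarrow> has_real_points Q \<and> has_tangents Q))"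
  unfolding exceptional_cone_def
proof (rule someI_ex)
  have "prime_cone {p :: 'v mpoly. meval p 0 \<ge> 0}" by (rule prime_cone_eval)
  then show "\<exists>P :: 'v mpoly set. prime_cone P \<and>
     (has_real_points P \<and> has_tangents P \<longrightarrow> (\<forall>Q. prime_cone Q \<longrightarrow> has_real_points Q \<and> has_tangents (Q :: 'v mpoly set)))"
    by blast
qed

interpretation exceptional: prime_cone exceptional_cone
  using exceptional_cone by blast

lemma (in prime_cone) mem_iff_if_diff_supp:
  assumes "a - b \<in> supp P"
  shows "a \<in> P \<longleftrightarrow> b \<in> P"
  using add_mem[of a "- (a - b)"] add_mem[of b "a - b"] assms by (auto simp: supp_def)

quotient_type (overloaded) 'v residue_ring = "'v::finite mpoly" / "\<lambda>a b. a - b \<in> supp exceptional_cone"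
  morphisms residue_rep residue_class
proof (rule equivpI)
  show "reflp (\<lambda>a b::'v mpoly. a - b \<in> supp exceptional_cone)"
    by (rule reflpI) (simp add: exceptional.supp_zero)
  show "symp (\<lambda>a b::'v mpoly. a - b \<in> supp exceptional_cone)"
    by (rule sympI) (use exceptional.supp_uminus in fastforce)
  show "transp (\<lambda>a b::'v mpoly. a - b \<in> supp exceptional_cone)"
    by (rule transpI) (use exceptional.supp_add in fastforce)
qed

instantiation residue_ring :: (finite) comm_ring_1
begin

lift_definition zero_residue_ring :: "'a residue_ring" is 0 .

lift_definition one_residue_ring :: "'a residue_ring" is 1 .

lift_definition plus_residue_ring :: "'a residue_ring \<Rightarrow> 'a residue_ring \<Rightarrow> 'a residue_ring" is "(+)"
  subgoal for a b c d
    using exceptional.supp_add[of "a - b" "c - d"] by (simp add: algebra_simps)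
  done

lift_definition uminus_residue_ring :: "'a residue_ring \<Rightarrow> 'a residue_ring" is uminus
  subgoal for a b
    using exceptional.supp_uminus[of "a - b"] by simp
  done

lift_definition times_residue_ring :: "'a residue_ring \<Rightarrow> 'a residue_ring \<Rightarrow> 'a residue_ring" is "(*)"
  subgoal for a b c d
    using exceptional.supp_add[of "a * (c - d)" "(a - b) * d"]
      exceptional.supp_mult_left[of "c - d" a] exceptional.supp_mult_right[of "a - b" d]
    by (simp add: algebra_simps)
  done

definition minus_residue_ring :: "'a residue_ring \<Rightarrow> 'a residue_ring \<Rightarrow> 'a residue_ring" where
  "minus_residue_ring x y = x + - y"

instance
proof
  fix a b c :: "'a residue_ring"
  show "a * b * c = a * (b * c)" "a * b = b * a" "1 * a = a" "a + b + c = a + (b + c)" "a + b = b + a"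
    "0 + a = a" "- a + a = 0" "(a + b) * c = a * c + b * c"
    by (transfer; simp add: exceptional.supp_zero algebra_simps)+
  show "a - b = a + - b" by (rule minus_residue_ring_def)
  show "(0::'a residue_ring) \<noteq> 1"
    by transfer (simp add: supp_def exceptional.minus_one_not_mem)
qed

end

instance residue_ring :: (finite) idom
proof
  fix a b :: "'a residue_ring" assume "a \<noteq> 0" "b \<noteq> 0"
  then show "a * b \<noteq> 0" by transfer (use exceptional.prime in auto)
qed

instantiation residue_ring :: (finite) linordered_idom
begin

lift_definition nonneg_residue :: "'a residue_ring \<Rightarrow> bool" is "\<lambda>a. a \<in> exceptional_cone"
  by (rule exceptional.mem_iff_if_diff_supp)

definition less_eq_residue_ring :: "'a residue_ring \<Rightarrow> 'a residue_ring \<Rightarrow> bool" where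
  "less_eq_residue_ring x y \<longleftrightarrow> nonneg_residue (y - x)"

definition less_residue_ring :: "'a residue_ring \<Rightarrow> 'a residue_ring \<Rightarrow> bool" where
  "less_residue_ring x y \<longleftrightarrow> x \<le> y \<and> \<not> y \<le> x"

definition abs_residue_ring :: "'a residue_ring \<Rightarrow> 'a residue_ring" where
  "abs_residue_ring x = (if x < 0 then - x else x)"

definition sgn_residue_ring :: "'a residue_ring \<Rightarrow> 'a residue_ring" where
  "sgn_residue_ring x = (if x = 0 then 0 else if 0 < x then 1 else - 1)"

instance
proof
  interpret positive_cone "Collect (nonneg_residue :: 'a residue_ring \<Rightarrow> bool)"
  proof (unfold_locales; unfold mem_Collect_eq)
    show "nonneg_residue (0 :: 'a residue_ring)" "nonneg_residue (1 :: 'a residue_ring)"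
      by (transfer; rule exceptional.zero_mem exceptional.one_mem)+
    fix x y :: "'a residue_ring"
    show "nonneg_residue x \<Longrightarrow> nonneg_residue y \<Longrightarrow> nonneg_residue (x + y)"
      by transfer (rule exceptional.add_mem)
    show "nonneg_residue x \<Longrightarrow> nonneg_residue y \<Longrightarrow> nonneg_residue (x * y)"
      by transfer (rule exceptional.mult_mem)
    show "nonneg_residue x \<or> nonneg_residue (- x)"
      by transfer (rule exceptional.total)
    show "nonneg_residue x \<Longrightarrow> nonneg_residue (- x) \<Longrightarrow> x = 0"
      by transfer (simp add: supp_def)
  qed
  have le_iff: "x \<le> y \<longleftrightarrow> y - x \<in> Collect nonneg_residue" for x y :: "'a residue_ring"
    by (simp add: less_eq_residue_ring_def)
  fix x y z :: "'a residue_ring"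
  show "x < y \<longleftrightarrow> x \<le> y \<and> \<not> y \<le> x" by (rule less_residue_ring_def)
  show "x \<le> x" unfolding le_iff by (simp only: diff_self zero_mem)
  show "x \<le> y \<Longrightarrow> y \<le> z \<Longrightarrow> x \<le> z" unfolding le_iff by (rule diff_mem_trans)
  show "x \<le> y \<Longrightarrow> y \<le> x \<Longrightarrow> x = y" unfolding le_iff by (rule diff_mem_antisym)
  show "x \<le> y \<or> y \<le> x" unfolding le_iff by (rule diff_mem_linear)
  show "x \<le> y \<Longrightarrow> z + x \<le> z + y" unfolding le_iff by simp
  show "x < y \<Longrightarrow> 0 < z \<Longrightarrow> z * x < z * y"
    unfolding less_residue_ring_def le_iff using mult_diff_mem_strict[of y x z] by auto
  show "\<bar>x\<bar> = (if x < 0 then - x else x)" by (rule abs_residue_ring_def)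
  show "sgn x = (if x = 0 then 0 else if 0 < x then 1 else - 1)" by (rule sgn_residue_ring_def)
qed

end

definition residue :: "'v::finite mpoly \<Rightarrow> 'v residue_ring fract" where
  "residue p = Fract (residue_class p) 1"

interpretation residue: comm_ring_hom residue
  by unfold_locales
    (simp_all add: residue_def Zero_fract_def One_fract_def flip: zero_residue_ring.abs_eq one_residue_ring.abs_eq
      plus_residue_ring.abs_eq times_residue_ring.abs_eq)

lemma residue_nonneg_iff: "residue p \<ge> 0 \<longleftrightarrow> p \<in> exceptional_cone"
proof -
  have "residue p \<ge> 0 \<longleftrightarrow> residue_class p \<ge> 0" by (simp add: residue_def Zero_fract_def)
  also have "\<dots> \<longleftrightarrow> p \<in> exceptional_cone"
    by (simp add: less_eq_residue_ring_def nonneg_residue.abs_eq)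
  finally show ?thesis .
qed

lemma residue_eq_0_iff: "residue p = 0 \<longleftrightarrow> p \<in> supp exceptional_cone"
  using residue_nonneg_iff[of p] residue_nonneg_iff[of "- p"] by (auto simp: supp_def residue.hom_uminus)

lemma residue_fraction:
  obtains a b where "residue b \<noteq> 0" "residue a = residue b * y"
proof (cases y)
  case (Fract u w)
  obtain a b where "u = residue_class a" "w = residue_class b"
    using Quotient3_abs_rep[OF Quotient3_residue_ring] by metis
  with Fract show thesis using that[of b a] by (simp add: residue_def Zero_fract_def eq_fract)
qed

lemma common_denominator:
  assumes "finite S"
  shows "\<exists>b. residue b \<noteq> 0 \<and> (\<forall>s\<in>S. \<exists>a. residue a = residue b * y s)"
  using assms
proof (induction S rule: finite_induct)
  case empty
  show ?case by (rule exI[of _ 1]) simp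
next
  case (insert s S)
  then obtain b where b: "residue b \<noteq> 0" "\<forall>s\<in>S. \<exists>a. residue a = residue b * y s" by blast
  obtain a' b' where ab': "residue b' \<noteq> 0" "residue a' = residue b' * y s" by (rule residue_fraction)
  have "\<exists>a. residue a = residue (b * b') * y r" if r: "r \<in> insert s S" for r
  proof (cases "r = s")
    case True
    then show ?thesis using ab' by (intro exI[of _ "b * a'"]) (simp add: residue.hom_mult)
  next
    case False
    then obtain a where "residue a = residue b * y r" using b r by blast
    then show ?thesis by (intro exI[of _ "b' * a"]) (simp add: residue.hom_mult)
  qed
  then show ?case using b ab' by (intro exI[of _ "b * b'"]) (simp add: residue.hom_mult)
qed

lemma field_hom_comp_mconst:
  fixes e :: "'v::finite mpoly \<Rightarrow> 'k::field"
  assumes "comm_ring_hom e"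
  shows "field_hom (\<lambda>c. e (mconst c))"
  by (intro field_hom.intro idom_hom.intro comm_ring_hom_compose[OF mconst.comm_ring_hom_axioms assms])

section \<open>Tangent vectors at a prime cone\<close>

context partial_derivation
begin

lemma derivation_mpoly_hom:
  fixes e :: "'v::finite mpoly \<Rightarrow> 'k"
  assumes "comm_ring_hom e" and const: "\<And>c. e (mconst c) \<in> L" "\<And>c. D (e (mconst c)) = 0"
    and var: "\<And>v. e (mvar v) \<in> L"
  shows "e g \<in> L \<and> D (e g) = (\<Sum>v\<in>UNIV. e (mpderiv v g) * D (e (mvar v)))"
proof -
  interpret e: comm_ring_hom e by fact
  show ?thesis
  proof (induction g rule: mpoly_induct)
    case (var u)
    have "(\<Sum>v\<in>UNIV. e (mpderiv v (mvar u)) * D (e (mvar v))) = (\<Sum>v\<in>UNIV. if v = u then D (e (mvar u)) else 0)"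
      by (intro sum.cong) (auto simp: mpderiv_mvar)
    then show ?case using assms(4) by simp
  next
    case (add p q)
    then show ?case by (simp add: e.hom_add mpderiv_add add_mem D_add distrib_right sum.distrib)
  next
    case (mult p q)
    then show ?case
      by (simp add: e.hom_mult e.hom_add mpderiv_mult mult_mem D_mult distrib_right sum.distrib
          sum_distrib_left mult.assoc)
  qed (simp add: const mpderiv_mconst)
qed

end

lemma residue_tangent_vector:
  fixes f :: "'v::finite mpoly"
  assumes "\<And>\<pi>. \<pi> \<noteq> 0 \<Longrightarrow> poly (map_poly (\<lambda>c. residue (mconst c)) \<pi>) (residue f) \<noteq> 0"
  shows "\<exists>w. directional_deriv w ` supp exceptional_cone \<subseteq> supp exceptional_cone \<and>
    directional_deriv w f \<notin> supp exceptional_cone"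
proof -
  interpret scalar: field_hom "\<lambda>c. residue (mconst c) :: 'v residue_ring fract"
    by (rule field_hom_comp_mconst[OF residue.comm_ring_hom_axioms])
  obtain L D where "partial_derivation L D" and L: "range (\<lambda>c. residue (mconst c)) \<subseteq> L" "range (\<lambda>v. residue (mvar v)) \<subseteq> L"
    and D: "\<And>c. D (residue (mconst c)) = 0" "D (residue f) = 1"
    by (rule derivation_with_unit_value[OF scalar.field_hom_axioms scalar.transcendental_over_range[OF assms],
          of "range (\<lambda>v. residue (mvar v))"]) auto
  then interpret partial_derivation L D by simp
  obtain b where b: "residue b \<noteq> 0" "\<forall>v\<in>UNIV. \<exists>a. residue a = residue b * D (residue (mvar v))"
    using common_denominator[of UNIV "\<lambda>v. D (residue (mvar v))"] by auto
  then obtain w where w: "\<And>v. residue (w v) = residue b * D (residue (mvar v))" by (metis UNIV_I)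
  have residue_deriv: "residue (directional_deriv w g) = residue b * D (residue g)" for g
  proof -
    have "D (residue g) = (\<Sum>v\<in>UNIV. residue (mpderiv v g) * D (residue (mvar v)))"
      using derivation_mpoly_hom[OF residue.comm_ring_hom_axioms] L D(1) by blast
    then show ?thesis
      by (simp add: directional_deriv_def residue.hom_sum residue.hom_mult w sum_distrib_left mult_ac)
  qed
  have "residue (directional_deriv w g) = 0" if "residue g = 0" for g unfolding residue_deriv that D_0 by simp
  moreover have "residue (directional_deriv w f) \<noteq> 0" unfolding residue_deriv D(2) using b(1) by simp
  ultimately show ?thesis unfolding residue_eq_0_iff by blast
qed

lemma exceptional_cone_has_tangents: "has_tangents (exceptional_cone :: 'v::finite mpoly set)"
  unfolding has_tangents_def
proof
  fix f :: "'v mpoly"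
  let ?e = "\<lambda>c. residue (mconst c) :: 'v residue_ring fract"
  show "(\<exists>v. f - mconst v \<in> supp exceptional_cone) \<or>
    (\<exists>w. directional_deriv w ` supp exceptional_cone \<subseteq> supp exceptional_cone \<and>
      directional_deriv w f \<notin> supp exceptional_cone)"
  proof (cases "\<exists>\<pi>. \<pi> \<noteq> 0 \<and> poly (map_poly ?e \<pi>) (residue f) = 0")
    case True
    then obtain v where "residue f = ?e v"
      using algebraic_over_reals_is_real[OF field_hom_comp_mconst[OF residue.comm_ring_hom_axioms]] by blast
    then have "residue (f - mconst v) = 0" by (simp add: residue.hom_minus)
    then show ?thesis by (auto simp: residue_eq_0_iff)
  next
    case False
    then show ?thesis using residue_tangent_vector[of f] by blast
  qed
qed

section \<open>Real points of a prime cone\<close>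

definition split_var :: "'v::finite \<Rightarrow> 'v mpoly \<Rightarrow> 'v mpoly poly" where
  "split_var w = mpoly_eval (\<lambda>c. [:mconst c:]) (\<lambda>v. if v = w then [:0, 1:] else [:mvar v:])"

lemma comm_ring_hom_const_poly: "comm_ring_hom (\<lambda>c. [:c:])"
  by unfold_locales (simp_all add: one_pCons)

lemma mpoly_eval_split_var:
  fixes y :: "'v::finite \<Rightarrow> 'k::comm_ring_1"
  assumes "comm_ring_hom e"
  shows "poly (map_poly (mpoly_eval e (y(w := 0))) (split_var w p)) (y w) = mpoly_eval e y p"
proof -
  interpret e: comm_ring_hom e by fact
  interpret eval: comm_ring_hom "mpoly_eval e (y(w := 0))" by (rule comm_ring_hom_mpoly_eval[OF assms])
  interpret map_eval: map_poly_comm_ring_hom "mpoly_eval e (y(w := 0))" ..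
  have const_hom: "comm_ring_hom (\<lambda>c. [:mconst c:] :: 'v mpoly poly)"
    by (rule comm_ring_hom_compose[OF mconst.comm_ring_hom_axioms comm_ring_hom_const_poly])
  have split_hom: "comm_ring_hom (split_var w)"
    unfolding split_var_def by (rule comm_ring_hom_mpoly_eval[OF const_hom])
  have hom: "comm_ring_hom (\<lambda>p. poly (map_poly (mpoly_eval e (y(w := 0))) (split_var w p)) (y w))"
    by (rule comm_ring_hom_compose[OF comm_ring_hom_compose[OF split_hom map_eval.comm_ring_hom_axioms]
          poly_hom.comm_ring_hom_axioms])
  have "split_var w (mconst c) = [:mconst c:]" "split_var w (mvar v) = (if v = w then [:0, 1:] else [:mvar v:])" for c v
    unfolding split_var_def by (simp_all add: mpoly_eval_mconst mpoly_eval_mvar one_pCons)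
  then show ?thesis
    by (subst comm_ring_hom_eq_mpoly_eval[OF hom], intro arg_cong2[where f = "\<lambda>e y. mpoly_eval e y p"] ext)
      (simp_all add: eval.map_poly_pCons_hom mpoly_eval_mconst mpoly_eval_mvar)
qed

lemma same_sign_mpoly_eval_hom:
  fixes e :: "real \<Rightarrow> 'k::linordered_field"
  assumes "field_hom e"
  shows "same_sign (mpoly_eval (\<lambda>x. x) x p) (mpoly_eval e (\<lambda>v. e (x v)) p)"
proof -
  interpret field_hom e by fact
  have hom: "comm_ring_hom (\<lambda>p. e (mpoly_eval (\<lambda>x. x) x p))"
    by (rule comm_ring_hom_compose[OF comm_ring_hom_mpoly_eval[OF comm_ring_hom_id] comm_ring_hom_axioms])
  have "e (mpoly_eval (\<lambda>x. x) x p) = mpoly_eval e (\<lambda>v. e (x v)) p"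
    by (subst comm_ring_hom_eq_mpoly_eval[OF hom]) (simp add: mpoly_eval_mconst mpoly_eval_mvar)
  then show ?thesis using field_hom_real_same_sign[OF assms, of "mpoly_eval (\<lambda>x. x) x p"] by simp
qed

(* The coordinates in S are replaced by real ones one at a time, each time by Muchnik's sign transfer. *)
lemma sign_realization:
  fixes e :: "real \<Rightarrow> 'k::real_closed_field" and y :: "'v::finite \<Rightarrow> 'k"
  assumes hom: "field_hom e"
  shows "finite S \<Longrightarrow> finite F \<Longrightarrow> (\<And>v. v \<notin> S \<Longrightarrow> y v = e (a v)) \<Longrightarrow>
    \<exists>x. (\<forall>v. v \<notin> S \<longrightarrow> x v = a v) \<and> (\<forall>f\<in>F. same_sign (mpoly_eval (\<lambda>x. x) x f) (mpoly_eval e y f))"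
proof (induction S arbitrary: F y a rule: finite_induct)
  case (empty F y a)
  then have "y = (\<lambda>v. e (a v))" by auto
  then show ?case using same_sign_mpoly_eval_hom[OF hom] by blast
next
  case (insert w S F y a)
  interpret field_hom e by fact
  let ?F = "split_var w ` F"
  have finite: "finite (muchnik_coeffs ?F)" using insert.prems(1) by (simp add: finite_muchnik_coeffs)
  have zero: "(y(w := 0)) v = e ((a(w := 0)) v)" if "v \<notin> S" for v using insert.prems(2) that by auto
  obtain x where x: "\<forall>v. v \<notin> S \<longrightarrow> x v = (a(w := 0)) v"
    and signs: "\<forall>c\<in>muchnik_coeffs ?F. same_sign (mpoly_eval (\<lambda>x. x) x c) (mpoly_eval e (y(w := 0)) c)"
    using insert.IH[where y = "y(w := 0)" and a = "a(w := 0)", OF finite zero] by blast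
  interpret matching_specializations "mpoly_eval (\<lambda>x. x) x" "mpoly_eval e (y(w := 0))" ?F
    using insert.prems(1) signs
    by (intro matching_specializations.intro matching_specializations_axioms.intro
        comm_ring_hom_mpoly_eval[OF comm_ring_hom_id] comm_ring_hom_mpoly_eval[OF comm_ring_hom_axioms]) auto
  obtain t where t: "\<forall>f\<in>F. same_sign (poly (map_poly (mpoly_eval (\<lambda>x. x) x) (split_var w f)) t)
      (poly (map_poly (mpoly_eval e (y(w := 0))) (split_var w f)) (y w))"
    using sign_transfer[of "y w"] by blast
  have "(x(w := t))(w := 0) = x" using x insert.hyps(2) by auto
  then have "\<forall>f\<in>F. same_sign (mpoly_eval (\<lambda>x. x) (x(w := t)) f) (mpoly_eval e y f)"
    using t mpoly_eval_split_var[OF comm_ring_hom_id, of "x(w := t)" w]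
      mpoly_eval_split_var[OF comm_ring_hom_axioms, of y w] by simp
  moreover have "\<forall>v. v \<notin> insert w S \<longrightarrow> (x(w := t)) v = a v" using x by auto
  ultimately show ?case by blast
qed

lemma exceptional_cone_has_real_points: "has_real_points (exceptional_cone :: 'v::finite mpoly set)"
  unfolding has_real_points_def
proof (intro allI impI)
  fix F :: "'v mpoly set" assume F: "F \<subseteq> exceptional_cone" "finite F"
  let ?e = "\<lambda>p :: 'v mpoly. to_rc (residue p)"
  have hom: "comm_ring_hom ?e"
    by (rule comm_ring_hom_compose[OF residue.comm_ring_hom_axioms to_rc.comm_ring_hom_axioms])
  obtain x where "\<forall>f\<in>F. same_sign (mpoly_eval (\<lambda>x. x) x f) (mpoly_eval (\<lambda>c. ?e (mconst c)) (\<lambda>v. ?e (mvar v)) f)"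
    using sign_realization[OF field_hom_comp_mconst[OF hom] finite_class.finite_UNIV F(2)] by blast
  then have x: "same_sign (mpoly_eval (\<lambda>x. x) x f) (?e f)" if "f \<in> F" for f
    using that by (subst comm_ring_hom_eq_mpoly_eval[OF hom]) blast
  have "meval f (\<chi> v. x v) \<ge> 0" if "f \<in> F" for f
  proof -
    have "?e f \<ge> 0" using that F(1) by (intro to_rc_nonneg) (auto simp: residue_nonneg_iff)
    then show ?thesis using x[OF that] by (simp add: meval_conv_mpoly_eval same_sign_nonneg_iff)
  qed
  then show "\<exists>x. \<forall>f\<in>F. meval f x \<ge> 0" by blast
qed

theorem Artin_Lang:
  assumes "prime_cone P" "finite F" "F \<subseteq> P"
  shows "\<exists>x. \<forall>f\<in>F. meval f x \<ge> 0"
  using exceptional_cone exceptional_cone_has_real_points exceptional_cone_has_tangents assms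
  by (fastforce simp: has_real_points_def)

theorem tangent_vector_exists:
  assumes "prime_cone P" "\<And>v. f - mconst v \<notin> supp P"
  shows "\<exists>w. directional_deriv w ` supp P \<subseteq> supp P \<and> directional_deriv w f \<notin> supp P"
  using exceptional_cone exceptional_cone_has_real_points exceptional_cone_has_tangents assms
  unfolding has_tangents_def by metis

section \<open>Ideals, quadratic modules and their truncations\<close>

locale semimodule_over = additive_submonoid S for C S :: "'a::comm_ring_1 set" +
  assumes scale_mem: "c \<in> C \<Longrightarrow> x \<in> S \<Longrightarrow> c * x \<in> S"

lemma semimodule_over_mono: "semimodule_over C S \<Longrightarrow> C' \<subseteq> C \<Longrightarrow> semimodule_over C' S"
  unfolding semimodule_over_def semimodule_over_axioms_def by blast

definition weighted_sums :: "'a::comm_ring_1 set \<Rightarrow> ('a \<Rightarrow> 'a set) \<Rightarrow> 'a set" where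
  "weighted_sums H A = {q. \<exists>a. (\<forall>h\<in>H. a h \<in> A h) \<and> q = (\<Sum>h\<in>H. h * a h)}"

lemma weighted_sumsI: "(\<And>h. h \<in> H \<Longrightarrow> a h \<in> A h) \<Longrightarrow> (\<Sum>h\<in>H. h * a h) \<in> weighted_sums H A"
  unfolding weighted_sums_def by (intro CollectI exI[of _ a]) simp

lemma weighted_sumsE:
  assumes "x \<in> weighted_sums H A"
  obtains a where "\<forall>h\<in>H. a h \<in> A h" "x = (\<Sum>h\<in>H. h * a h)"
  using assms by (auto simp: weighted_sums_def)

lemma zero_mem_weighted_sums: "(\<And>h. h \<in> H \<Longrightarrow> 0 \<in> A h) \<Longrightarrow> 0 \<in> weighted_sums H A"
  using weighted_sumsI[of H "\<lambda>_. 0" A] by simp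

lemma weighted_sums_mem:
  assumes "finite H" "h \<in> H" "b \<in> A h" and zero: "\<And>k. k \<in> H \<Longrightarrow> 0 \<in> A k"
  shows "h * b \<in> weighted_sums H A"
proof -
  have "h * b = (\<Sum>k\<in>H. if k = h then h * b else 0)" using assms(1,2) by simp
  also have "\<dots> = (\<Sum>k\<in>H. k * (if k = h then b else 0))" by (intro sum.cong) auto
  also have "\<dots> \<in> weighted_sums H A" by (rule weighted_sumsI) (simp add: assms(3) zero)
  finally show ?thesis .
qed

lemma weighted_sums_mono: "(\<And>h. h \<in> H \<Longrightarrow> A h \<subseteq> B h) \<Longrightarrow> weighted_sums H A \<subseteq> weighted_sums H B"
  unfolding weighted_sums_def by blast

lemma weighted_sums_subset:
  assumes "additive_submonoid S" "\<And>h b. h \<in> H \<Longrightarrow> b \<in> A h \<Longrightarrow> h * b \<in> S"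
  shows "weighted_sums H A \<subseteq> S"
  using assms(2) by (auto elim!: weighted_sumsE intro!: additive_submonoid.sum_mem[OF assms(1)])

lemma semimodule_over_weighted_sums:
  assumes A: "\<And>h. h \<in> H \<Longrightarrow> semimodule_over C (A h)"
  shows "semimodule_over C (weighted_sums H A)"
proof
  note submonoid = semimodule_over.axioms(1)[OF A]
  show "0 \<in> weighted_sums H A"
    by (intro zero_mem_weighted_sums additive_submonoid.zero_mem[OF submonoid])
  fix x assume "x \<in> weighted_sums H A"
  then obtain a where a: "\<forall>h\<in>H. a h \<in> A h" "x = (\<Sum>h\<in>H. h * a h)" by (rule weighted_sumsE)
  show "x + y \<in> weighted_sums H A" if "y \<in> weighted_sums H A" for y
    using that
  proof (rule weighted_sumsE)
    fix b assume b: "\<forall>h\<in>H. b h \<in> A h" "y = (\<Sum>h\<in>H. h * b h)"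
    have "x + y = (\<Sum>h\<in>H. h * (a h + b h))" by (simp add: a(2) b(2) distrib_left sum.distrib)
    also have "\<dots> \<in> weighted_sums H A"
      by (intro weighted_sumsI additive_submonoid.add_mem[OF submonoid] bspec[OF a(1)] bspec[OF b(1)])
    finally show ?thesis .
  qed
  show "c * x \<in> weighted_sums H A" if "c \<in> C" for c
  proof -
    have "c * x = (\<Sum>h\<in>H. h * (c * a h))" by (simp add: a(2) sum_distrib_left mult.left_commute)
    also have "\<dots> \<in> weighted_sums H A"
      by (intro weighted_sumsI semimodule_over.scale_mem[OF A] that bspec[OF a(1)])
    finally show ?thesis .
  qed
qed

lemma set_plus_mpI: "a \<in> A \<Longrightarrow> b \<in> B \<Longrightarrow> a + b \<in> set_plus_mp A B"
  by (auto simp: set_plus_mp_def)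

lemma set_plus_mpE:
  assumes "x \<in> set_plus_mp A B"
  obtains a b where "a \<in> A" "b \<in> B" "x = a + b"
  using assms by (auto simp: set_plus_mp_def)

lemma set_plus_mp_mono: "A \<subseteq> A' \<Longrightarrow> B \<subseteq> B' \<Longrightarrow> set_plus_mp A B \<subseteq> set_plus_mp A' B'"
  unfolding set_plus_mp_def by blast

lemma subset_set_plus_mp:
  shows "0 \<in> B \<Longrightarrow> A \<subseteq> set_plus_mp A B" and "0 \<in> A \<Longrightarrow> B \<subseteq> set_plus_mp A B"
  using set_plus_mpI[of _ A 0 B] set_plus_mpI[of 0 A _ B] by auto

lemma set_plus_mp_subset: "additive_submonoid S \<Longrightarrow> A \<subseteq> S \<Longrightarrow> B \<subseteq> S \<Longrightarrow> set_plus_mp A B \<subseteq> S"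
  by (auto elim!: set_plus_mpE intro: additive_submonoid.add_mem)

lemma semimodule_over_set_plus_mp:
  assumes "semimodule_over C A" "semimodule_over C B"
  shows "semimodule_over C (set_plus_mp A B)"
proof -
  interpret A: semimodule_over C A by fact
  interpret B: semimodule_over C B by fact
  show ?thesis
  proof
    show "0 \<in> set_plus_mp A B" using set_plus_mpI[OF A.zero_mem B.zero_mem] by simp
    fix x assume "x \<in> set_plus_mp A B"
    then obtain a b where x: "a \<in> A" "b \<in> B" "x = a + b" by (rule set_plus_mpE)
    show "x + y \<in> set_plus_mp A B" if "y \<in> set_plus_mp A B" for y
      using that
    proof (rule set_plus_mpE)
      fix a' b' assume y: "a' \<in> A" "b' \<in> B" "y = a' + b'"
      then have "x + y = (a + a') + (b + b')" using x by (simp add: add_ac)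
      also have "\<dots> \<in> set_plus_mp A B" by (intro set_plus_mpI A.add_mem B.add_mem x y)
      finally show ?thesis .
    qed
    show "c * x \<in> set_plus_mp A B" if "c \<in> C" for c
      unfolding x(3) distrib_left by (intro set_plus_mpI A.scale_mem B.scale_mem that x)
  qed
qed

lemma mult_SOS_mem:
  assumes "additive_submonoid S" "\<And>q. g * (q * q) \<in> S" "s \<in> SOS"
  shows "g * s \<in> S"
proof -
  interpret additive_submonoid S by fact
  obtain qs where "s = (\<Sum>q\<leftarrow>qs. q * q)" using assms(3) by (auto simp: SOS_def)
  then show ?thesis using assms(2) by (induction qs arbitrary: s) (simp_all add: zero_mem add_mem distrib_left)
qed

lemma SOS_subset: "additive_submonoid S \<Longrightarrow> (\<And>q. q * q \<in> S) \<Longrightarrow> SOS \<subseteq> S"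
  using mult_SOS_mem[of S 1] by auto

interpretation SOS: additive_submonoid SOS
proof
  show "0 \<in> SOS" unfolding SOS_def by (intro CollectI exI[of _ "[]"]) simp
  fix s t :: "'a mpoly" assume "s \<in> SOS" "t \<in> SOS"
  then obtain ps qs where "s = (\<Sum>q\<leftarrow>ps. q * q)" "t = (\<Sum>q\<leftarrow>qs. q * q)" by (auto simp: SOS_def)
  then have "s + t = (\<Sum>q\<leftarrow>ps @ qs. q * q)" by simp
  then show "s + t \<in> SOS" unfolding SOS_def by blast
qed

lemma SOS_square: "q * q \<in> SOS"
  unfolding SOS_def by (intro CollectI exI[of _ "[q]"]) simp

lemma SOS_mult:
  assumes "s \<in> SOS" "t \<in> SOS"
  shows "s * t \<in> SOS"
proof (rule mult_SOS_mem[OF SOS.additive_submonoid_axioms _ assms(2)])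
  fix q
  have "q * q * s \<in> SOS"
  proof (rule mult_SOS_mem[OF SOS.additive_submonoid_axioms _ assms(1)])
    show "q * q * (r * r) \<in> SOS" for r using SOS_square[of "q * r"] by (simp add: mult_ac)
  qed
  then show "s * (q * q) \<in> SOS" by (simp add: mult.commute)
qed

interpretation SOS: ring_preordering SOS
  using SOS_mult SOS_square[of 1] by unfold_locales (simp_all add: SOS_square)

interpretation SOS: semimodule_over SOS SOS
  by unfold_locales (rule SOS.mult_mem)

lemma meval_SOS:
  assumes "s \<in> SOS"
  shows "meval s u \<ge> 0"
proof -
  interpret nonneg: prime_cone "{q. meval q u \<ge> 0}" by (rule prime_cone_eval)
  have "SOS \<subseteq> {q. meval q u \<ge> 0}" by (rule SOS_subset[OF nonneg.additive_submonoid_axioms nonneg.square_mem])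
  then show ?thesis using assms by blast
qed

lemma Ideal_conv_weighted_sums: "Ideal H = weighted_sums H (\<lambda>_. UNIV)"
  by (simp add: Ideal_def weighted_sums_def)

lemma Qmod_conv_weighted_sums: "Qmod G = set_plus_mp SOS (weighted_sums G (\<lambda>_. SOS))"
  unfolding Qmod_def set_plus_mp_def weighted_sums_def by blast

lemma IQ_conv_set_plus_mp: "IQ H G = set_plus_mp (Ideal H) (Qmod G)"
  by (simp add: IQ_def set_plus_mp_def)

interpretation Ideal: semimodule_over UNIV "Ideal H"
  unfolding Ideal_conv_weighted_sums by (rule semimodule_over_weighted_sums) (unfold_locales; simp)

interpretation Qmod: semimodule_over SOS "Qmod G"
  unfolding Qmod_conv_weighted_sums
  by (intro semimodule_over_set_plus_mp semimodule_over_weighted_sums SOS.semimodule_over_axioms)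

interpretation IQ: semimodule_over SOS "IQ H G"
  unfolding IQ_conv_set_plus_mp
  by (rule semimodule_over_set_plus_mp[OF semimodule_over_mono[OF Ideal.semimodule_over_axioms subset_UNIV]
        Qmod.semimodule_over_axioms])

lemma Ideal_mem: "finite H \<Longrightarrow> h \<in> H \<Longrightarrow> h * a \<in> Ideal H"
  unfolding Ideal_conv_weighted_sums by (rule weighted_sums_mem) simp_all

lemma Qmod_mem: "finite G \<Longrightarrow> g \<in> G \<Longrightarrow> s \<in> SOS \<Longrightarrow> g * s \<in> Qmod G"
  unfolding Qmod_conv_weighted_sums
  by (rule subsetD[OF subset_set_plus_mp(2)[OF SOS.zero_mem]]) (rule weighted_sums_mem[OF _ _ _ SOS.zero_mem])

lemma SOS_subset_Qmod: "SOS \<subseteq> Qmod G"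
  unfolding Qmod_conv_weighted_sums
  by (intro subset_set_plus_mp zero_mem_weighted_sums SOS.zero_mem)

lemma Ideal_subset: "additive_submonoid S \<Longrightarrow> (\<And>h a. h \<in> H \<Longrightarrow> h * a \<in> S) \<Longrightarrow> Ideal H \<subseteq> S"
  unfolding Ideal_conv_weighted_sums by (rule weighted_sums_subset)

lemma Qmod_subset:
  assumes "additive_submonoid S" "\<And>q. q * q \<in> S" "\<And>g q. g \<in> G \<Longrightarrow> g * (q * q) \<in> S"
  shows "Qmod G \<subseteq> S"
  unfolding Qmod_conv_weighted_sums
  by (rule set_plus_mp_subset[OF assms(1) SOS_subset[OF assms(1,2)] weighted_sums_subset[OF assms(1)]])
    (rule mult_SOS_mem[OF assms(1,3)])

lemma IQ_subset: "additive_submonoid S \<Longrightarrow> Ideal H \<subseteq> S \<Longrightarrow> Qmod G \<subseteq> S \<Longrightarrow> IQ H G \<subseteq> S"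
  unfolding IQ_conv_set_plus_mp by (rule set_plus_mp_subset)

lemma Ideal_subset_IQ: "Ideal H \<subseteq> IQ H G" and Qmod_subset_IQ: "Qmod G \<subseteq> IQ H G"
  unfolding IQ_conv_set_plus_mp by (intro subset_set_plus_mp Qmod.zero_mem Ideal.zero_mem)+

definition nonneg_consts :: "'v::finite mpoly set" where
  "nonneg_consts = mconst ` {0..}"

lemma nonneg_consts_subset_SOS: "nonneg_consts \<subseteq> SOS"
proof -
  have "mconst c \<in> SOS" if "c \<ge> 0" for c
    using that SOS_square[of "mconst (sqrt c)"] by (simp flip: mconst.hom_mult)
  then show ?thesis by (auto simp: nonneg_consts_def)
qed

lemma poly_spaceI: "int (mdeg p) \<le> d \<Longrightarrow> p \<in> poly_space d"
  by (simp add: poly_space_def)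

lemma zero_mem_poly_space: "0 \<in> poly_space d"
  by (simp add: poly_space_def)

lemma semimodule_over_poly_space: "semimodule_over nonneg_consts (poly_space d)"
proof
  show "0 \<in> poly_space d" by (rule zero_mem_poly_space)
  show "p \<in> poly_space d \<Longrightarrow> q \<in> poly_space d \<Longrightarrow> p + q \<in> poly_space d" for p q :: "'a mpoly"
    using mdeg_add[of p q] by (auto simp: poly_space_def)
  show "c \<in> nonneg_consts \<Longrightarrow> p \<in> poly_space d \<Longrightarrow> c * p \<in> poly_space d" for c p :: "'a mpoly"
    using mdeg_mult[of c p] by (auto simp: poly_space_def nonneg_consts_def)
qed

lemma semimodule_over_SOS_trunc: "semimodule_over nonneg_consts (SOS_trunc d)"
  using semimodule_over_poly_space[of d] semimodule_over_mono[OF SOS.semimodule_over_axioms nonneg_consts_subset_SOS]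
  unfolding SOS_trunc_def semimodule_over_def semimodule_over_axioms_def additive_submonoid_def by blast

lemma Ideal_trunc_conv_weighted_sums:
  "Ideal_trunc H d = weighted_sums H (\<lambda>h. poly_space (int d - int (mdeg h)))"
  by (simp add: Ideal_trunc_def weighted_sums_def)

lemma Qmod_trunc_conv_weighted_sums:
  "Qmod_trunc G d = set_plus_mp (SOS_trunc (int d)) (weighted_sums G (\<lambda>g. SOS_trunc (int d - int (mdeg g))))"
  unfolding Qmod_trunc_def set_plus_mp_def weighted_sums_def by blast

lemma IQ_trunc_conv_set_plus_mp: "IQ_trunc H G d = set_plus_mp (Ideal_trunc H d) (Qmod_trunc G d)"
  by (simp add: IQ_trunc_def set_plus_mp_def)

interpretation Ideal_trunc: semimodule_over nonneg_consts "Ideal_trunc H d"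
  unfolding Ideal_trunc_conv_weighted_sums
  by (intro semimodule_over_weighted_sums semimodule_over_poly_space)

interpretation Qmod_trunc: semimodule_over nonneg_consts "Qmod_trunc G d"
  unfolding Qmod_trunc_conv_weighted_sums
  by (intro semimodule_over_set_plus_mp semimodule_over_weighted_sums semimodule_over_SOS_trunc)

interpretation IQ_trunc: semimodule_over nonneg_consts "IQ_trunc H G d"
  unfolding IQ_trunc_conv_set_plus_mp
  by (intro semimodule_over_set_plus_mp Ideal_trunc.semimodule_over_axioms Qmod_trunc.semimodule_over_axioms)

lemma Ideal_trunc_subset_IQ_trunc: "Ideal_trunc H d \<subseteq> IQ_trunc H G d"
  and Qmod_trunc_subset_IQ_trunc: "Qmod_trunc G d \<subseteq> IQ_trunc H G d"
  unfolding IQ_trunc_conv_set_plus_mp by (intro subset_set_plus_mp Qmod_trunc.zero_mem Ideal_trunc.zero_mem)+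

lemma zero_mem_SOS_trunc: "0 \<in> SOS_trunc d"
  by (simp add: SOS_trunc_def SOS.zero_mem zero_mem_poly_space)

lemma Ideal_trunc_mem:
  "finite H \<Longrightarrow> h \<in> H \<Longrightarrow> a \<in> poly_space (int d - int (mdeg h)) \<Longrightarrow> h * a \<in> Ideal_trunc H d"
  unfolding Ideal_trunc_conv_weighted_sums by (rule weighted_sums_mem) (simp_all add: zero_mem_poly_space)

lemma Qmod_trunc_mem:
  "finite G \<Longrightarrow> g \<in> G \<Longrightarrow> s \<in> SOS_trunc (int d - int (mdeg g)) \<Longrightarrow> g * s \<in> Qmod_trunc G d"
  unfolding Qmod_trunc_conv_weighted_sums
  by (rule subsetD[OF subset_set_plus_mp(2)[OF zero_mem_SOS_trunc]])
    (rule weighted_sums_mem[OF _ _ _ zero_mem_SOS_trunc])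

lemma SOS_trunc_subset_Qmod_trunc: "SOS_trunc (int d) \<subseteq> Qmod_trunc G d"
  unfolding Qmod_trunc_conv_weighted_sums
  by (intro subset_set_plus_mp zero_mem_weighted_sums zero_mem_SOS_trunc)

lemma IQ_trunc_subset_IQ: "IQ_trunc H G d \<subseteq> IQ H G"
  unfolding IQ_trunc_conv_set_plus_mp IQ_conv_set_plus_mp Ideal_conv_weighted_sums Qmod_conv_weighted_sums
    Ideal_trunc_conv_weighted_sums Qmod_trunc_conv_weighted_sums
  by (intro set_plus_mp_mono weighted_sums_mono) (auto simp: SOS_trunc_def)

locale quadratic_module = semimodule_over SOS M for M :: "'v::finite mpoly set" +
  assumes one_mem: "1 \<in> M"
begin

lemma SOS_mem: "s \<in> SOS \<Longrightarrow> s \<in> M"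
  using scale_mem[OF _ one_mem] by simp

lemma eq_UNIV_if_minus_one_mem:
  assumes "-1 \<in> M"
  shows "M = UNIV"
proof -
  have "x \<in> M" for x
  proof -
    let ?h = "mconst (1 / 2) :: 'v mpoly"
    have "?h * (x + 1) * (?h * (x + 1)) * 1 + ?h * (x - 1) * (?h * (x - 1)) * -1 \<in> M"
      by (intro add_mem scale_mem SOS_square one_mem assms)
    also have "?h * (x + 1) * (?h * (x + 1)) * 1 + ?h * (x - 1) * (?h * (x - 1)) * -1 = (?h + ?h) * (?h + ?h) * x"
      by (simp add: algebra_simps)
    also have "\<dots> = x" by (simp flip: mconst.hom_add)
    finally show ?thesis .
  qed
  then show ?thesis by blast
qed

end

section \<open>Certificates on the critical variety\<close>

definition sos_ideal :: "'v::finite mpoly set \<Rightarrow> 'v mpoly set" where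
  "sos_ideal H = set_plus_mp SOS (Ideal H)"

interpretation sos_ideal: ring_preordering "sos_ideal H"
proof -
  interpret semimodule_over SOS "sos_ideal H"
    unfolding sos_ideal_def
    by (rule semimodule_over_set_plus_mp[OF SOS.semimodule_over_axioms
          semimodule_over_mono[OF Ideal.semimodule_over_axioms subset_UNIV]])
  have SOS: "SOS \<subseteq> sos_ideal H" and Ideal: "Ideal H \<subseteq> sos_ideal H"
    unfolding sos_ideal_def by (intro subset_set_plus_mp Ideal.zero_mem SOS.zero_mem)+
  show "ring_preordering (sos_ideal H)"
  proof
    show "1 \<in> sos_ideal H" "\<And>a. a * a \<in> sos_ideal H" using SOS SOS.one_mem SOS_square by blast+
    fix x y assume "x \<in> sos_ideal H" "y \<in> sos_ideal H"
    then obtain s j where x: "s \<in> SOS" "j \<in> Ideal H" "x = s + j" by (auto simp: sos_ideal_def elim: set_plus_mpE)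
    have "y * j \<in> sos_ideal H" using Ideal Ideal.scale_mem[OF UNIV_I x(2)] by blast
    moreover have "s * y \<in> sos_ideal H" by (rule scale_mem) fact+
    ultimately have "s * y + y * j \<in> sos_ideal H" by (rule add_mem[rotated])
    then show "x * y \<in> sos_ideal H" by (simp add: x(3) algebra_simps)
  qed
qed

lemma Ideal_subset_sos_ideal: "Ideal H \<subseteq> sos_ideal H"
  unfolding sos_ideal_def by (rule subset_set_plus_mp(2)[OF SOS.zero_mem])

lemma (in quadratic_module) cone_adjoin_sos_ideal_subset:
  assumes "Ideal H \<subseteq> M" "\<rho> \<in> M"
  shows "cone_adjoin (sos_ideal H) \<rho> \<subseteq> M"
proof
  fix x assume "x \<in> cone_adjoin (sos_ideal H) \<rho>"
  then obtain s j s' j' where x: "s \<in> SOS" "j \<in> Ideal H" "s' \<in> SOS" "j' \<in> Ideal H" "x = (s + j) + \<rho> * (s' + j')"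
    by (auto simp: sos_ideal_def elim!: cone_adjoinE set_plus_mpE)
  have "j \<in> M" "\<rho> * j' \<in> M" using x assms(1) Ideal.scale_mem by blast+
  moreover have "s \<in> M" "s' * \<rho> \<in> M" using SOS_mem scale_mem x assms(2) by blast+
  ultimately have "(s + j) + (s' * \<rho> + \<rho> * j') \<in> M" by (intro add_mem)
  then show "x \<in> M" by (simp add: x(5) algebra_simps)
qed

lemma nonneg_uminus_iff: "(\<forall>q\<in>H \<union> uminus ` H. meval q u \<ge> 0) \<longleftrightarrow> (\<forall>h\<in>H. meval h u = 0)"
  by (auto simp: meval_simps ball_Un intro!: antisym)

lemma generators_subset_supp:
  assumes "finite H" "sos_ideal H \<subseteq> T"
  shows "H \<subseteq> supp T"
proof
  fix h assume "h \<in> H"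
  then have "h * 1 \<in> T" "h * -1 \<in> T" using Ideal_mem[OF assms(1)] Ideal_subset_sos_ideal assms(2) by blast+
  then show "h \<in> supp T" by (simp add: supp_def)
qed

lemma real_zero_of_prime_cone:
  assumes "prime_cone P" "finite H" "H \<subseteq> supp P" "\<rho> \<in> P"
  shows "\<exists>u. (\<forall>h\<in>H. meval h u = 0) \<and> meval \<rho> u \<ge> 0"
proof -
  have "insert \<rho> (H \<union> uminus ` H) \<subseteq> P" using assms(3,4) by (auto simp: supp_def)
  then obtain u where "\<forall>q\<in>insert \<rho> (H \<union> uminus ` H). meval q u \<ge> 0"
    using Artin_Lang[OF assms(1), of "insert \<rho> (H \<union> uminus ` H)"] assms(2) by blast
  then show ?thesis using nonneg_uminus_iff by (metis insert_iff)
qed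

lemma directional_deriv_Lagrangian:
  "directional_deriv w f = (\<Sum>v\<in>UNIV. (mpderiv v f - (\<Sum>i\<in>A. p i * mpderiv v (c i))) * w v) +
     (\<Sum>i\<in>A. p i * directional_deriv w (c i))"
proof -
  have "(\<Sum>i\<in>A. p i * directional_deriv w (c i)) = (\<Sum>v\<in>UNIV. (\<Sum>i\<in>A. p i * mpderiv v (c i)) * w v)"
    unfolding directional_deriv_def sum_distrib_left sum_distrib_right by (subst sum.swap) (simp add: mult.assoc)
  then show ?thesis by (simp add: directional_deriv_def left_diff_distrib sum_subtractf)
qed

definition critical_equations ::
    "'v::finite mpoly \<Rightarrow> ('i \<Rightarrow> 'v mpoly) \<Rightarrow> ('i \<Rightarrow> 'v mpoly) \<Rightarrow> 'i set \<Rightarrow> 'i set \<Rightarrow> 'v mpoly set" where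
  "critical_equations f c p E I = c ` E \<union> phi_set f c p E I"

lemma finite_critical_equations: "finite E \<Longrightarrow> finite I \<Longrightarrow> finite (critical_equations f c p E I)"
  by (simp add: critical_equations_def phi_set_def)

(* A tangent vector w would give w(f) = \<Sum> p i * w(c i) modulo the support, and each product vanishes there. *)
lemma critical_value_of_prime_cone:
  assumes "prime_cone P" and equations: "critical_equations f c p E I \<subseteq> supp P"
  shows "\<exists>v. f - mconst v \<in> supp P"
proof (rule ccontr)
  assume "\<not> ?thesis"
  then obtain w where w: "directional_deriv w ` supp P \<subseteq> supp P" "directional_deriv w f \<notin> supp P"
    using tangent_vector_exists[OF assms(1), of f] by blast
  interpret prime_cone P by fact
  have "p i * directional_deriv w (c i) \<in> supp P" if i: "i \<in> E \<union> I" for i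
  proof -
    have "p i * c i \<in> supp P"
      using i equations by (auto simp: critical_equations_def phi_set_def intro: supp_mult_left)
    then have "p i \<in> supp P \<or> c i \<in> supp P" by (rule prime)
    then show ?thesis using w(1) supp_mult_left supp_mult_right by blast
  qed
  moreover have "mpderiv v f - (\<Sum>i\<in>E \<union> I. p i * mpderiv v (c i)) \<in> supp P" for v
    using equations unfolding critical_equations_def phi_set_def by blast
  ultimately have "directional_deriv w f \<in> supp P"
    unfolding directional_deriv_Lagrangian[of w f p c "E \<union> I"]
    by (intro supp_add supp_sum) (simp_all add: supp_mult_right)
  then show False using w(2) by simp
qed

definition value_product :: "real list \<Rightarrow> 'v::finite mpoly \<Rightarrow> 'v mpoly" where
  "value_product vs f = (\<Prod>v\<leftarrow>vs. f - mconst v)"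

lemma meval_value_product: "meval (value_product vs f) u = (\<Prod>v\<leftarrow>vs. meval f u - v)"
  unfolding value_product_def by (induction vs) (simp_all add: meval_simps)

lemma meval_value_product_eq_0_iff: "meval (value_product vs f) u = 0 \<longleftrightarrow> meval f u \<in> set vs"
  by (auto simp: meval_value_product prod_list_zero_iff)

lemma critical_certificate:
  fixes f :: "'v::finite mpoly" and \<gamma> :: ereal
  assumes "finite E" "finite I"
    and neg: "\<And>u. \<forall>h\<in>critical_equations f c p E I. meval h u = 0 \<Longrightarrow> ereal (meval f u) < \<gamma> \<Longrightarrow> meval \<rho> u < 0"
  shows "\<exists>vs. (\<forall>v\<in>set vs. \<gamma> \<le> ereal v) \<and>
    - (value_product vs f * value_product vs f) \<in> cone_adjoin (sos_ideal (critical_equations f c p E I)) \<rho>"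
proof (rule ccontr)
  define H where "H = critical_equations f c p E I"
  define D where "D = {value_product vs f | vs. \<forall>v\<in>set vs. \<gamma> \<le> ereal v}"
  assume "\<not> ?thesis"
  then have avoids: "- (d * d) \<notin> cone_adjoin (sos_ideal H) \<rho>" if "d \<in> D" for d using that by (auto simp: D_def H_def)
  have D_I: "value_product vs f \<in> D" if "\<forall>v\<in>set vs. \<gamma> \<le> ereal v" for vs using that by (auto simp: D_def)
  have "1 \<in> D" using D_I[of "[]"] by (simp add: value_product_def)
  moreover have "d * e \<in> D" if D: "d \<in> D" "e \<in> D" for d e
  proof -
    obtain vs ws where vs: "d = value_product vs f" "\<forall>v\<in>set vs. \<gamma> \<le> ereal v"
      and ws: "e = value_product ws f" "\<forall>v\<in>set ws. \<gamma> \<le> ereal v"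
      using D by (auto simp: D_def)
    then have "\<forall>v\<in>set (vs @ ws). \<gamma> \<le> ereal v" by auto
    from D_I[OF this] show ?thesis by (simp add: vs(1) ws(1) value_product_def)
  qed
  ultimately obtain P where P: "prime_cone P" "cone_adjoin (sos_ideal H) \<rho> \<subseteq> P" "D \<inter> supp P = {}"
    using prime_cone_exists[OF sos_ideal.ring_preordering_cone_adjoin _ _ avoids] by metis
  have "finite H" using assms(1,2) by (simp add: H_def finite_critical_equations)
  moreover have "sos_ideal H \<subseteq> P" using P(2) sos_ideal.subset_cone_adjoin by blast
  ultimately have H_supp: "H \<subseteq> supp P" by (rule generators_subset_supp)
  then obtain v where v: "f - mconst v \<in> supp P"
    using critical_value_of_prime_cone[OF P(1)] unfolding H_def by blast
  have "\<rho> \<in> P" using P(2) sos_ideal.mem_cone_adjoin by blast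
  then obtain u where u: "\<forall>h\<in>insert (f - mconst v) H. meval h u = 0" "meval \<rho> u \<ge> 0"
    using real_zero_of_prime_cone[OF P(1), of "insert (f - mconst v) H"] \<open>finite H\<close> H_supp v by blast
  have "\<gamma> \<le> ereal v" using neg[of u] u by (force simp: H_def meval_simps)
  then have "f - mconst v \<in> D" using D_I[of "[v]"] by (simp add: value_product_def)
  then show False using v P(3) by blast
qed

section \<open>Positive polynomials on compact sets\<close>

definition bounded_in :: "'v::finite mpoly set \<Rightarrow> 'v mpoly \<Rightarrow> bool" where
  "bounded_in T q \<longleftrightarrow> (\<exists>n\<ge>0. mconst n - q \<in> T \<and> mconst n + q \<in> T)"

lemma bounded_inE:
  assumes "bounded_in T q"
  obtains n where "n \<ge> 0" "mconst n - q \<in> T" "mconst n + q \<in> T"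
  using assms by (auto simp: bounded_in_def)

definition sqnorm :: "'v::finite mpoly" where
  "sqnorm = (\<Sum>v\<in>UNIV. mvar v * mvar v)"

lemma meval_sqnorm: "meval sqnorm u = (norm u)\<^sup>2"
  by (simp add: sqnorm_def meval_simps norm_vec_def L2_set_def sum_nonneg power2_eq_square)

locale polynomial_preordering = ring_preordering T for T :: "'v::finite mpoly set"
begin

lemma mconst_mem: "c \<ge> 0 \<Longrightarrow> mconst c \<in> T"
  using square_mem[of "mconst (sqrt c)"] by (simp flip: mconst.hom_mult)

lemma half_mem:
  assumes "x + x \<in> T"
  shows "x \<in> T"
proof -
  have "mconst (1/2) * (x + x) = mconst (1/2 + 1/2) * x" by (simp only: mconst.hom_add distrib_left distrib_right)
  then show ?thesis using mult_mem[OF mconst_mem assms, of "1/2"] by simp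
qed

lemma bounded_in_mconst: "bounded_in T (mconst c)"
  unfolding bounded_in_def
  using mconst_mem[of "\<bar>c\<bar> - c"] mconst_mem[of "\<bar>c\<bar> + c"]
  by (intro exI[of _ "\<bar>c\<bar>"]) (simp add: mconst.hom_add mconst.hom_minus)

lemma bounded_in_add:
  assumes "bounded_in T p" "bounded_in T q"
  shows "bounded_in T (p + q)"
proof -
  obtain n where n: "n \<ge> 0" "mconst n - p \<in> T" "mconst n + p \<in> T" using assms(1) by (rule bounded_inE)
  obtain m where m: "m \<ge> 0" "mconst m - q \<in> T" "mconst m + q \<in> T" using assms(2) by (rule bounded_inE)
  show ?thesis
    unfolding bounded_in_def using add_mem[OF n(2) m(2)] add_mem[OF n(3) m(3)] n(1) m(1)
    by (intro exI[of _ "n + m"]) (simp add: mconst.hom_add algebra_simps)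
qed

lemma bounded_in_mult:
  assumes "bounded_in T p" "bounded_in T q"
  shows "bounded_in T (p * q)"
proof -
  obtain n where n: "n \<ge> 0" "mconst n - p \<in> T" "mconst n + p \<in> T" using assms(1) by (rule bounded_inE)
  obtain m where m: "m \<ge> 0" "mconst m - q \<in> T" "mconst m + q \<in> T" using assms(2) by (rule bounded_inE)
  have "(mconst n - p) * (mconst m + q) + (mconst n + p) * (mconst m - q) \<in> T"
    "(mconst n - p) * (mconst m - q) + (mconst n + p) * (mconst m + q) \<in> T"
    by (intro add_mem mult_mem n m)+
  then have "mconst n * mconst m - p * q \<in> T" "mconst n * mconst m + p * q \<in> T"
    using half_mem[of "mconst n * mconst m - p * q"] half_mem[of "mconst n * mconst m + p * q"]
    by (simp_all add: algebra_simps)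
  then show ?thesis
    unfolding bounded_in_def using n(1) m(1) by (intro exI[of _ "n * m"]) (simp add: mconst.hom_mult)
qed

lemma sqnorm_diff_mem: "sqnorm - mvar v * mvar v \<in> T"
proof -
  have "sqnorm - mvar v * mvar v = (\<Sum>u\<in>UNIV - {v}. mvar u * mvar u)"
    unfolding sqnorm_def by (subst sum.remove[of UNIV v]) auto
  then show ?thesis by (simp add: sum_mem square_mem)
qed

lemma bounded_in_mvar:
  assumes ball: "mconst N - sqnorm \<in> T" and "N \<ge> 0"
  shows "bounded_in T (mvar v)"
proof -
  have mem: "mconst (N + 1) - x \<in> T" if x: "mconst N - x * x \<in> T" for x
  proof -
    have "(mconst N - x * x) + (x - 1) * (x - 1) + mconst (N + 1) \<in> T"
      using assms(2) by (intro add_mem x square_mem mconst_mem) simp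
    then have "(mconst (N + 1) - x) + (mconst (N + 1) - x) \<in> T" by (simp add: mconst.hom_add algebra_simps)
    then show ?thesis by (rule half_mem)
  qed
  have "mconst N - mvar v * mvar v \<in> T" using add_mem[OF ball sqnorm_diff_mem[of v]] by simp
  then show ?thesis
    unfolding bounded_in_def using mem[of "mvar v"] mem[of "- mvar v"] assms(2) by (intro exI[of _ "N + 1"]) simp
qed

lemma bounded_in_if_ball:
  assumes "mconst N - sqnorm \<in> T" "N \<ge> 0"
  shows "bounded_in T q"
  by (induction q rule: mpoly_induct)
    (intro bounded_in_mconst bounded_in_mvar[OF assms] bounded_in_add bounded_in_mult; assumption)+

lemma polynomial_preordering_cone_adjoin: "polynomial_preordering (cone_adjoin T a)"
  by (intro polynomial_preordering.intro ring_preordering_cone_adjoin)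

(* Woermann's trick: multiples by 1 + s of elements of the preordering generated by N - |x|^2 lie in T,
   and that preordering is archimedean, so s itself is bounded in T. *)
lemma ball_mem_if_multiple_mem:
  assumes "s \<in> T" "N \<ge> 0" and multiple: "(1 + s) * (mconst N - sqnorm) \<in> T"
  shows "\<exists>N'\<ge>0. mconst N' - sqnorm \<in> T"
proof -
  let ?a = "mconst N - sqnorm :: 'v mpoly"
  interpret adjoin: polynomial_preordering "cone_adjoin T ?a" by (rule polynomial_preordering_cone_adjoin)
  obtain m where m: "m \<ge> 0" "mconst m - s \<in> cone_adjoin T ?a"
    using adjoin.bounded_in_if_ball[OF mem_cone_adjoin assms(2), of s] by (elim bounded_inE)
  then obtain x y where xy: "x \<in> T" "y \<in> T" "mconst m - s = x + ?a * y" by (auto elim: cone_adjoinE)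
  have "(1 + s) * x + (1 + s) * ?a * y \<in> T" by (intro add_mem mult_mem one_mem multiple assms xy)
  then have bound: "(1 + s) * (mconst m - s) \<in> T" unfolding xy(3) by (simp add: algebra_simps)
  let ?h = "mconst (m / 2) :: 'v mpoly"
  have mconst_m: "mconst m = ?h + ?h" by (simp flip: mconst.hom_add)
  have "(1 + s) * (mconst m - s) + (s - ?h) * (s - ?h) \<in> T" by (intro add_mem bound square_mem)
  then have s_bound: "mconst m + ?h * ?h - s \<in> T" unfolding mconst_m by (simp add: algebra_simps)
  have "sqnorm \<in> T" unfolding sqnorm_def by (intro sum_mem square_mem)
  then have "mconst N * (mconst m + ?h * ?h - s) + (1 + s) * ?a + s * sqnorm \<in> T"
    by (intro add_mem multiple mult_mem[OF mconst_mem[OF assms(2)] s_bound] mult_mem[OF assms(1)])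
  also have "mconst N * (mconst m + ?h * ?h - s) + (1 + s) * ?a + s * sqnorm =
      mconst N * (mconst m + ?h * ?h) + mconst N - sqnorm"
    by (simp add: algebra_simps)
  also have "\<dots> = mconst (N * (m + m / 2 * (m / 2)) + N) - sqnorm" by (simp only: mconst.hom_add mconst.hom_mult)
  finally show ?thesis using assms(2) m(1) by (intro exI[of _ "N * (m + m / 2 * (m / 2)) + N"]) simp
qed

lemma archimedean_descent:
  assumes "s \<in> T" "t \<in> T" "a * t = 1 + s" and n: "n > 0" "mconst n - t \<in> T"
    and r: "r \<ge> 0" "a + mconst r \<in> T"
  shows "a + mconst (r - 1 / n) \<in> T"
proof -
  have "(mconst n - t) * (a + mconst r) + s + mconst r * t \<in> T"
    by (intro add_mem mult_mem mconst_mem assms(1,2) n(2) r)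
  also have "(mconst n - t) * (a + mconst r) + s + mconst r * t = mconst n * (a + mconst r) - 1"
    using assms(3) by (simp add: algebra_simps)
  finally have "mconst (1 / n) * (mconst n * (a + mconst r) - 1) \<in> T"
    using n by (intro mult_mem mconst_mem) simp_all
  also have "mconst (1 / n) * (mconst n * (a + mconst r) - 1) = mconst (1 / n * n) * (a + mconst r) - mconst (1 / n)"
    by (simp only: mconst.hom_mult right_diff_distrib mult.assoc mult_1_right)
  also have "\<dots> = a + mconst (r - 1 / n)" using n by (simp add: mconst.hom_minus)
  finally show ?thesis .
qed

lemma mem_if_inverse_certificate:
  assumes bounded: "\<And>q. bounded_in T q" and cert: "s \<in> T" "t \<in> T" "a * t = 1 + s"
  shows "a \<in> T"
proof -
  obtain n0 where n0: "n0 \<ge> 0" "mconst n0 - t \<in> T" using bounded[of t] by (elim bounded_inE)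
  define n where "n = n0 + 1"
  have n: "n > 0" "mconst n - t \<in> T"
    using n0 add_mem[OF n0(2) one_mem] by (simp_all add: n_def mconst.hom_add algebra_simps)
  obtain r0 where r0: "r0 \<ge> 0" "mconst r0 + a \<in> T" using bounded[of a] by (elim bounded_inE)
  define r where "r k = max 0 (r0 - real k / n)" for k
  have "a + mconst (r k) \<in> T" for k
  proof (induction k)
    case 0
    show ?case using r0 by (simp add: r_def add.commute)
  next
    case (Suc k)
    have "a + mconst (r k - 1 / n) \<in> T"
      by (rule archimedean_descent[OF cert n _ Suc.IH]) (simp add: r_def)
    moreover have "mconst (r (Suc k) - (r k - 1 / n)) \<in> T"
      using n(1) by (intro mconst_mem) (auto simp: r_def field_simps max_def)
    ultimately have "a + mconst (r k - 1 / n) + mconst (r (Suc k) - (r k - 1 / n)) \<in> T" by (rule add_mem)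
    then show ?case by (simp add: mconst.hom_minus)
  qed
  moreover obtain k where "r0 * n \<le> real k" using real_arch_simple by blast
  then have "r k = 0" using n(1) by (simp add: r_def field_simps)
  ultimately show ?thesis by (metis add.right_neutral mconst.hom_zero)
qed

lemma real_point_exists:
  assumes "-1 \<notin> T" "finite F" "F \<subseteq> T"
  shows "\<exists>u. \<forall>q\<in>F. meval q u \<ge> 0"
proof -
  obtain P where P: "prime_cone P" "T \<subseteq> P"
    using prime_cone_exists[OF ring_preordering_axioms, of "{1}"] assms(1) by auto
  then show ?thesis using Artin_Lang assms(2,3) by blast
qed

lemma inverse_certificate_exists:
  assumes F: "finite F" "F \<subseteq> T" and pos: "\<And>u. \<forall>q\<in>F. meval q u \<ge> 0 \<Longrightarrow> meval a u > 0"
  obtains s t where "s \<in> T" "t \<in> T" "a * t = 1 + s"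
proof -
  interpret adjoin: polynomial_preordering "cone_adjoin T (- a)" by (rule polynomial_preordering_cone_adjoin)
  have "-1 \<in> cone_adjoin T (- a)"
  proof (rule ccontr)
    assume "-1 \<notin> cone_adjoin T (- a)"
    moreover have "insert (- a) F \<subseteq> cone_adjoin T (- a)" using mem_cone_adjoin subset_cone_adjoin F(2) by blast
    ultimately obtain u where "\<forall>q\<in>insert (- a) F. meval q u \<ge> 0" using adjoin.real_point_exists F(1) by blast
    then show False using pos[of u] by (simp add: meval_simps)
  qed
  then obtain s t where "s \<in> T" "t \<in> T" "-1 = s + - a * t" by (rule cone_adjoinE)
  then show thesis by (intro that[of s t]) (simp_all add: algebra_simps eq_neg_iff_add_eq_0)
qed

theorem positive_on_compact_mem:
  assumes F: "finite F" "F \<subseteq> T" and "bounded {u. \<forall>q\<in>F. meval q u \<ge> 0}"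
    and pos: "\<And>u. \<forall>q\<in>F. meval q u \<ge> 0 \<Longrightarrow> meval a u > 0"
  shows "a \<in> T"
proof -
  obtain B where B: "B > 0" "\<forall>u\<in>{u. \<forall>q\<in>F. meval q u \<ge> 0}. norm u \<le> B" using assms(3) unfolding bounded_pos by blast
  define N where "N = B\<^sup>2 + 1"
  have "N \<ge> 0" by (simp add: N_def)
  have "meval (mconst N - sqnorm) u > 0" if "\<forall>q\<in>F. meval q u \<ge> 0" for u
  proof -
    have "(norm u)\<^sup>2 \<le> B\<^sup>2" using B that by (intro power_mono) auto
    then show ?thesis by (simp add: meval_simps meval_sqnorm N_def)
  qed
  then obtain s t where st: "s \<in> T" "t \<in> T" "(mconst N - sqnorm) * t = 1 + s"
    by (rule inverse_certificate_exists[OF F])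
  have "(1 + s) * (mconst N - sqnorm) = (mconst N - sqnorm) * (mconst N - sqnorm) * t"
    unfolding st(3)[symmetric] by (simp add: mult_ac)
  also have "\<dots> \<in> T" by (intro mult_mem square_mem st)
  finally obtain N' where "N' \<ge> 0" "mconst N' - sqnorm \<in> T"
    using ball_mem_if_multiple_mem[OF st(1) \<open>N \<ge> 0\<close>] by blast
  then have "bounded_in T q" for q using bounded_in_if_ball by blast
  moreover obtain s t where "s \<in> T" "t \<in> T" "a * t = 1 + s" using inverse_certificate_exists[OF F pos] .
  ultimately show ?thesis by (rule mem_if_inverse_certificate)
qed

end

section \<open>Negative combinations on compact sets\<close>

lemma damped_bound_nonneg:
  fixes z :: real
  assumes z: "0 \<le> z" "z \<le> 1" and "l > 0"
  shows "z * (1 - z) ^ l \<le> 1 / real l"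
proof -
  have "(1 - z) ^ l * (1 + real l * z) \<le> (1 - z) ^ l * (1 + z) ^ l"
    using Bernoulli_inequality[of z l] z by (intro mult_left_mono) auto
  also have "\<dots> = (1 - z\<^sup>2) ^ l" by (simp add: algebra_simps power2_eq_square flip: power_mult_distrib)
  also have "\<dots> \<le> 1" using z by (intro power_le_one) (auto simp: power2_eq_square mult_le_one)
  finally have "(1 - z) ^ l + real l * (z * (1 - z) ^ l) \<le> 1" by (simp add: algebra_simps)
  moreover have "(1 - z) ^ l \<ge> 0" using z by simp
  ultimately show ?thesis using assms(3) by (simp add: field_simps)
qed

(* The factor damps y when y is positive and does not shrink it when y is negative. *)
lemma damped_bound:
  fixes y N :: real
  assumes N: "N > 0" "\<bar>y\<bar> \<le> N" and l: "l > 0"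
  shows "y * (1 - y / N) ^ (2 * l) \<le> - max 0 (- y) + N / real (2 * l)"
proof (cases "y \<ge> 0")
  case True
  have "y / N * (1 - y / N) ^ (2 * l) \<le> 1 / real (2 * l)"
    using N True l by (intro damped_bound_nonneg) (auto simp: field_simps)
  then show ?thesis using True N(1) by (simp add: field_simps)
next
  case False
  have "1 \<le> (1 - y / N) ^ (2 * l)" using False N by (intro one_le_power) (simp add: field_simps)
  then have "y * (1 - y / N) ^ (2 * l) \<le> y * 1" using False by (intro mult_left_mono_neg) auto
  also have "\<dots> \<le> - max 0 (- y) + N / real (2 * l)" using False N(1) by simp
  finally show ?thesis .
qed

lemma negative_parts_bounded_below:
  assumes "finite G" "compact K" and neg: "\<And>u. u \<in> K \<Longrightarrow> \<exists>g\<in>G. meval g u < 0"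
  obtains \<delta> where "\<delta> > 0" "\<And>u. u \<in> K \<Longrightarrow> \<delta> \<le> (\<Sum>g\<in>G. max 0 (- meval g u))"
proof (cases "K = {}")
  case True
  then show thesis using that[of 1] by simp
next
  case False
  define \<phi> where "\<phi> u = (\<Sum>g\<in>G. max 0 (- meval g u))" for u
  have "continuous_on K \<phi>" unfolding \<phi>_def by (intro continuous_intros continuous_on_max continuous_on_meval)
  then obtain u0 where u0: "u0 \<in> K" "\<forall>u\<in>K. \<phi> u0 \<le> \<phi> u" using continuous_attains_inf[OF assms(2) False] by blast
  obtain g where g: "g \<in> G" "meval g u0 < 0" using neg[OF u0(1)] by blast
  have "max 0 (- meval g u0) \<le> \<phi> u0" unfolding \<phi>_def using g(1) assms(1) by (intro member_le_sum) auto
  then show thesis using that[of "\<phi> u0"] u0(2) g(2) by (simp add: \<phi>_def)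
qed

lemma finitely_many_meval_bounded:
  assumes "finite G" "compact K"
  obtains N where "N > 0" "\<And>g u. g \<in> G \<Longrightarrow> u \<in> K \<Longrightarrow> \<bar>meval g u\<bar> \<le> N"
proof -
  have "bounded (\<Union>g\<in>G. meval g ` K)"
    using assms by (intro compact_imp_bounded compact_UN compact_continuous_image continuous_on_meval)
  then obtain N where "N > 0" "\<forall>y\<in>(\<Union>g\<in>G. meval g ` K). norm y \<le> N"
    unfolding bounded_pos by (elim exE conjE)
  then show thesis using that[of N] by auto
qed

lemma (in quadratic_module) negative_on_compact:
  assumes G: "finite G" "G \<subseteq> M" and "compact K" and neg: "\<And>u. u \<in> K \<Longrightarrow> \<exists>g\<in>G. meval g u < 0"
  obtains \<rho> \<delta> where "\<rho> \<in> M" "\<delta> > 0" "\<And>u. u \<in> K \<Longrightarrow> meval \<rho> u \<le> - \<delta>"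
proof -
  obtain \<delta> where \<delta>: "\<delta> > 0" "\<And>u. u \<in> K \<Longrightarrow> \<delta> \<le> (\<Sum>g\<in>G. max 0 (- meval g u))"
    using negative_parts_bounded_below[OF G(1) assms(3) neg] by blast
  obtain N where N: "N > 0" "\<And>g u. g \<in> G \<Longrightarrow> u \<in> K \<Longrightarrow> \<bar>meval g u\<bar> \<le> N"
    using finitely_many_meval_bounded[OF G(1) assms(3)] by blast
  obtain l :: nat where l: "real (card G) * N / \<delta> < real l" using reals_Archimedean2 by blast
  have "0 \<le> real (card G) * N / \<delta>" using N(1) \<delta>(1) by simp
  then have "l > 0" using l by (metis of_nat_0_less_iff order_le_less_trans)
  define q where "q g = (1 - mconst (1 / N) * g) ^ l" for g :: "'v mpoly"
  define \<rho> where "\<rho> = (\<Sum>g\<in>G. q g * q g * g)"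
  have "\<rho> \<in> M" unfolding \<rho>_def using G(2) by (intro sum_mem scale_mem SOS_square) auto
  moreover have "meval \<rho> u \<le> - (\<delta> / 2)" if u: "u \<in> K" for u
  proof -
    have "meval \<rho> u = (\<Sum>g\<in>G. meval g u * (1 - meval g u / N) ^ (2 * l))"
      by (simp add: \<rho>_def q_def meval_simps power_mult power2_eq_square power_mult_distrib mult_ac)
    also have "\<dots> \<le> (\<Sum>g\<in>G. - max 0 (- meval g u) + N / real (2 * l))"
      using N u \<open>l > 0\<close> by (intro sum_mono damped_bound) auto
    also have "\<dots> = - (\<Sum>g\<in>G. max 0 (- meval g u)) + real (card G) * N / real (2 * l)"
      by (simp add: sum.distrib sum_negf sum_subtractf)
    also have "real (card G) * N / real (2 * l) \<le> \<delta> / 2" using l \<open>l > 0\<close> \<delta>(1) by (simp add: field_simps)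
    finally show ?thesis using \<delta>(2)[OF u] by simp
  qed
  ultimately show thesis using that[of \<rho> "\<delta> / 2"] \<delta>(1) by simp
qed

section \<open>Nonnegativity of multipliers at minimizers\<close>

lemma dual_vectors:
  fixes g :: "'i \<Rightarrow> 'b::euclidean_space"
  assumes "finite A" and indep: "\<And>\<mu> i. (\<Sum>i\<in>A. \<mu> i *\<^sub>R g i) = 0 \<Longrightarrow> i \<in> A \<Longrightarrow> \<mu> i = 0"
  shows "\<exists>w. \<forall>i\<in>A. \<forall>k\<in>A. g i \<bullet> w k = (if i = k then 1 else 0)"
proof -
  have inj: "inj_on g A"
  proof (rule inj_onI, rule ccontr)
    fix i k assume ik: "i \<in> A" "k \<in> A" "g i = g k" "i \<noteq> k"
    let ?\<mu> = "\<lambda>l. (if l = i then 1 else 0) - (if l = k then 1 else 0 :: real)"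
    have "(\<Sum>l\<in>A. ?\<mu> l *\<^sub>R g l) = (\<Sum>l\<in>A. if l = i then g i else 0) - (\<Sum>l\<in>A. if l = k then g k else 0)"
      unfolding sum_subtractf[symmetric] by (intro sum.cong) (auto simp: scaleR_diff_left)
    also have "\<dots> = 0" using ik assms(1) by simp
    finally show False using indep[of ?\<mu> i] ik by auto
  qed
  have "independent (g ` A)"
  proof (rule independent_if_scalars_zero)
    fix \<nu> x assume "(\<Sum>x\<in>g ` A. \<nu> x *\<^sub>R x) = 0" "x \<in> g ` A"
    then show "\<nu> x = 0" using indep[of "\<lambda>i. \<nu> (g i)"] by (auto simp: sum.reindex[OF inj])
  qed (use assms(1) in simp)
  have "\<exists>w. \<forall>i\<in>A. g i \<bullet> w = (if i = k then 1 else 0)" if k: "k \<in> A" for k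
  proof -
    obtain \<phi> :: "'b \<Rightarrow> real" where \<phi>: "linear \<phi>" "\<forall>x\<in>g ` A. \<phi> x = (if x = g k then 1 else 0)"
      using linear_independent_extend[OF \<open>independent (g ` A)\<close>, of "\<lambda>x. if x = g k then 1 else 0"] by blast
    have "g i \<bullet> adjoint \<phi> 1 = (if i = k then 1 else 0)" if "i \<in> A" for i
      using \<phi>(2) that k inj_onD[OF inj, of i k] by (auto simp: adjoint_works[OF \<phi>(1)])
    then show ?thesis by blast
  qed
  then show ?thesis by metis
qed

locale active_constraints =
  fixes c :: "'i \<Rightarrow> 'b::euclidean_space \<Rightarrow> real" and G :: "'i \<Rightarrow> 'b \<Rightarrow> 'b"
    and A :: "'i set" and u :: 'b and w :: "'i \<Rightarrow> 'b"
  assumes finite_A: "finite A"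
    and gradient: "\<And>i x. (c i has_derivative (\<lambda>h. G i x \<bullet> h)) (at x)"
    and continuous_gradient: "\<And>i. continuous_on UNIV (G i)"
    and active: "\<And>i. i \<in> A \<Longrightarrow> c i u = 0"
    and dual: "\<And>i k. i \<in> A \<Longrightarrow> k \<in> A \<Longrightarrow> G i u \<bullet> w k = (if i = k then 1 else 0)"
begin

definition straighten :: "'b \<Rightarrow> 'b" where
  "straighten x = x - u - (\<Sum>i\<in>A. (G i u \<bullet> (x - u) - c i x) *\<^sub>R w i)"

definition straighten_deriv :: "'b \<Rightarrow> 'b \<Rightarrow>\<^sub>L 'b" where
  "straighten_deriv x = id_blinfun - (\<Sum>i\<in>A. blinfun_scaleR_left (w i) o\<^sub>L blinfun_inner_left (G i u - G i x))"

lemma inner_straighten: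
  assumes "k \<in> A"
  shows "G k u \<bullet> straighten x = c k x"
proof -
  have "G k u \<bullet> straighten x = G k u \<bullet> (x - u) - (\<Sum>i\<in>A. (G i u \<bullet> (x - u) - c i x) * (G k u \<bullet> w i))"
    unfolding straighten_def by (simp add: inner_diff_right inner_sum_right)
  also have "(\<Sum>i\<in>A. (G i u \<bullet> (x - u) - c i x) * (G k u \<bullet> w i)) = (\<Sum>i\<in>A. if i = k then G k u \<bullet> (x - u) - c k x else 0)"
    using assms by (intro sum.cong) (auto simp: dual)
  also have "\<dots> = G k u \<bullet> (x - u) - c k x" using assms finite_A by simp
  finally show ?thesis by simp
qed

lemma straighten_base: "straighten u = 0"
  by (simp add: straighten_def active)

lemma straighten_deriv_apply:
  "blinfun_apply (straighten_deriv x) h = h - (\<Sum>i\<in>A. (G i u \<bullet> h - G i x \<bullet> h) *\<^sub>R w i)"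
  by (simp add: straighten_deriv_def blinfun.diff_left blinfun.sum_left inner_diff_left inner_commute inner_diff_right)

lemma straighten_deriv_base: "straighten_deriv u = id_blinfun"
  by (rule blinfun_eqI) (simp add: straighten_deriv_apply)

lemma straighten_has_derivative: "(straighten has_derivative blinfun_apply (straighten_deriv x)) (at x)"
proof -
  have "(straighten has_derivative (\<lambda>h. h - 0 - (\<Sum>i\<in>A. (G i u \<bullet> (h - 0) - G i x \<bullet> h) *\<^sub>R w i))) (at x)"
    unfolding straighten_def by (intro derivative_intros gradient)
  then show ?thesis by (rule has_derivative_eq_rhs) (simp add: fun_eq_iff straighten_deriv_apply)
qed

lemma continuous_on_straighten_deriv: "continuous_on UNIV straighten_deriv"
  unfolding straighten_deriv_def
  by (intro continuous_intros continuous_gradient bounded_linear.continuous_on[OF bounded_linear_blinfun_inner_left])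

lemma straighten_local_inverse:
  obtains g V where "open V" "0 \<in> V" "g 0 = u" "(g has_derivative (\<lambda>h. h)) (at 0)"
    "\<And>y. y \<in> V \<Longrightarrow> straighten (g y) = y"
proof -
  have "id_blinfun o\<^sub>L straighten_deriv u = id_blinfun" by (simp add: straighten_deriv_base blinfun_eqI)
  then obtain U V g g' where "open V" and base: "u \<in> U" "straighten u \<in> V" and homeo: "homeomorphism U V straighten g"
    and g': "\<And>y. y \<in> V \<Longrightarrow> (g has_derivative (g' y)) (at y)"
      "\<And>y. y \<in> V \<Longrightarrow> g' y = inv_into UNIV (blinfun_apply (straighten_deriv (g y)))"
    using inverse_function_theorem[OF open_UNIV straighten_has_derivative continuous_on_straighten_deriv UNIV_I]
    by metis
  have "g 0 = u" using homeomorphism_apply1[OF homeo base(1)] by (simp add: straighten_base)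
  have "0 \<in> V" using base(2) by (simp add: straighten_base)
  then have "g' 0 = (\<lambda>h. h)" using g'(2) \<open>g 0 = u\<close> by (simp add: straighten_deriv_base id_def[symmetric])
  then have "(g has_derivative (\<lambda>h. h)) (at 0)" using g'(1)[OF \<open>0 \<in> V\<close>] by simp
  then show thesis using that \<open>open V\<close> \<open>0 \<in> V\<close> \<open>g 0 = u\<close> homeomorphism_apply2[OF homeo] by blast
qed

lemma curve_exists:
  assumes "j \<in> A"
  obtains x where "x 0 = u" "(x has_vector_derivative w j) (at 0)"
    "\<forall>\<^sub>F t in nhds 0. \<forall>k\<in>A. c k (x t) = (if k = j then t else 0)"
proof -
  obtain g V where V: "open V" "0 \<in> V" and g: "g 0 = u" "(g has_derivative (\<lambda>h. h)) (at 0)"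
    and inverse: "\<And>y. y \<in> V \<Longrightarrow> straighten (g y) = y"
    by (rule straighten_local_inverse) blast
  define x where "x t = g (t *\<^sub>R w j)" for t
  have "(x has_derivative (\<lambda>t. t *\<^sub>R w j)) (at 0)"
    unfolding x_def using has_derivative_compose[of "\<lambda>t. t *\<^sub>R w j" "\<lambda>t. t *\<^sub>R w j" 0 UNIV g "\<lambda>h. h"] g(2)
    by (simp add: has_derivative_scaleR_left)
  then have "(x has_vector_derivative w j) (at 0)" by (simp add: has_vector_derivative_def)
  moreover have "\<forall>\<^sub>F t in nhds 0. t *\<^sub>R w j \<in> V"
  proof (rule topological_tendstoD[OF _ V(1)])
    show "((\<lambda>t. t *\<^sub>R w j) \<longlongrightarrow> 0 *\<^sub>R w j) (nhds 0)" by (intro tendsto_intros filterlim_ident)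
  qed (use V(2) in simp)
  then have "\<forall>\<^sub>F t in nhds 0. \<forall>k\<in>A. c k (x t) = (if k = j then t else 0)"
  proof eventually_elim
    case (elim t)
    have "c k (x t) = (if k = j then t else 0)" if "k \<in> A" for k
      using inner_straighten[OF that, of "x t"] inverse[OF elim] dual[OF that assms]
      by (cases "k = j") (simp_all add: x_def)
    then show ?case by blast
  qed
  ultimately show thesis using that[of x] g(1) by (simp add: x_def)
qed

end

definition active_set :: "('i \<Rightarrow> 'v::finite mpoly) \<Rightarrow> 'i set \<Rightarrow> 'i set \<Rightarrow> real^'v \<Rightarrow> 'i set" where
  "active_set c E I u = {i \<in> E \<union> I. meval (c i) u = 0}"

lemma mem_crit_pairs_iff:
  "(u, lam) \<in> crit_pairs f c E I \<longleftrightarrow> (\<forall>i\<in>E. meval (c i) u = 0) \<and> (\<forall>j\<in>I. lam j * meval (c j) u = 0) \<and>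
    mgrad f u = (\<Sum>i\<in>E \<union> I. lam i *\<^sub>R mgrad (c i) u)"
  by (simp add: crit_pairs_def vec_eq_iff mgrad_def)

lemma multiplier_eq_0_if_inactive:
  "(u, lam) \<in> crit_pairs f c E I \<Longrightarrow> i \<in> E \<union> I \<Longrightarrow> i \<notin> active_set c E I u \<Longrightarrow> lam i = 0"
  by (auto simp: crit_pairs_def active_set_def)

lemma active_gradients_independent:
  assumes fin: "finite E" "finite I" and crit: "(u, lam) \<in> crit_pairs f c E I"
    and unique: "\<forall>lam'. (u, lam') \<in> crit_pairs f c E I \<longrightarrow> (\<forall>i\<in>E \<union> I. lam' i = lam i)"
    and zero: "(\<Sum>i\<in>active_set c E I u. \<mu> i *\<^sub>R mgrad (c i) u) = 0" and i: "i \<in> active_set c E I u"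
  shows "\<mu> i = 0"
proof -
  let ?A = "active_set c E I u"
  define \<mu>' where "\<mu>' i = (if i \<in> ?A then \<mu> i else 0)" for i
  have "(\<Sum>i\<in>E \<union> I. \<mu>' i *\<^sub>R mgrad (c i) u) = (\<Sum>i\<in>?A. \<mu> i *\<^sub>R mgrad (c i) u)"
    using fin by (intro sum.mono_neutral_cong_right) (auto simp: \<mu>'_def active_set_def)
  then have "(\<Sum>i\<in>E \<union> I. (lam i + \<mu>' i) *\<^sub>R mgrad (c i) u) = (\<Sum>i\<in>E \<union> I. lam i *\<^sub>R mgrad (c i) u)"
    by (simp add: zero scaleR_add_left sum.distrib)
  moreover have "\<mu>' i * meval (c i) u = 0" for i by (simp add: \<mu>'_def active_set_def)
  ultimately have "(u, \<lambda>i. lam i + \<mu>' i) \<in> crit_pairs f c E I"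
    using crit unfolding mem_crit_pairs_iff by (auto simp: distrib_right)
  then have "\<forall>i\<in>E \<union> I. lam i + \<mu>' i = lam i" by (rule unique[THEN spec, THEN mp])
  then have "\<mu>' i = 0" using i by (auto simp: active_set_def)
  then show ?thesis using i by (simp add: \<mu>'_def)
qed

lemma feasible_along_curve:
  assumes "finite I" "E \<inter> I = {}" "j \<in> I" and feasible: "feasible c E I u"
    and x: "isCont x 0" "x 0 = u"
    and active: "\<forall>\<^sub>F t in nhds 0. \<forall>k\<in>active_set c E I u. meval (c k) (x t) = (if k = j then t else 0)"
  shows "\<forall>\<^sub>F t in at_right 0. feasible c E I (x t)"
proof -
  let ?A = "active_set c E I u"
  have "\<forall>\<^sub>F t in at_right 0. meval (c i) (x t) > 0" if i: "i \<in> I - ?A" for i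
  proof (rule order_tendstoD(1))
    have "isCont (meval (c i)) (x 0)"
      using continuous_on_meval[of UNIV "c i"] by (simp add: continuous_on_eq_continuous_at)
    then have "((\<lambda>t. meval (c i) (x t)) \<longlongrightarrow> meval (c i) (x 0)) (at 0)"
      using isCont_o2[OF x(1)] by (simp add: isCont_def)
    then show "((\<lambda>t. meval (c i) (x t)) \<longlongrightarrow> meval (c i) (x 0)) (at_right 0)"
      by (rule filterlim_mono) (simp_all add: at_le)
    show "0 < meval (c i) (x 0)" using feasible i x(2) by (auto simp: feasible_def active_set_def less_le)
  qed
  then have "\<forall>\<^sub>F t in at_right 0. \<forall>i\<in>I - ?A. meval (c i) (x t) > 0"
    using assms(1) by (intro eventually_ball_finite) auto
  moreover have "\<forall>\<^sub>F t in at_right 0. \<forall>k\<in>?A. meval (c k) (x t) = (if k = j then t else 0)"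
    using active by (simp add: eventually_at_filter eventually_mono)
  moreover have "\<forall>\<^sub>F t in at_right 0. (0::real) < t" by (rule eventually_at_right_less)
  ultimately show ?thesis
  proof eventually_elim
    case (elim t)
    have "meval (c i) (x t) = 0" if "i \<in> E" for i
    proof -
      have "i \<in> ?A" "i \<noteq> j" using that feasible assms(2,3) by (auto simp: feasible_def active_set_def)
      then show ?thesis using elim(2) by simp
    qed
    moreover have "meval (c i) (x t) \<ge> 0" if "i \<in> I" for i
      using elim that by (cases "i \<in> ?A") (auto simp: less_imp_le)
    ultimately show ?case unfolding feasible_def by blast
  qed
qed

(* A negative multiplier of an active inequality would let f decrease along a feasible curve
   on which that constraint grows and all other active constraints stay zero. *)
theorem multiplier_nonneg:
  fixes f :: "'v::finite mpoly" and c :: "'i \<Rightarrow> 'v mpoly"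
  assumes EI: "finite E" "finite I" "E \<inter> I = {}" and crit: "(u, lam) \<in> crit_pairs f c E I"
    and unique: "\<forall>lam'. (u, lam') \<in> crit_pairs f c E I \<longrightarrow> (\<forall>i\<in>E \<union> I. lam' i = lam i)"
    and feasible: "feasible c E I u" and opt: "\<And>x. feasible c E I x \<Longrightarrow> meval f u \<le> meval f x" and j: "j \<in> I"
  shows "lam j \<ge> 0"
proof (rule ccontr)
  assume neg: "\<not> lam j \<ge> 0"
  let ?A = "active_set c E I u"
  have "finite ?A" using EI by (simp add: active_set_def)
  then have "\<exists>w. \<forall>i\<in>?A. \<forall>k\<in>?A. mgrad (c i) u \<bullet> w k = (if i = k then 1 else 0)"
    by (rule dual_vectors) (rule active_gradients_independent[OF EI(1,2) crit unique])
  then obtain w where w: "\<forall>i\<in>?A. \<forall>k\<in>?A. mgrad (c i) u \<bullet> w k = (if i = k then 1 else 0)" ..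
  interpret active_constraints "\<lambda>i. meval (c i)" "\<lambda>i. mgrad (c i)" ?A u w
    using \<open>finite ?A\<close> w
    by unfold_locales (auto simp: active_set_def intro: meval_has_derivative continuous_on_mgrad)
  have "j \<in> ?A" using multiplier_eq_0_if_inactive[OF crit, of j] j neg by auto
  then obtain x where x: "x 0 = u" "(x has_vector_derivative w j) (at 0)"
    and active: "\<forall>\<^sub>F t in nhds 0. \<forall>k\<in>?A. meval (c k) (x t) = (if k = j then t else 0)"
    by (rule curve_exists)
  have "mgrad f u \<bullet> w j = (\<Sum>i\<in>E \<union> I. lam i * (mgrad (c i) u \<bullet> w j))"
    using crit by (simp add: mem_crit_pairs_iff inner_sum_left)
  also have "\<dots> = (\<Sum>i\<in>E \<union> I. if i = j then lam j else 0)"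
    using multiplier_eq_0_if_inactive[OF crit] w \<open>j \<in> ?A\<close> by (intro sum.cong) (auto split: if_splits)
  also have "\<dots> = lam j" using EI j by simp
  finally have slope: "mgrad f u \<bullet> w j = lam j" .
  have "((\<lambda>t. meval f (x t)) has_derivative (\<lambda>t. mgrad f (x 0) \<bullet> (t *\<^sub>R w j))) (at 0)"
    using x(2) unfolding has_vector_derivative_def by (rule has_derivative_compose[OF _ meval_has_derivative])
  then have "((\<lambda>t. meval f (x t)) has_real_derivative lam j) (at 0)"
    by (simp add: has_field_derivative_def slope x(1) mult_commute_abs)
  from DERIV_neg_dec_right[OF this] obtain e where e: "e > 0" "\<And>t. 0 < t \<Longrightarrow> t < e \<Longrightarrow> meval f (x t) < meval f u"
    using neg x(1) by auto
  have "\<forall>\<^sub>F t in at_right 0. feasible c E I (x t)"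
    by (rule feasible_along_curve[OF EI(2,3) j feasible has_vector_derivative_continuous[OF x(2)] x(1) active])
  moreover have "\<forall>\<^sub>F t in at_right 0. 0 < t \<and> t < e" using e(1) eventually_at_right_real[of 0 e] by simp
  ultimately have "\<forall>\<^sub>F t in at_right 0. feasible c E I (x t) \<and> 0 < t \<and> t < e" by (rule eventually_conj)
  then obtain t where "feasible c E I (x t)" "0 < t" "t < e"
    using eventually_happens'[OF trivial_limit_at_right_real] by blast
  then show False using opt[of "x t"] e(2)[of t] by simp
qed

section \<open>A quadratic perturbation\<close>

lemma power_le_abs_prod_list:
  fixes g :: "'a \<Rightarrow> real"
  assumes "0 \<le> a" "\<forall>v\<in>set vs. a \<le> \<bar>g v\<bar>"
  shows "a ^ length vs \<le> \<bar>\<Prod>v\<leftarrow>vs. g v\<bar>"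
  using assms by (induction vs) (simp_all add: abs_mult mult_mono)

lemma linear_plus_square_nonneg:
  fixes \<gamma> :: real
  assumes "vs \<noteq> []" "\<forall>v\<in>set vs. \<gamma> < v"
  shows "\<exists>C\<ge>0. \<forall>t. t - \<gamma> + C * (\<Prod>v\<leftarrow>vs. t - v)\<^sup>2 \<ge> 0"
proof -
  define d where "d = Min ((\<lambda>v. v - \<gamma>) ` set vs)"
  have d: "d > 0" "\<And>v. v \<in> set vs \<Longrightarrow> d \<le> v - \<gamma>" using assms by (auto simp: d_def)
  obtain n where n: "length vs = Suc n" using assms(1) by (cases vs) auto
  define C where "C = 1 / (4 * d * (d ^ n)\<^sup>2)"
  have "C \<ge> 0" using d(1) by (simp add: C_def)
  moreover have "t - \<gamma> + C * (\<Prod>v\<leftarrow>vs. t - v)\<^sup>2 \<ge> 0" for t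
  proof (cases "t \<ge> \<gamma>")
    case True
    then show ?thesis using \<open>C \<ge> 0\<close> by simp
  next
    case False
    define s where "s = \<gamma> - t"
    have "s > 0" using False by (simp add: s_def)
    have "(d + s) * d ^ n \<le> (d + s) ^ length vs" using d(1) \<open>s > 0\<close> by (simp add: n power_mono)
    also have "\<dots> \<le> \<bar>\<Prod>v\<leftarrow>vs. t - v\<bar>"
      using d \<open>s > 0\<close> by (intro power_le_abs_prod_list) (fastforce simp: s_def)+
    finally have "((d + s) * d ^ n)\<^sup>2 \<le> (\<Prod>v\<leftarrow>vs. t - v)\<^sup>2"
      using d(1) \<open>s > 0\<close> power_mono[of "(d + s) * d ^ n" "\<bar>\<Prod>v\<leftarrow>vs. t - v\<bar>" 2] by simp
    then have "C * ((d + s) * d ^ n)\<^sup>2 \<le> C * (\<Prod>v\<leftarrow>vs. t - v)\<^sup>2" using \<open>C \<ge> 0\<close> by (rule mult_left_mono)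
    moreover have "C * ((d + s) * d ^ n)\<^sup>2 = (d + s)\<^sup>2 / (4 * d)"
      using d(1) by (simp add: C_def power_mult_distrib)
    moreover have "4 * d * s \<le> (d + s)\<^sup>2"
      using zero_le_power2[of "d - s"] by (simp add: power2_eq_square algebra_simps)
    then have "s \<le> (d + s)\<^sup>2 / (4 * d)" using d(1) by (simp add: field_simps)
    ultimately show ?thesis by (simp add: s_def)
  qed
  ultimately show ?thesis by blast
qed

section \<open>Separation on compact critical sets\<close>

lemma Ideal_insert_subset:
  assumes "finite H" "x \<in> Ideal (insert b H)"
  obtains n e where "n \<in> Ideal H" "x = n + b * e"
proof -
  let ?S = "set_plus_mp (Ideal H) (range ((*) b))"
  interpret range_mult: additive_submonoid "range ((*) b)"
  proof
    show "0 \<in> range ((*) b)" using rangeI[of "(*) b" 0] by simp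
    show "x + y \<in> range ((*) b)" if "x \<in> range ((*) b)" "y \<in> range ((*) b)" for x y
      using that by (auto simp flip: distrib_left)
  qed
  interpret semimodule_over "{}" ?S
    by (intro semimodule_over_set_plus_mp semimodule_over.intro semimodule_over_axioms.intro
        Ideal.additive_submonoid_axioms range_mult.additive_submonoid_axioms) simp_all
  have "Ideal (insert b H) \<subseteq> ?S"
  proof (rule Ideal_subset[OF additive_submonoid_axioms])
    fix h a assume "h \<in> insert b H"
    then show "h * a \<in> ?S"
      using set_plus_mpI[OF Ideal_mem[OF assms(1), of h a] range_mult.zero_mem]
        set_plus_mpI[OF Ideal.zero_mem, of "b * a" "range ((*) b)" H] by auto
  qed
  then show thesis using assms(2) that by (auto elim!: set_plus_mpE)
qed

lemma compact_nonneg_set: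
  assumes "compact {x. meval p x \<ge> 0}"
  shows "compact {x. \<forall>q\<in>insert p F. meval q x \<ge> 0}"
proof -
  have "{x. \<forall>q\<in>insert p F. meval q x \<ge> 0} = {x. meval p x \<ge> 0} \<inter> (\<Inter>q\<in>F. {x. 0 \<le> meval q x})" by auto
  also have "compact \<dots>"
    by (intro compact_Int_closed assms closed_INT ballI closed_Collect_le continuous_on_const continuous_on_meval)
  finally show ?thesis .
qed

lemma (in quadratic_module) negative_where_vanishing:
  assumes p0: "p0 \<in> M" "compact {x. meval p0 x \<ge> 0}" and H: "finite H" "Ideal H \<subseteq> M" and G: "finite G" "G \<subseteq> M"
    and neg: "\<And>u. \<forall>h\<in>insert b H. meval h u = 0 \<Longrightarrow> \<exists>g\<in>G. meval g u < 0"
  shows "\<exists>\<rho>\<in>M. \<forall>u. meval b u = 0 \<longrightarrow> meval \<rho> u < 0"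
proof -
  define H' where "H' = insert b H"
  define F where "F = insert p0 (H' \<union> uminus ` H')"
  let ?Z = "{u. \<forall>q\<in>F. meval q u \<ge> 0}"
  have compact: "compact ?Z" unfolding F_def by (rule compact_nonneg_set[OF p0(2)])
  have "\<exists>g\<in>G. meval g u < 0" if "u \<in> ?Z" for u
    using that neg nonneg_uminus_iff[of H' u] by (simp add: F_def H'_def)
  then obtain \<rho>0 \<delta> where \<rho>0: "\<rho>0 \<in> M" "\<delta> > 0" "\<And>u. u \<in> ?Z \<Longrightarrow> meval \<rho>0 u \<le> - \<delta>"
    using negative_on_compact[OF G compact] by blast
  define a where "a = - \<rho>0 - mconst (\<delta> / 2)"
  let ?T = "cone_adjoin (sos_ideal H') p0"
  interpret T: polynomial_preordering ?T
    by (intro polynomial_preordering.intro sos_ideal.ring_preordering_cone_adjoin)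
  have "finite H'" using H(1) by (simp add: H'_def)
  then have "H' \<subseteq> supp ?T" using sos_ideal.subset_cone_adjoin by (rule generators_subset_supp)
  then have F: "finite F" "F \<subseteq> ?T"
    using \<open>finite H'\<close> sos_ideal.mem_cone_adjoin by (auto simp: F_def supp_def)
  have "a \<in> ?T"
  proof (rule T.positive_on_compact_mem[OF F compact_imp_bounded[OF compact]])
    show "meval a u > 0" if "\<forall>q\<in>F. meval q u \<ge> 0" for u
      using \<rho>0(2) \<rho>0(3)[of u] that by (simp add: a_def meval_simps)
  qed
  then obtain s j t j' where a: "s \<in> SOS" "t \<in> SOS" "j \<in> Ideal H'" "j' \<in> Ideal H'" "a = (s + j) + p0 * (t + j')"
    by (auto simp: sos_ideal_def elim!: cone_adjoinE set_plus_mpE)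
  have "j + p0 * j' \<in> Ideal H'" by (intro Ideal.add_mem Ideal.scale_mem a UNIV_I)
  then obtain n e where n: "n \<in> Ideal H" "j + p0 * j' = n + b * e"
    unfolding H'_def by (rule Ideal_insert_subset[OF H(1)])
  define \<rho> where "\<rho> = \<rho>0 + s + t * p0 + n"
  have "s \<in> M" "t * p0 \<in> M" "n \<in> M" using SOS_mem scale_mem a(1,2) p0(1) n(1) H(2) by auto
  then have "\<rho> \<in> M" unfolding \<rho>_def by (intro add_mem \<rho>0(1))
  moreover have "\<rho> = mconst (- (\<delta> / 2)) - b * e"
  proof -
    have "\<rho> + b * e = \<rho>0 + s + t * p0 + (j + p0 * j')" unfolding \<rho>_def n(2) by (simp add: add_ac)
    also have "\<dots> = \<rho>0 + a" unfolding a(5) by (simp add: algebra_simps)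
    finally show ?thesis by (simp add: a_def mconst.hom_uminus eq_diff_eq)
  qed
  ultimately show ?thesis using \<rho>0(2) by (intro bexI[of _ \<rho>]) (simp_all add: meval_simps)
qed

lemma finitely_many_critical_values:
  assumes "finite E" "finite I"
  shows "\<exists>vs. \<forall>u. (\<forall>h\<in>critical_equations f c p E I. meval h u = 0) \<longrightarrow> meval f u \<in> set vs"
proof -
  let ?H = "critical_equations f c p E I"
  obtain vs where vs: "- (value_product vs f * value_product vs f) \<in> cone_adjoin (sos_ideal ?H) 1"
    using critical_certificate[OF assms, where \<gamma> = "-\<infinity>" and \<rho> = 1 and c = c and p = p and f = f]
    by auto
  have "meval f u \<in> set vs" if u: "\<forall>h\<in>?H. meval h u = 0" for u
  proof -
    interpret nonneg: prime_cone "{q. meval q u \<ge> 0}" by (rule prime_cone_eval)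
    have "Ideal ?H \<subseteq> {q. meval q u \<ge> 0}"
      using u by (intro Ideal_subset nonneg.additive_submonoid_axioms) (simp add: meval_simps)
    moreover have "SOS \<subseteq> {q. meval q u \<ge> 0}" using meval_SOS by blast
    ultimately have "sos_ideal ?H \<subseteq> {q. meval q u \<ge> 0}"
      unfolding sos_ideal_def by (intro set_plus_mp_subset nonneg.additive_submonoid_axioms)
    then have "cone_adjoin (sos_ideal ?H) 1 \<subseteq> {q. meval q u \<ge> 0}"
      by (rule nonneg.cone_adjoin_subset) (rule nonneg.one_mem)
    then have "meval (- (value_product vs f * value_product vs f)) u \<ge> 0" using vs by blast
    then have "meval (value_product vs f) u = 0" by (auto simp: meval_simps mult_le_0_iff)
    then show ?thesis by (simp add: meval_value_product_eq_0_iff)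
  qed
  then show ?thesis by blast
qed

section \<open>Moment vectors of points\<close>

lemma mpair_0 [simp]: "mpair 0 y = 0"
  by (simp add: mpair_def)

lemma mpair_add: "mpair (p + q) y = mpair p y + mpair q y"
  unfolding mpair_def by (rule setsum_keys_plus_distrib) (simp_all add: distrib_right)

lemma mpair_scale: "mpair (mconst c * p) y = c * mpair p y"
proof (induction p rule: mpoly_additive_induct)
  case (single a d)
  show ?case by (simp add: mconst_def mult_single mpair_def)
qed (simp add: distrib_left mpair_add)

definition point_moments :: "nat \<Rightarrow> real^'v::finite \<Rightarrow> ('v \<Rightarrow>\<^sub>0 nat) \<Rightarrow> real" where
  "point_moments k x a = (if mdeg_mono a \<le> 2 * k then \<Prod>v\<in>UNIV. (x $ v) ^ lookup a v else 0)"

lemma mpair_point_moments: "mdeg q \<le> 2 * k \<Longrightarrow> mpair q (point_moments k x) = meval q x"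
  unfolding mpair_def meval_def by (intro sum.cong refl) (auto simp: point_moments_def mdeg_le_iff)

lemma mpair_point_moments_localizing:
  assumes "a1 \<in> poly_space (int k - int ((mdeg q + 1) div 2))" "a2 \<in> poly_space (int k - int ((mdeg q + 1) div 2))"
  shows "mpair (q * a1 * a2) (point_moments k x) = meval q x * meval a1 x * meval a2 x"
proof (cases "a1 = 0 \<or> a2 = 0")
  case False
  then have "int (mdeg a1) \<le> int k - int ((mdeg q + 1) div 2)" "int (mdeg a2) \<le> int k - int ((mdeg q + 1) div 2)"
    using assms by (auto simp: poly_space_def)
  moreover have "mdeg (q * a1 * a2) \<le> mdeg q + mdeg a1 + mdeg a2"
    using mdeg_mult[of "q * a1" a2] mdeg_mult[of q a1] by linarith
  ultimately have "mdeg (q * a1 * a2) \<le> 2 * k" by linarith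
  then show ?thesis by (simp add: mpair_point_moments meval_simps)
qed (auto simp: meval_simps)

lemma loc_psd_point_moments: "meval q x \<ge> 0 \<Longrightarrow> loc_psd k q (point_moments k x)"
  unfolding loc_psd_def by (simp add: mpair_point_moments_localizing) (simp add: mult.assoc)

lemma loc_zero_point_moments: "meval q x = 0 \<Longrightarrow> loc_zero k q (point_moments k x)"
  unfolding loc_zero_def by (auto simp: mpair_point_moments_localizing)

section \<open>Tightness of the relaxations\<close>

locale critical_problem =
  fixes f :: "'v::finite mpoly" and c p :: "'i \<Rightarrow> 'v mpoly" and E I :: "'i set"
  assumes finite_index: "finite E" "finite I"
begin

abbreviation "\<Phi> \<equiv> phi_set f c p E I"
abbreviation "\<Psi> \<equiv> psi_set p I"
abbreviation "equations \<equiv> critical_equations f c p E I"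
abbreviation "min_value \<equiv> f_c f c p E I"

definition inequalities :: "'v mpoly set" where
  "inequalities = c ` I \<union> \<Psi>"

definition iq_module :: "'v mpoly set" where
  "iq_module = set_plus_mp (IQ (c ` E) (c ` I)) (IQ \<Phi> \<Psi>)"

definition iq_module_trunc :: "nat \<Rightarrow> 'v mpoly set" where
  "iq_module_trunc k = set_plus_mp (IQ_trunc (c ` E) (c ` I) (2 * k)) (IQ_trunc \<Phi> \<Psi> (2 * k))"

definition moments :: "nat \<Rightarrow> (('v \<Rightarrow>\<^sub>0 nat) \<Rightarrow> real) set" where
  "moments k = {y. (\<forall>a. mdeg_mono a > 2 * k \<longrightarrow> y a = 0) \<and> mpair 1 y = 1 \<and> loc_psd k 1 y \<and>
     (\<forall>h\<in>equations. loc_zero k h y) \<and> (\<forall>g\<in>inequalities. loc_psd k g y)}"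

definition admissible :: "real^'v \<Rightarrow> bool" where
  "admissible x \<longleftrightarrow> (\<forall>h\<in>equations. meval h x = 0) \<and> (\<forall>g\<in>inequalities. meval g x \<ge> 0)"

lemma f_c_conv_admissible: "min_value = Inf {ereal (meval f x) | x. admissible x}"
  unfolding f_c_def admissible_def feasible_def critical_equations_def inequalities_def
  by (rule arg_cong[of _ _ Inf]) (auto simp: ball_Un)

lemma f_mom_conv_moments: "f_mom k f c p E I = Inf {ereal (mpair f y) | y. y \<in> moments k}"
  unfolding f_mom_def moments_def critical_equations_def inequalities_def
  by (rule arg_cong[of _ _ Inf]) (auto simp: ball_Un)

lemma f_sos_conv_iq_module_trunc: "f_sos k f c p E I = Sup {ereal \<gamma> | \<gamma>. f - mconst \<gamma> \<in> iq_module_trunc k}"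
  by (simp add: f_sos_def iq_module_trunc_def)

lemma finite_sets: "finite (c ` E)" "finite (c ` I)" "finite \<Phi>" "finite \<Psi>"
  using finite_index by (simp_all add: phi_set_def psi_set_def)

lemma finite_equations: "finite equations" and finite_inequalities: "finite inequalities"
  using finite_sets by (simp_all add: finite_critical_equations finite_index inequalities_def)

lemma iq_module_subset:
  assumes S: "additive_submonoid S" and equation: "\<And>h a. h \<in> equations \<Longrightarrow> h * a \<in> S"
    and square: "\<And>q. q * q \<in> S" and inequality: "\<And>g q. g \<in> inequalities \<Longrightarrow> g * (q * q) \<in> S"
  shows "iq_module \<subseteq> S"
  unfolding iq_module_def
  by (intro set_plus_mp_subset[OF S] IQ_subset[OF S] Ideal_subset[OF S equation] Qmod_subset[OF S square inequality])
    (simp_all add: critical_equations_def inequalities_def)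

lemma IQ_subset_iq_module: "IQ (c ` E) (c ` I) \<subseteq> iq_module" "IQ \<Phi> \<Psi> \<subseteq> iq_module"
  unfolding iq_module_def by (intro subset_set_plus_mp IQ.zero_mem)+

sublocale iq_module: quadratic_module iq_module
proof (intro quadratic_module.intro quadratic_module_axioms.intro)
  show "semimodule_over SOS iq_module"
    unfolding iq_module_def by (intro semimodule_over_set_plus_mp IQ.semimodule_over_axioms)
  show "1 \<in> iq_module"
    using SOS.one_mem SOS_subset_Qmod Qmod_subset_IQ IQ_subset_iq_module(1) by blast
qed

lemma Ideal_equations_subset: "Ideal equations \<subseteq> iq_module"
proof (rule Ideal_subset[OF iq_module.additive_submonoid_axioms])
  fix h a assume "h \<in> equations"
  then consider "h \<in> c ` E" | "h \<in> \<Phi>" by (auto simp: critical_equations_def)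
  then show "h * a \<in> iq_module"
    by cases (blast intro: Ideal_mem finite_sets subsetD[OF Ideal_subset_IQ] subsetD[OF IQ_subset_iq_module(1)]
        subsetD[OF IQ_subset_iq_module(2)])+
qed

lemma inequality_mem: "g \<in> inequalities \<Longrightarrow> s \<in> SOS \<Longrightarrow> g * s \<in> iq_module"
proof -
  assume "g \<in> inequalities" "s \<in> SOS"
  then consider "g * s \<in> Qmod (c ` I)" | "g * s \<in> Qmod \<Psi>"
    using Qmod_mem finite_sets unfolding inequalities_def by blast
  then show ?thesis using Qmod_subset_IQ IQ_subset_iq_module by cases blast+
qed

lemma inequalities_subset: "inequalities \<subseteq> iq_module"
  using inequality_mem[OF _ SOS.one_mem] by auto

lemma Qmod_inequalities_subset: "Qmod inequalities \<subseteq> iq_module"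
  by (intro Qmod_subset iq_module.additive_submonoid_axioms inequality_mem SOS_square iq_module.SOS_mem)

lemma iq_module_trunc_subset: "iq_module_trunc k \<subseteq> iq_module"
  unfolding iq_module_trunc_def iq_module_def by (intro set_plus_mp_mono IQ_trunc_subset_IQ)

lemma meval_iq_module_nonneg:
  assumes "m \<in> iq_module" "admissible x"
  shows "meval m x \<ge> 0"
proof -
  interpret nonneg: prime_cone "{q. meval q x \<ge> 0}" by (rule prime_cone_eval)
  have "iq_module \<subseteq> {q. meval q x \<ge> 0}"
    using assms(2) by (intro iq_module_subset nonneg.additive_submonoid_axioms) (auto simp: meval_simps admissible_def)
  then show ?thesis using assms(1) by blast
qed

lemma f_c_le: "admissible x \<Longrightarrow> min_value \<le> ereal (meval f x)"
  unfolding f_c_conv_admissible by (rule Inf_lower) blast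

lemma f_sos_le: "f_sos k f c p E I \<le> min_value"
  unfolding f_sos_conv_iq_module_trunc f_c_conv_admissible
proof (rule Sup_least, rule Inf_greatest, clarify)
  fix \<gamma> x assume "f - mconst \<gamma> \<in> iq_module_trunc k" "admissible x"
  then have "meval (f - mconst \<gamma>) x \<ge> 0" using meval_iq_module_nonneg iq_module_trunc_subset by blast
  then show "ereal \<gamma> \<le> ereal (meval f x)" by (simp add: meval_simps)
qed

lemma point_moments_mem: "admissible x \<Longrightarrow> point_moments k x \<in> moments k"
  unfolding moments_def
  by (auto simp: admissible_def mpair_point_moments meval_simps point_moments_def[of k x]
      intro!: loc_psd_point_moments loc_zero_point_moments)

lemma f_mom_le:
  assumes "mdeg f \<le> 2 * k"
  shows "f_mom k f c p E I \<le> min_value"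
  unfolding f_mom_conv_moments f_c_conv_admissible
proof (rule Inf_mono, clarify)
  fix x assume "admissible x"
  then show "\<exists>a\<in>{ereal (mpair f y) | y. y \<in> moments k}. a \<le> ereal (meval f x)"
    using point_moments_mem[of x k] mpair_point_moments[OF assms, of x] by force
qed

definition certified :: "nat \<Rightarrow> 'v mpoly set" where
  "certified k = {m \<in> iq_module_trunc k. \<forall>y\<in>moments k. mpair m y \<ge> 0}"

definition certifiable :: "'v mpoly set" where
  "certifiable = {m. \<forall>\<^sub>F k in sequentially. m \<in> certified k}"

sublocale certified: semimodule_over nonneg_consts "certified k"
proof -
  interpret semimodule_over nonneg_consts "iq_module_trunc k"
    unfolding iq_module_trunc_def by (intro semimodule_over_set_plus_mp IQ_trunc.semimodule_over_axioms)
  show "semimodule_over nonneg_consts (certified k)"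
    by unfold_locales
      (auto simp: certified_def zero_mem add_mem scale_mem mpair_add mpair_scale nonneg_consts_def)
qed

lemma certified_scale: "r \<ge> 0 \<Longrightarrow> m \<in> certified k \<Longrightarrow> mconst r * m \<in> certified k"
  by (rule certified.scale_mem) (simp add: nonneg_consts_def)

lemma IQ_trunc_subset_iq_module_trunc:
  "IQ_trunc (c ` E) (c ` I) (2 * k) \<subseteq> iq_module_trunc k" "IQ_trunc \<Phi> \<Psi> (2 * k) \<subseteq> iq_module_trunc k"
  unfolding iq_module_trunc_def by (intro subset_set_plus_mp IQ_trunc.zero_mem)+

lemma certified_square:
  assumes "mdeg q \<le> k"
  shows "q * q \<in> certified k"
proof -
  have "q * q \<in> SOS_trunc (int (2 * k))"
    using mdeg_mult[of q q] assms by (auto simp: SOS_trunc_def SOS_square intro!: poly_spaceI)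
  then have "q * q \<in> iq_module_trunc k"
    using SOS_trunc_subset_Qmod_trunc Qmod_trunc_subset_IQ_trunc IQ_trunc_subset_iq_module_trunc(1) by blast
  moreover have "mpair (q * q) y \<ge> 0" if "y \<in> moments k" for y
  proof -
    have "loc_psd k 1 y" using that by (simp add: moments_def)
    moreover have "q \<in> poly_space (int k - int ((mdeg (1 :: 'v mpoly) + 1) div 2))"
      using assms by (intro poly_spaceI) simp
    ultimately have "mpair (1 * q * q) y \<ge> 0" unfolding loc_psd_def by blast
    then show ?thesis by simp
  qed
  ultimately show ?thesis by (simp add: certified_def)
qed

lemma certified_inequality:
  assumes g: "g \<in> inequalities" and k: "mdeg g + mdeg q \<le> k"
  shows "g * (q * q) \<in> certified k"
proof -
  have "q * q \<in> SOS_trunc (int (2 * k) - int (mdeg g))"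
    using mdeg_mult[of q q] k by (auto simp: SOS_trunc_def SOS_square intro!: poly_spaceI)
  then consider "g * (q * q) \<in> Qmod_trunc (c ` I) (2 * k)" | "g * (q * q) \<in> Qmod_trunc \<Psi> (2 * k)"
    using g Qmod_trunc_mem finite_sets unfolding inequalities_def by blast
  then have "g * (q * q) \<in> iq_module_trunc k"
    using Qmod_trunc_subset_IQ_trunc IQ_trunc_subset_iq_module_trunc by cases blast+
  moreover have "mpair (g * (q * q)) y \<ge> 0" if "y \<in> moments k" for y
  proof -
    have "loc_psd k g y" using g that by (simp add: moments_def)
    moreover have "q \<in> poly_space (int k - int ((mdeg g + 1) div 2))" using k by (intro poly_spaceI) linarith
    ultimately have "mpair (g * q * q) y \<ge> 0" unfolding loc_psd_def by blast
    then show ?thesis by (simp add: mult.assoc)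
  qed
  ultimately show ?thesis by (simp add: certified_def)
qed

lemma certified_equation:
  assumes h: "h \<in> equations" and k: "mdeg h + mdeg a \<le> k"
  shows "h * a \<in> certified k"
proof -
  have "a \<in> poly_space (int (2 * k) - int (mdeg h))" using k by (intro poly_spaceI) linarith
  then consider "h * a \<in> Ideal_trunc (c ` E) (2 * k)" | "h * a \<in> Ideal_trunc \<Phi> (2 * k)"
    using h Ideal_trunc_mem finite_sets unfolding critical_equations_def by blast
  then have "h * a \<in> iq_module_trunc k"
    using Ideal_trunc_subset_IQ_trunc IQ_trunc_subset_iq_module_trunc by cases blast+
  moreover have "mpair (h * a) y = 0" if "y \<in> moments k" for y
  proof -
    have "loc_zero k h y" using h that by (simp add: moments_def)
    moreover have "a \<in> poly_space (int k - int ((mdeg h + 1) div 2))"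
      "1 \<in> poly_space (int k - int ((mdeg h + 1) div 2))"
      using k by (intro poly_spaceI; simp; linarith)+
    ultimately have "mpair (h * a * 1) y = 0" unfolding loc_zero_def by blast
    then show ?thesis by simp
  qed
  ultimately show ?thesis by (simp add: certified_def)
qed

lemma iq_module_certifiable: "iq_module \<subseteq> certifiable"
proof (rule iq_module_subset)
  show "additive_submonoid certifiable"
  proof
    show "0 \<in> certifiable" by (simp add: certifiable_def certified.zero_mem)
    show "a \<in> certifiable \<Longrightarrow> b \<in> certifiable \<Longrightarrow> a + b \<in> certifiable" for a b
      by (auto simp: certifiable_def elim: eventually_elim2 intro: certified.add_mem)
  qed
  show "h * a \<in> certifiable" if "h \<in> equations" for h a
    unfolding certifiable_def using certified_equation[OF that] by (auto simp: eventually_sequentially)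
  show "q * q \<in> certifiable" for q
    unfolding certifiable_def using certified_square by (auto simp: eventually_sequentially)
  show "g * (q * q) \<in> certifiable" if "g \<in> inequalities" for g q
    unfolding certifiable_def using certified_inequality[OF that] by (auto simp: eventually_sequentially)
qed

lemma certified_lower_bounds:
  assumes "f - mconst \<gamma> \<in> certified k"
  shows "ereal \<gamma> \<le> f_sos k f c p E I" "ereal \<gamma> \<le> f_mom k f c p E I"
proof -
  show "ereal \<gamma> \<le> f_sos k f c p E I"
    unfolding f_sos_conv_iq_module_trunc by (rule Sup_upper) (use assms in \<open>auto simp: certified_def\<close>)
  show "ereal \<gamma> \<le> f_mom k f c p E I"
    unfolding f_mom_conv_moments
  proof (rule Inf_greatest, clarify)
    fix y assume y: "y \<in> moments k"
    have "0 \<le> mpair (f + mconst (- \<gamma>) * 1) y" using assms y by (simp add: certified_def mconst.hom_uminus)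
    also have "\<dots> = mpair f y - \<gamma>" using y by (simp only: mpair_add mpair_scale) (simp add: moments_def)
    finally show "ereal \<gamma> \<le> ereal (mpair f y)" by simp
  qed
qed

definition tight :: bool where
  "tight \<longleftrightarrow> (\<exists>K. \<forall>k\<ge>K. f_sos k f c p E I = min_value \<and> f_mom k f c p E I = min_value)"

lemma tight_if_certified:
  assumes "\<forall>\<^sub>F k in sequentially. \<forall>\<gamma>. ereal \<gamma> < min_value \<longrightarrow> f - mconst \<gamma> \<in> certified k"
  shows tight
proof -
  have min_value_le: "min_value \<le> z" if "\<And>\<gamma>. ereal \<gamma> < min_value \<Longrightarrow> ereal \<gamma> \<le> z" for z
  proof (rule dense_le)
    fix b assume "b < min_value"
    then show "b \<le> z" using that by (cases b) auto
  qed
  have "\<forall>\<^sub>F k in sequentially. mdeg f \<le> k" by (rule eventually_ge_at_top)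
  with assms have "\<forall>\<^sub>F k in sequentially. f_sos k f c p E I = min_value \<and> f_mom k f c p E I = min_value"
  proof eventually_elim
    case (elim k)
    then have "min_value \<le> f_sos k f c p E I" "min_value \<le> f_mom k f c p E I"
      using certified_lower_bounds min_value_le by blast+
    then show ?case using f_sos_le f_mom_le[of k] elim(2) by (auto intro: antisym)
  qed
  then show ?thesis by (simp add: tight_def eventually_sequentially)
qed

lemma certified_compose_nonneg_poly:
  assumes nonneg: "\<And>t. poly q t \<ge> 0" and degree: "degree q * mdeg f \<le> k"
  shows "poly (map_poly mconst q) f \<in> certified k"
proof -
  interpret map_mconst: map_poly_comm_ring_hom "mconst :: real \<Rightarrow> 'v mpoly" ..
  obtain qs where qs: "q = (\<Sum>r\<leftarrow>qs. r * r)" "\<forall>r\<in>set qs. 2 * degree r \<le> degree q"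
    using nonneg_poly_sum_squares[OF nonneg] by blast
  have "poly (map_poly mconst (\<Sum>r\<leftarrow>rs. r * r)) f \<in> certified k" if "set rs \<subseteq> set qs" for rs
    using that
  proof (induction rs)
    case Nil
    show ?case by (simp add: certified.zero_mem)
  next
    case (Cons r rs)
    have "degree r * mdeg f \<le> degree q * mdeg f" using Cons.prems qs(2) by (intro mult_right_mono) auto
    then have "mdeg (poly (map_poly mconst r) f) \<le> k"
      using mdeg_poly_map_poly_mconst[of r f] degree by linarith
    then show ?case
      using Cons by (simp add: map_mconst.hom_add map_mconst.hom_mult certified.add_mem certified_square)
  qed
  then show ?thesis using qs(1) by blast
qed

lemma compose_value_product: "poly (map_poly mconst (\<Prod>v\<leftarrow>vs. [:-v, 1:])) g = value_product vs g"
proof -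
  interpret map_mconst: map_poly_comm_ring_hom "mconst :: real \<Rightarrow> 'b::finite mpoly" ..
  show ?thesis
    by (induction vs)
      (simp_all add: value_product_def map_mconst.hom_mult mconst.map_poly_pCons_hom mconst.hom_uminus
        del: mult_pCons_left mult_pCons_right)
qed

lemma certified_if_value_certificate:
  assumes "vs \<noteq> []" "\<forall>v\<in>set vs. \<gamma> < v" and cert: "- (value_product vs f * value_product vs f) \<in> certified k"
    and k: "(2 * length vs + 1) * mdeg f \<le> k"
  shows "f - mconst \<gamma> \<in> certified k"
proof -
  interpret map_mconst: map_poly_comm_ring_hom "mconst :: real \<Rightarrow> 'v mpoly" ..
  obtain C where C: "C \<ge> 0" "\<forall>t. t - \<gamma> + C * (\<Prod>v\<leftarrow>vs. t - v)\<^sup>2 \<ge> 0"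
    using linear_plus_square_nonneg[OF assms(1,2)] by blast
  define \<pi> where "\<pi> = (\<Prod>v\<leftarrow>vs. [:-v, 1:])"
  define q where "q = [:-\<gamma>, 1:] + [:C:] * (\<pi> * \<pi>)"
  have "degree \<pi> \<le> length vs"
    unfolding \<pi>_def by (induction vs) (auto intro!: order_trans[OF degree_mult_le] simp del: mult_pCons_left)
  then have "degree q \<le> 2 * length vs + 1"
    unfolding q_def using degree_mult_le[of \<pi> \<pi>] degree_smult_le[of C "\<pi> * \<pi>"] by (intro degree_add_le) auto
  then have "degree q * mdeg f \<le> k" using k mult_right_mono order_trans by blast
  moreover have "poly \<pi> t = (\<Prod>v\<leftarrow>vs. t - v)" for t
    unfolding \<pi>_def by (induction vs) (simp_all add: algebra_simps)
  then have "poly q t \<ge> 0" for t using C(2) by (simp add: q_def power2_eq_square)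
  ultimately have "poly (map_poly mconst q) f \<in> certified k" by (intro certified_compose_nonneg_poly)
  then have "poly (map_poly mconst q) f + mconst C * - (value_product vs f * value_product vs f) \<in> certified k"
    by (intro certified.add_mem certified_scale C(1) cert)
  moreover have "poly (map_poly mconst q) f = f - mconst \<gamma> + mconst C * (value_product vs f * value_product vs f)"
    unfolding q_def \<pi>_def map_mconst.hom_add map_mconst.hom_mult poly_add poly_mult compose_value_product
    by (simp add: mconst.map_poly_pCons_hom mconst.hom_uminus)
  ultimately show ?thesis by simp
qed

lemma tight_if_minus_one_mem:
  assumes "-1 \<in> iq_module"
  shows tight
proof (rule tight_if_certified)
  have "f \<in> certifiable" "1 \<in> certifiable" "-1 \<in> certifiable"
    using iq_module_certifiable iq_module.eq_UNIV_if_minus_one_mem[OF assms] by auto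
  then have "\<forall>\<^sub>F k in sequentially. f \<in> certified k" "\<forall>\<^sub>F k in sequentially. 1 \<in> certified k"
    "\<forall>\<^sub>F k in sequentially. -1 \<in> certified k" by (simp_all add: certifiable_def)
  then show "\<forall>\<^sub>F k in sequentially. \<forall>\<gamma>. ereal \<gamma> < min_value \<longrightarrow> f - mconst \<gamma> \<in> certified k"
  proof eventually_elim
    case (elim k)
    have "f - mconst \<gamma> \<in> certified k" for \<gamma>
      using certified.add_mem[OF elim(1) certified_scale[OF _ elim(2), of "- \<gamma>"]]
        certified.add_mem[OF elim(1) certified_scale[OF _ elim(3), of \<gamma>]]
      by (cases "\<gamma> \<ge> 0") (simp_all add: mconst.hom_uminus)
    then show ?case by blast
  qed
qed

lemma tight_if_value_certificate:
  assumes vs: "\<forall>v\<in>set vs. min_value \<le> ereal v" and cert: "- (value_product vs f * value_product vs f) \<in> iq_module"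
  shows tight
proof (cases "min_value = \<infinity>")
  case True
  then have "vs = []" using vs by (cases vs) auto
  then show ?thesis using tight_if_minus_one_mem cert by (simp add: value_product_def)
next
  case False
  then obtain v0 where v0: "min_value \<le> ereal v0" by (cases min_value) auto
  define ws where "ws = v0 # vs"
  have "(f - mconst v0) * (f - mconst v0) * - (value_product vs f * value_product vs f) \<in> iq_module"
    by (intro iq_module.scale_mem SOS_square cert)
  then have "- (value_product ws f * value_product ws f) \<in> iq_module"
    by (simp add: ws_def value_product_def mult_ac)
  then have "\<forall>\<^sub>F k in sequentially. - (value_product ws f * value_product ws f) \<in> certified k"
    using iq_module_certifiable by (auto simp: certifiable_def)
  moreover have "\<forall>\<^sub>F k in sequentially. (2 * length ws + 1) * mdeg f \<le> k" by (rule eventually_ge_at_top)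
  ultimately have "\<forall>\<^sub>F k in sequentially. \<forall>\<gamma>. ereal \<gamma> < min_value \<longrightarrow> f - mconst \<gamma> \<in> certified k"
  proof eventually_elim
    case (elim k)
    have "f - mconst \<gamma> \<in> certified k" if "ereal \<gamma> < min_value" for \<gamma>
    proof (rule certified_if_value_certificate[OF _ _ elim])
      show "\<forall>v\<in>set ws. \<gamma> < v" using less_le_trans[OF that] vs v0 by (fastforce simp: ws_def)
    qed (simp add: ws_def)
    then show ?case by blast
  qed
  then show ?thesis by (rule tight_if_certified)
qed

theorem tight_if_separating:
  assumes "\<rho> \<in> iq_module"
    and neg: "\<And>u. \<forall>h\<in>equations. meval h u = 0 \<Longrightarrow> ereal (meval f u) < min_value \<Longrightarrow> meval \<rho> u < 0"
  shows tight
proof -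
  obtain vs where "\<forall>v\<in>set vs. min_value \<le> ereal v"
    "- (value_product vs f * value_product vs f) \<in> cone_adjoin (sos_ideal equations) \<rho>"
    using critical_certificate[OF finite_index neg] by blast
  then show ?thesis
    using tight_if_value_certificate iq_module.cone_adjoin_sos_ideal_subset[OF Ideal_equations_subset assms(1)]
    by blast
qed

(* f takes only finitely many values below the minimum on the critical variety, and wherever it takes
   one of them some inequality fails. *)
theorem tight_if_archimedean:
  assumes "archimedean iq_module"
  shows tight
proof -
  obtain p0 where p0: "p0 \<in> iq_module" "compact {x. meval p0 x \<ge> 0}" using assms by (auto simp: archimedean_def)
  obtain vs where vs: "\<forall>u. (\<forall>h\<in>equations. meval h u = 0) \<longrightarrow> meval f u \<in> set vs"
    using finitely_many_critical_values[OF finite_index] by (rule exE)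
  define bs where "bs = filter (\<lambda>v. ereal v < min_value) vs"
  have "\<exists>g\<in>inequalities. meval g u < 0" if u: "\<forall>h\<in>insert (value_product bs f) equations. meval h u = 0" for u
  proof (rule ccontr)
    assume "\<not> ?thesis"
    then have "admissible u" using u by (simp add: admissible_def not_less)
    then have "min_value \<le> ereal (meval f u)" by (rule f_c_le)
    moreover have "meval f u \<in> set bs" using u by (simp add: meval_value_product_eq_0_iff)
    ultimately show False by (auto simp: bs_def)
  qed
  then obtain \<rho> where \<rho>: "\<rho> \<in> iq_module" "\<forall>u. meval (value_product bs f) u = 0 \<longrightarrow> meval \<rho> u < 0"
    using iq_module.negative_where_vanishing[OF p0 finite_equations Ideal_equations_subset
        finite_inequalities inequalities_subset]
    by blast
  show ?thesis
  proof (rule tight_if_separating[OF \<rho>(1)])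
    show "meval \<rho> u < 0" if "\<forall>h\<in>equations. meval h u = 0" "ereal (meval f u) < min_value" for u
      using \<rho>(2) vs that by (simp add: meval_value_product_eq_0_iff bs_def)
  qed
qed

lemma zero_of_equations_iff: "(\<forall>h\<in>equations. meval h u = 0) \<longleftrightarrow> (u, \<lambda>i. meval (p i) u) \<in> crit_pairs f c E I"
  unfolding critical_equations_def phi_set_def ball_Un by (auto simp: crit_pairs_def meval_simps)

lemma f_c_eq_critical_minimum:
  assumes "E \<inter> I = {}"
    and multipliers: "\<forall>(x, lam)\<in>crit_pairs f c E I. \<forall>i\<in>E \<union> I. lam i = meval (p i) x"
    and u: "u \<in> crit_points f c E I" "feasible c E I u"
    and opt: "\<And>x. feasible c E I x \<Longrightarrow> meval f u \<le> meval f x"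
  shows "min_value = ereal (meval f u)"
proof (rule antisym)
  obtain lam where lam: "(u, lam) \<in> crit_pairs f c E I" using u(1) by (auto simp: crit_points_def)
  then have lam_eq: "\<forall>i\<in>E \<union> I. lam i = meval (p i) u" using multipliers by blast
  have unique: "\<forall>lam'. (u, lam') \<in> crit_pairs f c E I \<longrightarrow> (\<forall>i\<in>E \<union> I. lam' i = lam i)"
    using multipliers lam_eq by fastforce
  have "meval (p j) u \<ge> 0" if "j \<in> I" for j
    using multiplier_nonneg[OF finite_index assms(1) lam unique u(2) opt that] lam_eq that by simp
  moreover have "(u, \<lambda>i. meval (p i) u) \<in> crit_pairs f c E I" using lam lam_eq by (auto simp: crit_pairs_def)
  ultimately have "admissible u"
    using u(2) unfolding admissible_def zero_of_equations_iff
    by (auto simp: inequalities_def feasible_def psi_set_def)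
  then show "min_value \<le> ereal (meval f u)" by (rule f_c_le)
  show "ereal (meval f u) \<le> min_value"
    unfolding f_c_conv_admissible
    by (rule Inf_greatest) (use opt in \<open>auto simp: admissible_def feasible_def critical_equations_def inequalities_def\<close>)
qed

lemma tight_if_negative_below_min_value:
  assumes "\<exists>\<rho>\<in>Qmod inequalities. \<forall>u\<in>crit_points f c E I. ereal (meval f u) < min_value \<longrightarrow> meval \<rho> u < 0"
  shows tight
proof -
  obtain \<rho> where \<rho>: "\<rho> \<in> Qmod inequalities" "\<forall>u\<in>crit_points f c E I. ereal (meval f u) < min_value \<longrightarrow> meval \<rho> u < 0"
    using assms by blast
  show ?thesis
  proof (rule tight_if_separating)
    show "\<rho> \<in> iq_module" using \<rho>(1) Qmod_inequalities_subset by blast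
    show "meval \<rho> u < 0" if "\<forall>h\<in>equations. meval h u = 0" "ereal (meval f u) < min_value" for u
      using \<rho>(2) that unfolding zero_of_equations_iff crit_points_def by blast
  qed
qed

end

theorem theorem3p3:
  fixes f :: "'v::finite mpoly"
    and c :: "'i \<Rightarrow> 'v mpoly"
    and p :: "'i \<Rightarrow> 'v mpoly"
    and E I :: "'i set"
  assumes "finite E" and "finite I" and "E \<inter> I = {}"
    and "crit_points f c E I \<noteq> {}"
    and assmA: "\<forall>(x, lam)\<in>crit_pairs f c E I. \<forall>i\<in>E \<union> I. lam i = meval (p i) x"
    and conds: "archimedean (set_plus_mp (IQ (c ` E) (c ` I)) (IQ (phi_set f c p E I) (psi_set p I)))
       \<or> archimedean (IQ (c ` E) (c ` I))
       \<or> (\<exists>\<rho>\<in>Qmod (c ` I \<union> psi_set p I). \<forall>u\<in>crit_points f c E I.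
             ereal (meval f u) < f_c f c p E I \<longrightarrow> meval \<rho> u < 0)"
  shows "(\<exists>K. \<forall>k\<ge>K. f_sos k f c p E I = f_c f c p E I \<and> f_mom k f c p E I = f_c f c p E I)
    \<and> (\<forall>u. u \<in> crit_points f c E I \<and> feasible c E I u \<and>
           (\<forall>x. feasible c E I x \<longrightarrow> meval f u \<le> meval f x) \<longrightarrow>
         (\<exists>K. \<forall>k\<ge>K. f_sos k f c p E I = ereal (meval f u) \<and> f_mom k f c p E I = ereal (meval f u)))"
proof -
  interpret critical_problem f c p E I by standard (fact assms)+
  have tight
    using conds
  proof (elim disjE)
    assume "archimedean (IQ (c ` E) (c ` I))"
    then have "archimedean iq_module" using IQ_subset_iq_module(1) unfolding archimedean_def by blast
    then show tight by (rule tight_if_archimedean)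
  qed (use tight_if_archimedean tight_if_negative_below_min_value in \<open>simp_all add: iq_module_def inequalities_def\<close>)
  moreover have "f_c f c p E I = ereal (meval f u)"
    if "u \<in> crit_points f c E I \<and> feasible c E I u \<and> (\<forall>x. feasible c E I x \<longrightarrow> meval f u \<le> meval f x)" for u
    using that f_c_eq_critical_minimum[OF assms(3) assmA] by blast
  ultimately show ?thesis unfolding tight_def by metis
qed

end
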